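(* Let $H\in\{2,-2\}$, let $D\subset\mathbb{C}$ be a simply connected domain containing $0$, and let $E(z,\bar z,\lambda)$, with $E(0,0,\lambda)=I$, be the normalized extended frame of a definite affine sphere on $D$ with affine mean curvature $H$, affine metric $e^\psi|dz|^2$ and cubic form coefficient $U$, with associated family $r_\lambda$. Let $\alpha\in\mathbb{C}^\times$, $|\alpha|\neq1$, and let $h(\lambda)=A\,g_{\alpha,\ell_1}(\lambda)\,g_{\bar\alpha^{-1},\ell_2}(\lambda)\in\Lambda^{\sigma,\tau}_I\mathrm{GL}(3,\mathbb{C})$ with $A=\mathrm{diag}(d,d^{-1},1)$. Suppose that for every $z\in D$ both $$\tilde\ell_2:=\ell_2E(z,\bar z,\bar\alpha^{-1})=\mathbb{C}\cdot(\tilde b_2,\tilde c_2,1),\qquad \tilde\ell_1:=\ell_1\,g_{\bar\alpha^{-1},\ell_2}(\alpha)\,E(z,\bar z,\alpha)\,g_{\bar\alpha^{-1},\tilde\ell_2}(\alpha)^{-1}=\mathbb{C}\cdot(\tilde b_1,\tilde c_1,1)$$ are not contained in $\Delta$, and $(2\tilde b_1\tilde c_1-1)(2\tilde b_2\tilde c_2-1)>0$. Define $\tilde d=\sqrt{(2\tilde b_1\tilde c_1-1)(2\tilde b_2\tilde c_2-1)}$ and $\tilde A=\mathrm{diag}(\tilde d,\tilde d^{-1},1)$. Then: (i) there is a factorization $$A\,g_{\alpha,\ell_1}(\lambda)\,g_{\bar\alpha^{-1},\ell_2}(\lambda)\,E(z,\bar z,\lambda)=\tilde E(z,\bar z,\lambda)\,\tilde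 A(z,\bar z)\,g_{\alpha,\tilde\ell_1(z,\bar z)}(\lambda)\,g_{\bar\alpha^{-1},\tilde\ell_2(z,\bar z)}(\lambda)$$ with $\tilde E(z,\bar z,\cdot)\in\Lambda^{\sigma,\tau}_{\mathbb{C}^\times}\mathrm{SL}(3,\mathbb{C})$ and $\tilde A\,g_{\alpha,\tilde\ell_1}g_{\bar\alpha^{-1},\tilde\ell_2}\in\Lambda^{\sigma,\tau}_I\mathrm{GL}(3,\mathbb{C})$; (ii) $\tilde E$ is the extended frame of a new definite affine sphere, which, up to a constant invertible linear transformation, is given explicitly by $\tilde r:=N\,h(\lambda)^{-1}\tilde E\,e_3$, namely, with $r=r_\lambda$ and $k:=\sqrt{-2H}\,e^{-\psi/2}$, $$\tilde r=N\,\frac{\alpha\lambda^3\tilde b_1\left\{-2k\left[\lambda^3\bar\alpha^3(2\tilde b_2\tilde c_2-1)-1\right]r_{\bar z}+4k\bar\alpha^2\tilde c_2^2\,r_z+4H\bar\alpha\tilde c_2\,r\right\}}{(\lambda^3\bar\alpha^3+1)(2\tilde b_2\tilde c_2-1)(\lambda^3+\alpha^3)}$$ $$\quad+N\,\frac{\alpha^2\tilde c_1\left[4k\bar\alpha\lambda^3\tilde b_2^2\,r_{\bar z}+2k(\lambda^3\bar\alpha^3+1-2\tilde b_2\tilde c_2)\,r_z+4H\bar\alpha^2\lambda^3\tilde b_2\,r\right]}{(\lambda^3\bar\alpha^3+1)(\lambda^3+\alpha^3)}$$ $$\quad+N\,\frac{(-\lambda^3+\alpha^3)\left[2k\bar\alpha^2\lambda^3\tilde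 b_2\,r_{\bar z}-2k\bar\alpha\tilde c_2\,r_z+H(\lambda^3\bar\alpha^3-1)\,r\right]}{(\lambda^3\bar\alpha^3+1)(\lambda^3+\alpha^3)},\qquad N=\begin{pmatrix}\frac1{\sqrt2}&\frac1{\sqrt2}&0\\ \frac{i}{\sqrt2}&\frac{-i}{\sqrt2}&0\\0&0&\sqrt{H/2}\end{pmatrix};$$ (iii) the new definite affine sphere has affine metric $\tilde d^2e^\psi|dz|^2$, the same affine cubic form and the same affine mean curvature (i.e. $\tilde E^{-1}d\tilde E$ is the Maurer-Cartan form $\alpha_\lambda$ built from $\tilde\psi=\psi+\ln\tilde d^2$ and the same $U$, $H$).
   Context: $H=-2$ is the hyperbolic and $H=2$ the elliptic case. Put $\epsilon=e^{\pi i/3}$, $e_3=(0,0,1)^t$ and $$T=\begin{pmatrix}0&1&0\\1&0&0\\0&0&-H/2\end{pmatrix},\qquad P=\begin{pmatrix}0&\epsilon^4&0\\ \epsilon^2&0&0\\0&0&1\end{pmatrix},\qquad \tau(g)=T\bar gT^{-1},\qquad \sigma(g)=P(g^t)^{-1}P^{-1}.$$ For small $0<r_0<1$ let $I=\{|\lambda|<r_0\}\cup\{\lambda\in\mathbb{C}\cup\{\infty\}:|\lambda|>1/r_0\}$, with $r_0<|\alpha|<1/r_0$. $\Lambda_I^{\sigma,\tau}\mathrm{GL}(3,\mathbb{C})$ (resp. $\Lambda^{\sigma,\tau}_{\mathbb{C}^\times}\mathrm{SL}(3,\mathbb{C})$) is the group of holomorphic maps $g$ from $I$ to $\mathrm{GL}(3,\mathbb{C})$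 (resp. from $\mathbb{C}\setminus\{0\}$ to $\mathrm{SL}(3,\mathbb{C})$) with $\tau(g(\bar\lambda^{-1}))=g(\lambda)$ and $\sigma(g(\lambda))=g(\epsilon\lambda)$. Extended frames: a definite affine sphere in $\mathbb{R}^3$ with affine mean curvature $H$, affine metric $e^\psi|dz|^2$ and affine cubic form $U\,dz^3+\bar U\,d\bar z^3$ satisfies $\psi_{z\bar z}+\frac H2e^\psi+|U|^2e^{-2\psi}=0$, $U_{\bar z}=0$, and is determined by $(\psi,U,H)$ up to equiaffine motions. With $s=\sqrt{-H/2}\in\{1,i\}$, its Maurer-Cartan form is $$\alpha_\lambda=\begin{pmatrix}\frac12(\psi_z dz-\psi_{\bar z}d\bar z)&\lambda^{-1}\bar Ue^{-\psi}d\bar z& s\lambda e^{\psi/2}dz\\ \lambda Ue^{-\psi}dz&\frac12(\psi_{\bar z}d\bar z-\psi_zdz)& s\lambda^{-1}e^{\psi/2}d\bar z\\ s\lambda^{-1}e^{\psi/2}d\bar z& s\lambda e^{\psi/2}dz&0\end{pmatrix},$$ an extended frame is a smooth solution $E(z,\bar z,\lambda)\in\Lambda^{\sigma,\tau}_{\mathbb{C}^\times}\mathrm{SL}(3,\mathbb{C})$ of $E^{-1}dE=\alpha_\lambda$, and the associated family is $r_\lambda:=-H^{-1}Ee_3$ ($\mathbb{C}^3$-valued); for $|\lambda|=1$ it represents, up to a constant invertible complex linear transformation, the affine sphere with data $(\psi,\lambda^3U,H)$. One has $E=(\lambda^{-1}\sqrt{-2H}\,e^{-\psi/2}(r_\lambda)_z,\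 \lambda\sqrt{-2H}\,e^{-\psi/2}(r_\lambda)_{\bar z},\ -Hr_\lambda)$ with $\sqrt{-2H}=2s$. $\Delta:=\{(z_1,z_2,z_3)\in\mathbb{C}^3:2z_1z_2=z_3^2\text{ or }z_3=0\}$. For $\alpha\in\mathbb{C}^\times$ and a line $\ell=\mathbb{C}\cdot(b,c,1)\nsubseteq\Delta$ (i.e. $2bc\neq1$) put $$g_{\alpha,\ell}(\lambda)=I+\frac{2}{\lambda^3-\alpha^3}\begin{pmatrix}\frac{\alpha^3bc}{2bc-1}&\frac{\alpha\lambda^2c^2}{2bc-1}&\frac{\alpha^2\lambda c}{2bc-1}\\ \alpha^2\lambda b^2&\alpha^3bc&\alpha\lambda^2b\\ \alpha\lambda^2b&\alpha^2\lambda c&\alpha^3\end{pmatrix}$$ (in matrix formulas $I$ is the identity matrix). $\ell M=\{vM:v\in\ell\}$ for a matrix $M$. *)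

theory Defs
  imports "HOL-Analysis.Analysis"
begin

primrec ck_on :: "nat \<Rightarrow> 'a::real_normed_vector set \<Rightarrow> ('a \<Rightarrow> 'b::real_normed_vector) \<Rightarrow> bool" where
  "ck_on 0 S f \<longleftrightarrow> continuous_on S f"
| "ck_on (Suc k) S f \<longleftrightarrow>
     (\<forall>x\<in>S. f differentiable (at x)) \<and> (\<forall>v. ck_on k S (\<lambda>x. frechet_derivative f (at x) v))"

text \<open>Real \<open>C\<^sup>\<infinity>\<close>-smoothness; only used on open sets of finite-dimensional spaces.\<close>

definition smooth_on :: "'a::real_normed_vector set \<Rightarrow> ('a \<Rightarrow> 'b::real_normed_vector) \<Rightarrow> bool" where
  "smooth_on S f \<longleftrightarrow> (\<forall>k. ck_on k S f)"

definition dirderiv :: "(complex \<Rightarrow> 'b::real_normed_vector) \<Rightarrow> complex \<Rightarrow> complex \<Rightarrow> 'b" where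
  "dirderiv f X z = frechet_derivative f (at z) X"

text \<open>The Wirtinger derivatives \<open>f\<^sub>z\<close> and \<open>f\<^sub>z\<^sub>b\<close> (derivative in the conjugate variable), for
  scalar functions and componentwise for \<open>\<complex>\<^sup>3\<close>-valued ones.\<close>

definition wirt_z :: "(complex \<Rightarrow> complex) \<Rightarrow> complex \<Rightarrow> complex" where
  "wirt_z f z = (dirderiv f 1 z - \<i> * dirderiv f \<i> z) / 2"

definition wirt_zb :: "(complex \<Rightarrow> complex) \<Rightarrow> complex \<Rightarrow> complex" where
  "wirt_zb f z = (dirderiv f 1 z + \<i> * dirderiv f \<i> z) / 2"

definition wirt_z_vec :: "(complex \<Rightarrow> complex^3) \<Rightarrow> complex \<Rightarrow> complex^3" where
  "wirt_z_vec f z = (\<chi> i. wirt_z (\<lambda>w. f w $ i) z)"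

definition wirt_zb_vec :: "(complex \<Rightarrow> complex^3) \<Rightarrow> complex \<Rightarrow> complex^3" where
  "wirt_zb_vec f z = (\<chi> i. wirt_zb (\<lambda>w. f w $ i) z)"

text \<open>
  \<open>f : D \<rightarrow> \<real>\<^sup>3\<close> is a Blaschke immersion with affine normal \<open>\<xi>\<close> and induced connection
  \<open>\<nabla>\<close>, where \<open>C z X Y\<close> is the value at \<open>z\<close> of \<open>\<nabla>\<^sub>X Y\<close> for constant vector fields \<open>X, Y\<close>
  (tangent vectors of \<open>D\<close> are complex numbers, and \<open>\<bullet>\<close> on them is \<open>Re (X * cnj Y)\<close>).
  The clauses say, in this order: the affine normal is equiaffinely normalised, i.e. the
  volume of \<open>(f\<^sub>x, f\<^sub>y, \<xi>)\<close> is the area density \<open>e\<^sup>\<psi>\<close> of the affine metric; Gauss formula with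
  affine metric \<open>e\<^sup>\<psi> |dz|\<^sup>2\<close>; the shape operator is \<open>H\<close> times the identity; the cubic form
  \<open>2 h(\<nabla>\<^sub>X Y - \<nabla>\<^sup>0\<^sub>X Y, Z)\<close> equals \<open>U dz\<^sup>3\<close> plus its conjugate.  Here \<open>\<nabla>\<^sup>0\<close> is the Levi-Civita
  connection of the affine metric, \<open>\<nabla>\<^sup>0\<^sub>X Y = \<psi>\<^sub>z X Y\<close> for constant \<open>X, Y\<close>.
  In complex coordinates this is \<open>f\<^sub>z\<^sub>z = \<psi>\<^sub>z f\<^sub>z + U e\<^sup>-\<^sup>\<psi> f\<^sub>z\<^sub>b\<close>, \<open>f\<^sub>z\<^sub>z\<^sub>b = e\<^sup>\<psi> \<xi> / 2\<close>,
  \<open>\<xi>\<^sub>z = - H f\<^sub>z\<close>; the compatibility conditions of this system (the equation for \<open>\<psi>\<close> and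
  holomorphy of \<open>U\<close>) are consequences.
\<close>

definition definite_affine_sphere ::
  "complex set \<Rightarrow> real \<Rightarrow> (complex \<Rightarrow> real) \<Rightarrow> (complex \<Rightarrow> complex) \<Rightarrow> (complex \<Rightarrow> real^3) \<Rightarrow> bool" where
  "definite_affine_sphere D H \<psi> U f \<longleftrightarrow>
     smooth_on D f \<and> smooth_on D \<psi> \<and>
     (\<exists>\<xi> C. smooth_on D \<xi> \<and>
       (\<forall>z\<in>D.
          det (vector [dirderiv f 1 z, dirderiv f \<i> z, \<xi> z] :: real^3^3) = exp (\<psi> z) \<and>
          (\<forall>X Y. dirderiv (dirderiv f Y) X z
                   = dirderiv f (C z X Y) z + (exp (\<psi> z) * (X \<bullet> Y)) *\<^sub>R \<xi> z) \<and>
          (\<forall>X. dirderiv \<xi> X z = - H *\<^sub>R dirderiv f X z) \<and>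
          (\<forall>X Y Z. 2 * exp (\<psi> z) * ((C z X Y - wirt_z (\<lambda>w. of_real (\<psi> w)) z * X * Y) \<bullet> Z)
                   = Re (U z * X * Y * Z + cnj (U z * X * Y * Z)))))"

definition eps :: complex where
  "eps = exp (\<i> * of_real pi / 3)"

definition Tmat :: "real \<Rightarrow> complex^3^3" where
  "Tmat H = vector [vector [0, 1, 0], vector [1, 0, 0], vector [0, 0, - of_real H / 2]]"

definition Pmat :: "complex^3^3" where
  "Pmat = vector [vector [0, eps^4, 0], vector [eps^2, 0, 0], vector [0, 0, 1]]"

definition tau :: "real \<Rightarrow> complex^3^3 \<Rightarrow> complex^3^3" where
  "tau H g = Tmat H ** map_matrix cnj g ** matrix_inv (Tmat H)"

definition sigma :: "complex^3^3 \<Rightarrow> complex^3^3" where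
  "sigma g = Pmat ** matrix_inv (transpose g) ** matrix_inv Pmat"

definition mat_holomorphic_on :: "(complex \<Rightarrow> complex^3^3) \<Rightarrow> complex set \<Rightarrow> bool" where
  "mat_holomorphic_on g S \<longleftrightarrow> (\<forall>i j. (\<lambda>l. g l $ i $ j) holomorphic_on S)"

definition loop_SL :: "real \<Rightarrow> (complex \<Rightarrow> complex^3^3) \<Rightarrow> bool" where
  "loop_SL H g \<longleftrightarrow>
     mat_holomorphic_on g (- {0}) \<and>
     (\<forall>l. l \<noteq> 0 \<longrightarrow> det (g l) = 1 \<and> tau H (g (inverse (cnj l))) = g l \<and> sigma (g l) = g (eps * l))"

text \<open>
  Loops on \<open>I = {|\<lambda>| < r0} \<union> {|\<lambda>| > 1/r0}\<close>, a subset of the Riemann sphere.  A map on \<open>I\<close> is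
  given by \<open>g\<close> on the finite points and its value \<open>ginf\<close> at infinity; \<open>g'\<close> is the map in the chart
  \<open>w = 1/\<lambda>\<close> on the disc around infinity.  In that chart \<open>\<lambda> \<mapsto> \<epsilon> \<lambda>\<close> becomes \<open>w \<mapsto> w / \<epsilon>\<close>, and
  \<open>\<lambda> \<mapsto> inverse (cnj \<lambda>)\<close> exchanges the two discs by \<open>cnj\<close>.
\<close>

definition loop_GL :: "real \<Rightarrow> real \<Rightarrow> (complex \<Rightarrow> complex^3^3) \<Rightarrow> bool" where
  "loop_GL H r0 g \<longleftrightarrow>
     (\<exists>ginf g'. g' = (\<lambda>w. if w = 0 then ginf else g (inverse w)) \<and>
        mat_holomorphic_on g (ball 0 r0) \<and> mat_holomorphic_on g' (ball 0 r0) \<and>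
        (\<forall>l\<in>ball 0 r0.
           invertible (g l) \<and> invertible (g' l) \<and>
           tau H (g' (cnj l)) = g l \<and> tau H (g (cnj l)) = g' l \<and>
           sigma (g l) = g (eps * l) \<and> sigma (g' l) = g' (l / eps)))"

text \<open>The form \<open>\<alpha>\<^sub>\<lambda>\<close> at \<open>z\<close>, evaluated on the tangent vector \<open>X\<close>: \<open>dz\<close> becomes \<open>X\<close> and its
  conjugate \<open>cnj X\<close>.  As \<open>H\<close> is 2 or -2, \<open>csqrt\<close> takes the values \<open>1\<close> and \<open>\<i>\<close> here and below.\<close>

definition mc_form ::
  "real \<Rightarrow> (complex \<Rightarrow> real) \<Rightarrow> (complex \<Rightarrow> complex) \<Rightarrow> complex \<Rightarrow> complex \<Rightarrow> complex \<Rightarrow> complex^3^3" where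
  "mc_form H \<psi> U l z X =
     (let s = csqrt (- of_real H / 2);
          e = of_real (exp (\<psi> z / 2));
          em = of_real (exp (- \<psi> z));
          pz = wirt_z (\<lambda>w. of_real (\<psi> w)) z;
          pzb = wirt_zb (\<lambda>w. of_real (\<psi> w)) z;
          dz = X;
          dzb = cnj X
      in vector [
           vector [(pz * dz - pzb * dzb) / 2, inverse l * cnj (U z) * em * dzb, s * l * e * dz],
           vector [l * U z * em * dz, (pzb * dzb - pz * dz) / 2, s * inverse l * e * dzb],
           vector [s * inverse l * e * dzb, s * l * e * dz, 0]])"

definition extended_frame ::
  "complex set \<Rightarrow> real \<Rightarrow> (complex \<Rightarrow> real) \<Rightarrow> (complex \<Rightarrow> complex)
     \<Rightarrow> (complex \<Rightarrow> complex \<Rightarrow> complex^3^3) \<Rightarrow> bool" where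
  "extended_frame D H \<psi> U E \<longleftrightarrow>
     smooth_on (D \<times> (- {0})) (\<lambda>(z, l). E z l) \<and>
     (\<forall>z\<in>D. loop_SL H (E z)) \<and>
     (\<forall>z\<in>D. \<forall>l. l \<noteq> 0 \<longrightarrow>
        (\<forall>X. matrix_inv (E z l) ** dirderiv (\<lambda>w. E w l) X z = mc_form H \<psi> U l z X))"

definition e3 :: "complex^3" where
  "e3 = vector [0, 0, 1]"

definition assoc_family :: "real \<Rightarrow> (complex \<Rightarrow> complex \<Rightarrow> complex^3^3) \<Rightarrow> complex \<Rightarrow> complex \<Rightarrow> complex^3" where
  "assoc_family H E l z = (- inverse (of_real H)) *s (E z l *v e3)"

definition Delta :: "(complex^3) set" where
  "Delta = {z. 2 * z$1 * z$2 = (z$3)^2 \<or> z$3 = 0}"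

definition cline :: "complex \<Rightarrow> complex \<Rightarrow> (complex^3) set" where
  "cline b c = range (\<lambda>t. t *s vector [b, c, 1])"

definition line_mult :: "(complex^3) set \<Rightarrow> complex^3^3 \<Rightarrow> (complex^3) set" where
  "line_mult L M = (\<lambda>v. v v* M) ` L"

text \<open>\<open>gfac \<alpha> b c\<close> is \<open>g\<^sub>\<alpha>\<^sub>,\<^sub>l\<close> for the line \<open>l = cline b c\<close>; the line determines \<open>b\<close> and \<open>c\<close>.\<close>

definition gfac :: "complex \<Rightarrow> complex \<Rightarrow> complex \<Rightarrow> complex \<Rightarrow> complex^3^3" where
  "gfac \<alpha> b c l =
     mat 1 + map_matrix (\<lambda>x. 2 / (l^3 - \<alpha>^3) * x)
       (vector [
          vector [\<alpha>^3 * b * c / (2*b*c - 1), \<alpha> * l^2 * c^2 / (2*b*c - 1), \<alpha>^2 * l * c / (2*b*c - 1)],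
          vector [\<alpha>^2 * l * b^2, \<alpha>^3 * b * c, \<alpha> * l^2 * b],
          vector [\<alpha> * l^2 * b, \<alpha>^2 * l * c, \<alpha>^3]])"

definition Adiag :: "complex \<Rightarrow> complex^3^3" where
  "Adiag d = vector [vector [d, 0, 0], vector [0, inverse d, 0], vector [0, 0, 1]]"

definition dressing ::
  "complex \<Rightarrow> complex \<Rightarrow> complex \<Rightarrow> complex \<Rightarrow> complex \<Rightarrow> complex \<Rightarrow> complex \<Rightarrow> complex^3^3" where
  "dressing \<alpha> d b1 c1 b2 c2 l = Adiag d ** gfac \<alpha> b1 c1 l ** gfac (inverse (cnj \<alpha>)) b2 c2 l"

definition Nmat :: "real \<Rightarrow> complex^3^3" where
  "Nmat H = vector [
     vector [1 / of_real (sqrt 2), 1 / of_real (sqrt 2), 0],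
     vector [\<i> / of_real (sqrt 2), - \<i> / of_real (sqrt 2), 0],
     vector [0, 0, csqrt (of_real H / 2)]]"

text \<open>The vector to which \<open>N\<close> is applied in the explicit formula for the new affine sphere;
  \<open>r, rz, rzb\<close> stand for the associated family and its two derivatives.\<close>

definition new_sphere ::
  "complex \<Rightarrow> complex \<Rightarrow> complex \<Rightarrow> complex \<Rightarrow> complex \<Rightarrow> complex \<Rightarrow> complex \<Rightarrow> complex
     \<Rightarrow> complex^3 \<Rightarrow> complex^3 \<Rightarrow> complex^3 \<Rightarrow> complex^3" where
  "new_sphere H k \<alpha> b1 c1 b2 c2 l r rz rzb =
     (let a = cnj \<alpha> in
       (\<alpha> * l^3 * b1 / ((l^3 * a^3 + 1) * (2*b2*c2 - 1) * (l^3 + \<alpha>^3))) *s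
         ((- 2 * k * (l^3 * a^3 * (2*b2*c2 - 1) - 1)) *s rzb
          + (4 * k * a^2 * c2^2) *s rz
          + (4 * H * a * c2) *s r)
     + (\<alpha>^2 * c1 / ((l^3 * a^3 + 1) * (l^3 + \<alpha>^3))) *s
         ((4 * k * a * l^3 * b2^2) *s rzb
          + (2 * k * (l^3 * a^3 + 1 - 2*b2*c2)) *s rz
          + (4 * H * a^2 * l^3 * b2) *s r)
     + ((- (l^3) + \<alpha>^3) / ((l^3 * a^3 + 1) * (l^3 + \<alpha>^3))) *s
         ((2 * k * a^2 * l^3 * b2) *s rzb
          - (2 * k * a * c2) *s rz
          + (H * (l^3 * a^3 - 1)) *s r))"

end

theory Submission
  imports Defs "HOL-Complex_Analysis.Conformal_Mappings"
begin

text \<open>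
  The factorization forces \<open>Et = h E ht\<^sup>-\<^sup>1\<close>, and one shows that this product extends holomorphically
  across the poles of its factors.  A simple factor has residues of rank one whose row space is the (rotated)
  line, and its inverse annihilates that line at the pole.  As the lines \<open>l2~\<close> and \<open>l1~\<close> are the images of \<open>l2\<close>
  and \<open>l1\<close> under the frame, all residues of the product vanish; the symmetry sigma reduces the twelve
  poles to two.

  By the reality of \<open>h\<close> and \<open>E\<close>, the defect of the reality condition is the same for \<open>Et\<close> and \<open>ht\<close>.  It is
  holomorphic off 0 by the first description and bounded near 0 and infinity by the second, hence constant, and
  the choice of \<open>dt\<close> makes it trivial at 0.

  Similarly \<open>Et\<^sup>-\<^sup>1 dEt = ht \<alpha>\<^sub>\<lambda> ht\<^sup>-\<^sup>1 - dht ht\<^sup>-\<^sup>1\<close> has at most simple poles at 0 and infinity, with leading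
  coefficients read off from the diagonal values \<open>ht 0\<close> and \<open>ht \<infinity>\<close>.  They are those of the Maurer-Cartan
  form with the metric \<open>\<psi> + ln dt\<^sup>2\<close>, and Liouville's theorem excludes any difference.
\<close>

subsection \<open>Smooth maps\<close>

text \<open>An extended frame must be smooth jointly in \<open>z\<close> and \<open>l\<close>, also
  where \<open>h\<close> or the inverse of \<open>ht\<close> has a pole. Removing singularities for
  each fixed \<open>z\<close> gives holomorphy in \<open>l\<close> but says nothing about
  \<open>z\<close>; hence the calculus of \<open>C^k\<close> maps and parameter integrals that
  precedes the geometry. Joint smoothness serves again when z-derivatives are evaluated in the
  limits \<open>l\<close> to 0 and to infinity.

  The value of \<open>dt\<close> comes from comparing the two ends of the loop. Let x and y be the
  numbers 2bc-1 of the two new lines. The product of the two simple factors is diag(1/(xy), xy, 1)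
  at 0 and the identity at infinity, so \<open>ht\<close> is diag(dt/(xy), xy/dt, 1) at 0 and
  diag(dt, 1/dt, 1) at infinity. The reality condition exchanges the ends and inverts real diagonal
  matrices of this kind, which forces dt^2 = xy.

  The explicit formula rests on \<open>h\<close>^-1 \<open>Et\<close> = \<open>E\<close>
  \<open>ht\<close>^-1: only the third column of the inverse of \<open>ht\<close> enters, and the
  columns of \<open>E\<close> are multiples of \<open>r\<close> and its two derivatives.\<close>

lemma ck_on_cong:
  assumes "open S" "\<And>x. x \<in> S \<Longrightarrow> f x = g x" "ck_on k S f"
  shows "ck_on k S g"
  using assms(2,3)
proof (induction k arbitrary: f g)
  case 0
  then show ?case by (simp cong: continuous_on_cong)
next
  case (Suc k)
  have d: "f differentiable (at x)" if "x \<in> S" for x using Suc.prems that by simp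
  have hd: "(g has_derivative frechet_derivative f (at x)) (at x)" if "x \<in> S" for x
    using d[OF that] has_derivative_transform_within_open[OF _ assms(1) that Suc.prems(1)]
    by (simp add: frechet_derivative_works)
  have e: "frechet_derivative f (at x) = frechet_derivative g (at x)" if "x \<in> S" for x
    using frechet_derivative_at[OF hd[OF that]] .
  have "ck_on k S (\<lambda>x. frechet_derivative g (at x) v)" for v
    by (rule Suc.IH[of "\<lambda>x. frechet_derivative f (at x) v"]) (use e Suc.prems in auto)
  with hd show ?case by (auto simp: differentiable_def)
qed

text \<open>Derivatives are usually known in closed form, whereas \<open>ck_on\<close> speaks of
  \<open>frechet_derivative\<close>; uniqueness of the derivative and \<open>ck_on_cong\<close>
  bridge the two. Most closure properties below go through this rule.\<close>

lemma ck_on_SucI: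
  assumes "open S" "\<And>x. x \<in> S \<Longrightarrow> (f has_derivative f' x) (at x)" "\<And>v. ck_on k S (\<lambda>x. f' x v)"
  shows "ck_on (Suc k) S f"
proof -
  have "ck_on k S (\<lambda>x. frechet_derivative f (at x) v)" for v
    by (rule ck_on_cong[OF assms(1) _ assms(3)[of v]]) (simp add: frechet_derivative_at[OF assms(2)])
  with assms(2) show ?thesis by (auto simp: differentiable_def)
qed

lemma ck_on_SucD:
  assumes "ck_on (Suc k) S f" "x \<in> S"
  shows "(f has_derivative frechet_derivative f (at x)) (at x)"
  using assms by (simp add: frechet_derivative_works)

lemma ck_on_Suc_imp: "ck_on (Suc k) S f \<Longrightarrow> ck_on k S f"
proof (induction k arbitrary: f)
  case 0
  then show ?case
    by (auto intro!: continuous_at_imp_continuous_on differentiable_imp_continuous_within)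
next
  case (Suc k)
  from Suc.prems have "ck_on k S (\<lambda>x. frechet_derivative f (at x) v)" for v
    by (intro Suc.IH) simp
  with Suc.prems show ?case by simp
qed

lemma ck_on_subset: "ck_on k S f \<Longrightarrow> T \<subseteq> S \<Longrightarrow> ck_on k T f"
  by (induction k arbitrary: f) (auto intro: continuous_on_subset)

lemma ck_on_const: "ck_on k S (\<lambda>x. c)"
proof (induction k arbitrary: c)
  case (Suc k)
  then show ?case by simp
qed simp

lemma ck_on_linear:
  assumes "bounded_linear L" "open S" "ck_on k S f"
  shows "ck_on k S (\<lambda>x. L (f x))"
  using assms(3)
proof (induction k arbitrary: f)
  case 0
  then show ?case
    using assms(1) by (auto intro: bounded_linear.continuous_on)
next
  case (Suc k)
  show ?case
    by (rule ck_on_SucI[OF assms(2), where f' = "\<lambda>x v. L (frechet_derivative f (at x) v)"])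
       (use Suc in \<open>auto intro!: bounded_linear.has_derivative[OF assms(1)] ck_on_SucD\<close>)
qed

lemma ck_on_id: "open S \<Longrightarrow> ck_on k S (\<lambda>x. x)"
  by (cases k) (auto intro!: ck_on_SucI[where f' = "\<lambda>x v. v"] ck_on_const)

lemma ck_on_add:
  assumes "open S" "ck_on k S f" "ck_on k S g"
  shows "ck_on k S (\<lambda>x. f x + g x)"
  using assms(2,3)
proof (induction k arbitrary: f g)
  case 0
  then show ?case by (auto intro: continuous_intros)
next
  case (Suc k)
  show ?case
    by (rule ck_on_SucI[OF assms(1), where f' = "\<lambda>x v. frechet_derivative f (at x) v + frechet_derivative g (at x) v"])
       (use Suc in \<open>auto intro!: has_derivative_add ck_on_SucD\<close>)
qed

lemma ck_on_sum:
  assumes "open S" "\<And>i. i \<in> I \<Longrightarrow> ck_on k S (f i)"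
  shows "ck_on k S (\<lambda>x. \<Sum>i\<in>I. f i x)"
  using assms(2)
  by (induction I rule: infinite_finite_induct) (auto intro: ck_on_const ck_on_add[OF assms(1)])

text \<open>The Leibniz rule writes the derivative as \<open>B\<close> applied to \<open>f\<close>,
  \<open>g\<close> and their derivatives, all of class \<open>k\<close>, so the induction closes
  once \<open>f\<close> and \<open>g\<close> are arbitrary.\<close>

lemma ck_on_bilinear:
  assumes "bounded_bilinear B" "open S" "ck_on k S f" "ck_on k S g"
  shows "ck_on k S (\<lambda>x. B (f x) (g x))"
  using assms(3,4)
proof (induction k arbitrary: f g)
  case 0
  then show ?case using assms(1) by (auto intro: bounded_bilinear.continuous_on)
next
  case (Suc k)
  have "ck_on k S f" "ck_on k S g" using Suc.prems ck_on_Suc_imp by blast+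
  then have "ck_on k S (\<lambda>x. B (f x) (frechet_derivative g (at x) v) + B (frechet_derivative f (at x) v) (g x))" for v
    using Suc.prems by (intro ck_on_add assms Suc.IH) auto
  then show ?case
    by (intro ck_on_SucI[OF assms(2), where f' = "\<lambda>x v. B (f x) (frechet_derivative g (at x) v) + B (frechet_derivative f (at x) v) (g x)"])
       (use Suc in \<open>auto intro!: bounded_bilinear.FDERIV[OF assms(1)] ck_on_SucD\<close>)
qed

lemma ck_on_compose:
  fixes f :: "'a::real_normed_vector \<Rightarrow> 'b::euclidean_space"
  assumes "open S" "open T" "ck_on k S f" "ck_on k T g" "f ` S \<subseteq> T"
  shows "ck_on k S (\<lambda>x. g (f x))"
  using assms(3,4)
proof (induction k arbitrary: g)
  case 0
  then show ?case using assms(5) by (auto intro: continuous_on_compose2)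
next
  case (Suc k)
  \<comment> \<open>The chain rule expanded in a basis of the middle space: a finite sum of scalar
    functions times partial derivatives of \<open>g\<close> composed with \<open>f\<close>. In this
    form the induction hypothesis and the product rule apply.\<close>
  let ?D = "\<lambda>x v. \<Sum>b\<in>Basis. (frechet_derivative f (at x) v \<bullet> b) *\<^sub>R frechet_derivative g (at (f x)) b"
  have "ck_on k S f" using Suc.prems ck_on_Suc_imp by blast
  then have 1: "ck_on k S (\<lambda>x. frechet_derivative g (at (f x)) b)" for b
    using Suc.prems by (intro Suc.IH) auto
  have "ck_on k S (\<lambda>x. ?D x v)" for v
    using 1 Suc.prems
    by (intro ck_on_sum ck_on_bilinear[OF bounded_bilinear_scaleR] ck_on_linear[OF bounded_linear_inner_left]
        assms(1)) auto
  moreover have "((\<lambda>x. g (f x)) has_derivative ?D x) (at x)" if "x \<in> S" for x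
  proof -
    have gd: "(g has_derivative frechet_derivative g (at (f x))) (at (f x))"
      using Suc.prems(2) assms(5) that by (intro ck_on_SucD) auto
    have lin: "linear (frechet_derivative g (at (f x)))"
      using gd has_derivative_linear by blast
    have "?D x = (\<lambda>v. frechet_derivative g (at (f x)) (frechet_derivative f (at x) v))"
    proof
      fix v
      have "frechet_derivative g (at (f x)) (frechet_derivative f (at x) v) =
        frechet_derivative g (at (f x)) (\<Sum>b\<in>Basis. (frechet_derivative f (at x) v \<bullet> b) *\<^sub>R b)"
        by (simp add: euclidean_representation)
      also have "\<dots> = ?D x v"
        using lin by (simp add: linear_sum linear_scale)
      finally show "?D x v = frechet_derivative g (at (f x)) (frechet_derivative f (at x) v)" ..
    qed
    moreover have "((\<lambda>x. g (f x)) has_derivative (\<lambda>v. frechet_derivative g (at (f x)) (frechet_derivative f (at x) v))) (at x)"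
      by (rule has_derivative_compose[OF ck_on_SucD[OF Suc.prems(1) that] gd])
    ultimately show ?thesis by simp
  qed
  ultimately show ?case by (intro ck_on_SucI[OF assms(1)]) auto
qed

lemma ck_on_locally:
  assumes "\<And>x. x \<in> S \<Longrightarrow> \<exists>T. open T \<and> x \<in> T \<and> ck_on k T f"
  shows "ck_on k S f"
  using assms
proof (induction k arbitrary: f)
  case 0
  then show ?case
    by (auto intro!: continuous_at_imp_continuous_on) (metis continuous_on_eq_continuous_at)
next
  case (Suc k)
  have "f differentiable (at x)" if "x \<in> S" for x
    using Suc.prems[OF that] by auto
  moreover have "ck_on k S (\<lambda>x. frechet_derivative f (at x) v)" for v
    by (rule Suc.IH) (use Suc.prems in fastforce)
  ultimately show ?case by simp
qed

text \<open>The derivative is again a polynomial in \<open>inverse\<close>, so each degree of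
  smoothness yields the next. The same bootstrap serves \<open>exp\<close>.\<close>

lemma ck_on_inverse_id: "ck_on k (- {0}) (inverse :: 'a::real_normed_field \<Rightarrow> 'a)"
proof (induction k)
  case 0
  then show ?case by (auto intro!: continuous_intros)
next
  case (Suc k)
  have o: "open (- {0::'a})" by auto
  show ?case
    by (rule ck_on_SucI[OF o, where f' = "\<lambda>x v. - (inverse x * v * inverse x)"])
       (auto intro!: has_derivative_inverse' ck_on_linear[OF bounded_linear_minus[OF bounded_linear_ident] o]
          ck_on_bilinear[OF bounded_bilinear_mult o] ck_on_const Suc)
qed

lemma ck_on_exp_id: "ck_on k UNIV (exp :: 'a::{real_normed_field,banach} \<Rightarrow> 'a)"
proof (induction k)
  case 0
  then show ?case by (auto intro!: continuous_intros)
next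
  case (Suc k)
  show ?case
    by (rule ck_on_SucI[where f' = "\<lambda>x v. exp x * v"])
       (use DERIV_exp Suc in \<open>auto simp: has_field_derivative_def[symmetric] intro!: ck_on_bilinear[OF bounded_bilinear_mult] ck_on_const\<close>)
qed

lemma ck_on_ln_id: "ck_on k {0<..} (ln :: real \<Rightarrow> real)"
proof (cases k)
  case 0
  then show ?thesis by (auto intro!: continuous_intros)
next
  case (Suc k)
  have "ck_on k {0<..} (inverse :: real \<Rightarrow> real)"
    by (rule ck_on_subset[OF ck_on_inverse_id]) auto
  then show ?thesis unfolding Suc
    by (intro ck_on_SucI[where f' = "\<lambda>x v. inverse x * v"])
       (use DERIV_ln in \<open>auto simp: has_field_derivative_def[symmetric] intro!: ck_on_bilinear[OF bounded_bilinear_mult] ck_on_const\<close>)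
qed

text \<open>\<open>leibniz_rule\<close> asks for the partial derivative as a continuous family of
  bounded linear maps. It is packed into \<open>Blinfun\<close>, and continuity is checked on basis
  vectors, where it is continuity of a directional derivative of \<open>F\<close>.\<close>

lemma has_derivative_integral_param:
  fixes F :: "'a::euclidean_space \<times> real \<Rightarrow> 'c::euclidean_space"
  assumes "open S" "x0 \<in> S" "ck_on 1 (S \<times> UNIV) F"
  shows "((\<lambda>x. integral {0..1} (\<lambda>t. F (x, t))) has_derivative
      (\<lambda>v. integral {0..1} (\<lambda>t. frechet_derivative F (at (x0, t)) (v, 0)))) (at x0)"
proof -
  let ?D = "\<lambda>x t v. frechet_derivative F (at (x, t)) (v, 0)"
  define fx where "fx = (\<lambda>x t. Blinfun (?D x t))"
  obtain e where e: "e > 0" "ball x0 e \<subseteq> S" using assms(1,2) openE by blast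
  have Fd: "(F has_derivative frechet_derivative F (at (x, t))) (at (x, t))" if "x \<in> S" for x t
    using that by (intro ck_on_SucD[OF assms(3)[unfolded One_nat_def]]) auto
  have bl: "bounded_linear (?D x t)" if "x \<in> S" for x t
    using bounded_linear_compose[OF has_derivative_bounded_linear[OF Fd[OF that]], of "\<lambda>v. (v, 0)"]
    by (simp add: bounded_linear_Pair bounded_linear_zero)
  have app: "blinfun_apply (fx x t) = ?D x t" if "x \<in> S" for x t
    unfolding fx_def using bl[OF that] by (rule bounded_linear_Blinfun_apply)
  have 1: "((\<lambda>x. F (x, t)) has_derivative blinfun_apply (fx x t)) (at x within ball x0 e)"
    if "x \<in> ball x0 e" for x t
  proof -
    have "x \<in> S" using that e by auto
    have "((\<lambda>x. F (x, t)) has_derivative ?D x t) (at x)"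
      by (rule has_derivative_compose[of "\<lambda>x. (x, t)" "\<lambda>v. (v, 0)", OF _ Fd[OF \<open>x \<in> S\<close>]])
         (auto intro!: derivative_eq_intros)
    then show ?thesis unfolding app[OF \<open>x \<in> S\<close>] by (rule has_derivative_at_withinI)
  qed
  have cF: "continuous_on (S \<times> UNIV) F"
    using ck_on_Suc_imp[OF assms(3)[unfolded One_nat_def]] by simp
  have 2: "(\<lambda>t. F (x, t)) integrable_on cbox 0 1" if "x \<in> ball x0 e" for x
    by (rule integrable_continuous, rule continuous_on_compose2[OF cF])
       (use that e in \<open>auto intro!: continuous_intros\<close>)
  have 3: "continuous_on (ball x0 e \<times> cbox 0 1) (\<lambda>(x, t). fx x t)"
  proof (rule continuous_on_blinfun_componentwise)
    fix i :: 'a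
    have "continuous_on (ball x0 e \<times> cbox 0 1) (\<lambda>xt. frechet_derivative F (at xt) (i, 0))"
      using assms(3) by (auto intro: continuous_on_subset simp: e)
         (meson Sigma_mono assms(3) continuous_on_subset e(2) subset_UNIV)
    then show "continuous_on (ball x0 e \<times> cbox 0 1) (\<lambda>x. blinfun_apply (case x of (x, t) \<Rightarrow> fx x t) i)"
      by (rule continuous_on_eq) (use app e in auto)
  qed
  have "((\<lambda>x. integral (cbox 0 1) (\<lambda>t. F (x, t))) has_derivative integral (cbox 0 1) (fx x0)) (at x0 within ball x0 e)"
    by (rule leibniz_rule[OF 1 2 3]) (use e in auto)
  then have "((\<lambda>x. integral {0..1} (\<lambda>t. F (x, t))) has_derivative integral {0..1} (fx x0)) (at x0)"
    using e by (simp add: at_within_open[of x0 "ball x0 e"])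
  moreover have "blinfun_apply (integral {0..1} (fx x0)) = (\<lambda>v. integral {0..1} (\<lambda>t. ?D x0 t v))"
  proof
    fix v
    have "fx x0 integrable_on cbox 0 1"
      by (rule integrable_continuous, rule continuous_on_compose2[OF 3, of _ "\<lambda>t. (x0, t)", simplified])
         (use e in \<open>auto intro!: continuous_intros\<close>)
    then show "blinfun_apply (integral {0..1} (fx x0)) v = integral {0..1} (\<lambda>t. ?D x0 t v)"
      by (subst blinfun_apply_integral) (auto simp: app[OF assms(2)])
  qed
  ultimately show ?thesis by simp
qed

text \<open>Differentiation under the integral replaces \<open>F\<close> by its derivative in a
  direction \<open>(v, 0)\<close>, an integrand of the same kind with one degree less, so the
  induction runs over all \<open>F\<close>. The factor \<open>UNIV\<close> keeps the domain open in
  the variable of integration.\<close>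

lemma ck_on_integral:
  fixes F :: "'a::euclidean_space \<times> real \<Rightarrow> 'c::euclidean_space"
  assumes "open S" "ck_on k (S \<times> UNIV) F"
  shows "ck_on k S (\<lambda>x. integral {0..1} (\<lambda>t. F (x, t)))"
  using assms(2)
proof (induction k arbitrary: F)
  case 0
  then have "continuous_on (S \<times> cbox 0 1) (\<lambda>(x, t). F (x, t))"
    by (auto intro: continuous_on_subset)
  from integral_continuous_on_param[OF this] show ?case by simp
next
  case (Suc k)
  have 1: "ck_on 1 (S \<times> UNIV) F"
    using Suc.prems by (induction k) (auto dest: ck_on_Suc_imp simp del: ck_on.simps)
  have "ck_on k S (\<lambda>x. integral {0..1} (\<lambda>t. frechet_derivative F (at (x, t)) (v, 0)))" for v
    using Suc.IH[of "\<lambda>p. frechet_derivative F (at p) (v, 0)"] Suc.prems by simp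
  then show ?case
    by (intro ck_on_SucI[OF assms(1) has_derivative_integral_param[OF assms(1) _ 1]])
qed

section \<open>Closure properties of smooth maps\<close>

lemma smooth_on_ckD: "smooth_on S f \<Longrightarrow> ck_on k S f"
  by (simp add: smooth_on_def)

lemma smooth_onI: "(\<And>k. ck_on k S f) \<Longrightarrow> smooth_on S f"
  by (simp add: smooth_on_def)

lemma smooth_on_cong:
  assumes "open S" "\<And>x. x \<in> S \<Longrightarrow> f x = g x" "smooth_on S f"
  shows "smooth_on S g"
  using ck_on_cong[OF assms(1,2)] assms(3) by (simp add: smooth_on_def)

lemma smooth_on_subset: "smooth_on S f \<Longrightarrow> T \<subseteq> S \<Longrightarrow> smooth_on T f"
  by (rule smooth_onI) (rule ck_on_subset[OF smooth_on_ckD])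

lemma smooth_on_locally:
  assumes "\<And>x. x \<in> S \<Longrightarrow> \<exists>T. open T \<and> x \<in> T \<and> smooth_on T f"
  shows "smooth_on S f"
  unfolding smooth_on_def
proof
  fix k
  show "ck_on k S f"
    by (rule ck_on_locally) (use assms smooth_on_ckD in blast)
qed

lemma smooth_on_linear:
  "bounded_linear L \<Longrightarrow> open S \<Longrightarrow> smooth_on S f \<Longrightarrow> smooth_on S (\<lambda>x. L (f x))"
  by (simp add: smooth_on_def ck_on_linear)

lemma smooth_on_const: "smooth_on S (\<lambda>x. c)"
  by (simp add: smooth_on_def ck_on_const)

lemma smooth_on_id: "open S \<Longrightarrow> smooth_on S (\<lambda>x. x)"
  by (simp add: smooth_on_def ck_on_id)

lemma smooth_on_add:
  "open S \<Longrightarrow> smooth_on S f \<Longrightarrow> smooth_on S g \<Longrightarrow> smooth_on S (\<lambda>x. f x + g x)"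
  by (simp add: smooth_on_def ck_on_add)

lemma smooth_on_minus: "open S \<Longrightarrow> smooth_on S f \<Longrightarrow> smooth_on S (\<lambda>x. - f x)"
  by (rule smooth_on_linear[OF bounded_linear_minus[OF bounded_linear_ident]])

lemma smooth_on_diff:
  "open S \<Longrightarrow> smooth_on S f \<Longrightarrow> smooth_on S g \<Longrightarrow> smooth_on S (\<lambda>x. f x - g x)"
  using smooth_on_add[of S f "\<lambda>x. - g x"] smooth_on_minus[of S g] by simp

lemma smooth_on_sum:
  "open S \<Longrightarrow> (\<And>i. i \<in> I \<Longrightarrow> smooth_on S (f i)) \<Longrightarrow> smooth_on S (\<lambda>x. \<Sum>i\<in>I. f i x)"
  by (simp add: smooth_on_def ck_on_sum)

lemma smooth_on_mult:
  fixes f g :: "'a::real_normed_vector \<Rightarrow> 'b::real_normed_algebra"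
  shows "open S \<Longrightarrow> smooth_on S f \<Longrightarrow> smooth_on S g \<Longrightarrow> smooth_on S (\<lambda>x. f x * g x)"
  by (simp add: smooth_on_def ck_on_bilinear[OF bounded_bilinear_mult])

lemma smooth_on_scaleR:
  "open S \<Longrightarrow> smooth_on S f \<Longrightarrow> smooth_on S g \<Longrightarrow> smooth_on S (\<lambda>x. f x *\<^sub>R g x)"
  by (simp add: smooth_on_def ck_on_bilinear[OF bounded_bilinear_scaleR])

lemma smooth_on_power:
  fixes f :: "'a::real_normed_vector \<Rightarrow> 'b::real_normed_algebra_1"
  shows "open S \<Longrightarrow> smooth_on S f \<Longrightarrow> smooth_on S (\<lambda>x. f x ^ n)"
  by (induction n) (auto intro: smooth_on_const smooth_on_mult)

lemma smooth_on_compose: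
  fixes f :: "'a::real_normed_vector \<Rightarrow> 'b::euclidean_space"
  assumes "open S" "open T" "smooth_on S f" "smooth_on T g" "f ` S \<subseteq> T"
  shows "smooth_on S (\<lambda>x. g (f x))"
  by (rule smooth_onI) (rule ck_on_compose[OF assms(1,2) smooth_on_ckD[OF assms(3)] smooth_on_ckD[OF assms(4)] assms(5)])

lemma smooth_on_inverse:
  fixes f :: "'a::real_normed_vector \<Rightarrow> 'b::{real_normed_field,euclidean_space}"
  assumes "open S" "smooth_on S f" "\<And>x. x \<in> S \<Longrightarrow> f x \<noteq> 0"
  shows "smooth_on S (\<lambda>x. inverse (f x))"
  by (rule smooth_on_compose[OF assms(1) _ assms(2), of "- {0}"])
     (use assms in \<open>auto simp: smooth_on_def ck_on_inverse_id\<close>)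

lemma smooth_on_divide:
  fixes f g :: "'a::real_normed_vector \<Rightarrow> 'b::{real_normed_field,euclidean_space}"
  assumes "open S" "smooth_on S f" "smooth_on S g" "\<And>x. x \<in> S \<Longrightarrow> g x \<noteq> 0"
  shows "smooth_on S (\<lambda>x. f x / g x)"
  using smooth_on_mult[OF assms(1,2) smooth_on_inverse[OF assms(1,3,4)]] by (simp add: divide_inverse)

lemma smooth_on_exp:
  fixes f :: "'a::real_normed_vector \<Rightarrow> 'b::{real_normed_field,banach,euclidean_space}"
  assumes "open S" "smooth_on S f"
  shows "smooth_on S (\<lambda>x. exp (f x))"
  by (rule smooth_on_compose[OF assms(1) open_UNIV assms(2)]) (auto simp: smooth_on_def ck_on_exp_id)

lemma smooth_on_ln:
  fixes f :: "'a::real_normed_vector \<Rightarrow> real"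
  assumes "open S" "smooth_on S f" "\<And>x. x \<in> S \<Longrightarrow> f x > 0"
  shows "smooth_on S (\<lambda>x. ln (f x))"
  by (rule smooth_on_compose[OF assms(1) _ assms(2), of "{0<..}"])
     (use assms in \<open>auto simp: smooth_on_def ck_on_ln_id\<close>)

lemma smooth_on_Pair:
  assumes "open S" "smooth_on S f" "smooth_on S g"
  shows "smooth_on S (\<lambda>x. (f x, g x))"
proof -
  have "bounded_linear (\<lambda>u. (u, 0))" "bounded_linear (\<lambda>u. (0, u))"
    by (auto intro!: bounded_linear_Pair)
  then have "smooth_on S (\<lambda>x. (f x, 0) + (0, g x))"
    by (intro smooth_on_add smooth_on_linear[of "\<lambda>u. (u, 0)"] smooth_on_linear[of "\<lambda>u. (0, u)"] assms)
  then show ?thesis by simp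
qed

lemmas smooth_on_fst = smooth_on_linear[OF bounded_linear_fst]
lemmas smooth_on_snd = smooth_on_linear[OF bounded_linear_snd]
lemmas smooth_on_Re = smooth_on_linear[OF bounded_linear_Re]
lemmas smooth_on_of_real = smooth_on_linear[OF bounded_linear_of_real]
lemmas smooth_on_nth = smooth_on_linear[OF bounded_linear_vec_nth]

lemma smooth_on_vec:
  fixes f :: "'a::real_normed_vector \<Rightarrow> 'b::euclidean_space^'n"
  assumes "open S" "\<And>i. smooth_on S (\<lambda>x. f x $ i)"
  shows "smooth_on S f"
proof -
  have 1: "bounded_linear (axis i :: 'b \<Rightarrow> 'b^'n)" for i
    by (auto intro!: linear_linear[THEN iffD2] linearI simp: vec_eq_iff axis_def linear_conv_bounded_linear[symmetric])
  have "smooth_on S (\<lambda>x. \<Sum>i\<in>UNIV. axis i (f x $ i))"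
    by (intro smooth_on_sum smooth_on_linear[OF 1] assms)
  moreover have "(\<Sum>i\<in>UNIV. axis i (f x $ i)) = f x" for x
    by (simp add: vec_eq_iff axis_def if_distrib cong: if_cong)
  ultimately show ?thesis by simp
qed

lemma smooth_on_matrix_mult:
  fixes F G :: "'a::real_normed_vector \<Rightarrow> complex^3^3"
  assumes "open S" "smooth_on S F" "smooth_on S G"
  shows "smooth_on S (\<lambda>x. F x ** G x)"
  unfolding matrix_matrix_mult_def
  by (intro smooth_on_vec assms(1), simp, intro smooth_on_sum smooth_on_mult smooth_on_nth assms)

lemma smooth_on_integral:
  fixes F :: "'a::euclidean_space \<times> real \<Rightarrow> 'c::euclidean_space"
  assumes "open S" "smooth_on (S \<times> UNIV) F"
  shows "smooth_on S (\<lambda>x. integral {0..1} (\<lambda>t. F (x, t)))"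
  by (rule smooth_onI) (rule ck_on_integral[OF assms(1) smooth_on_ckD[OF assms(2)]])

lemma smooth_on_differentiable: "smooth_on S f \<Longrightarrow> x \<in> S \<Longrightarrow> f differentiable (at x)"
  using smooth_on_ckD[of S f "Suc 0"] by simp

lemma smooth_on_frechet_derivative:
  "smooth_on S f \<Longrightarrow> smooth_on S (\<lambda>x. frechet_derivative f (at x) v)"
proof (unfold smooth_on_def, rule allI)
  fix k assume "\<forall>k. ck_on k S f"
  then have "ck_on (Suc k) S f" by blast
  then show "ck_on k S (\<lambda>x. frechet_derivative f (at x) v)" by simp
qed

lemma smooth_on_continuous_on: "smooth_on S f \<Longrightarrow> continuous_on S f"
  using smooth_on_ckD[of S f 0] by simp

lemma smooth_on_has_derivative:
  "smooth_on S f \<Longrightarrow> x \<in> S \<Longrightarrow> (f has_derivative frechet_derivative f (at x)) (at x)"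
  using smooth_on_differentiable frechet_derivative_works by blast

section \<open>Derivatives in the first variable of a jointly smooth map\<close>

lemma smooth_on_dirderiv: "smooth_on D f \<Longrightarrow> smooth_on D (dirderiv f X)"
  unfolding dirderiv_def[abs_def] by (rule smooth_on_frechet_derivative)

lemma smooth_on_slice:
  fixes D :: "'a::euclidean_space set" and L :: "'b::euclidean_space set"
  assumes "open D" "open L" "smooth_on (D \<times> L) (\<lambda>(z, l). F z l)" "l \<in> L"
  shows "smooth_on D (\<lambda>z. F z l)"
proof -
  have "smooth_on D (\<lambda>z. (\<lambda>(z, l). F z l) (z, l))"
    by (rule smooth_on_compose[OF assms(1) open_Times[OF assms(1,2)] _ assms(3)])
       (use assms in \<open>auto intro!: smooth_on_Pair smooth_on_id smooth_on_const\<close>)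
  then show ?thesis by simp
qed

lemma dirderiv_slice:
  fixes L :: "'b::real_normed_vector set"
  assumes "smooth_on (D \<times> L) (\<lambda>(z, l). F z l)" "z \<in> D" "l \<in> L"
  shows "dirderiv (\<lambda>w. F w l) X z = frechet_derivative (\<lambda>(z, l). F z l) (at (z, l)) (X, 0)"
proof -
  have "((\<lambda>w. (\<lambda>(z, l). F z l) (w, l)) has_derivative (\<lambda>X. frechet_derivative (\<lambda>(z, l). F z l) (at (z, l)) (X, 0))) (at z)"
    by (rule has_derivative_compose[of "\<lambda>w. (w, l)" "\<lambda>v. (v, 0)", OF _ smooth_on_has_derivative[OF assms(1)]])
       (use assms in \<open>auto intro!: derivative_eq_intros\<close>)
  then show ?thesis unfolding dirderiv_def using frechet_derivative_at[of "\<lambda>w. F w l"] by simp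
qed

text \<open>The z-derivative at fixed \<open>l\<close> is a directional derivative of the joint map,
  hence continuous in \<open>l\<close>. This gives the removability in \<open>Om_hol\<close> and the
  limits in \<open>dirderiv_ht_tendsto\<close>.\<close>

lemma continuous_on_dirderiv_slice:
  assumes "smooth_on (D \<times> L) (\<lambda>(z, l). F z l)" "z \<in> D"
  shows "continuous_on L (\<lambda>l. dirderiv (\<lambda>w. F w l) X z)"
proof -
  have "continuous_on (D \<times> L) (\<lambda>p. frechet_derivative (\<lambda>(z, l). F z l) (at p) (X, 0))"
    by (intro smooth_on_continuous_on smooth_on_frechet_derivative assms)
  then have "continuous_on L (\<lambda>l. frechet_derivative (\<lambda>(z, l). F z l) (at (z, l)) (X, 0))"
    by (rule continuous_on_compose2) (use assms in \<open>auto intro!: continuous_intros\<close>)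
  then show ?thesis
    by (rule continuous_on_eq) (use dirderiv_slice[OF assms] in auto)
qed

subsection \<open>Removable singularities and Liouville theorems\<close>

text \<open>Every point of \<open>L\<close> is a limit of points of \<open>L - K\<close>, and limits
  are unique. Identities for the dressed frame are proved off the poles and carried over in this
  way.\<close>

lemma continuous_eq_off_finite:
  fixes f g :: "'a::{perfect_space,t2_space} \<Rightarrow> 'b::t2_space"
  assumes "open L" "finite K" "continuous_on L f" "continuous_on L g"
    "\<And>l. l \<in> L - K \<Longrightarrow> f l = g l" "l \<in> L"
  shows "f l = g l"
proof -
  have "open (L - (K - {l}))"
    using assms(1,2) by (intro open_Diff finite_imp_closed) auto
  then have "eventually (\<lambda>x. x \<in> L - (K - {l})) (at l)"
    using assms(6) by (intro eventually_at_in_open') auto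
  then have "eventually (\<lambda>x. f x = g x) (at l)"
    using eventually_neq_at_within[of l l UNIV] by eventually_elim (use assms(5) in auto)
  then have "(f \<longlongrightarrow> g l) (at l) = (g \<longlongrightarrow> g l) (at l)"
    by (rule tendsto_cong)
  moreover have "(f \<longlongrightarrow> f l) (at l)" "(g \<longlongrightarrow> g l) (at l)"
    using assms(3,4,6) at_within_open[OF assms(6,1)] by (auto simp: continuous_on_def)
  ultimately show ?thesis
    using tendsto_unique[OF trivial_limit_at] by blast
qed

text \<open>Riemann's criterion, applied to one point after the other. \<open>L\<close> has to vary
  in the induction, since the induction hypothesis is used on \<open>L\<close> without the new
  point.\<close>

lemma holomorphic_extend_finite:
  assumes "finite K" "open L" "f holomorphic_on (L - K)"
    "\<And>p. p \<in> K \<Longrightarrow> p \<in> L \<Longrightarrow> ((\<lambda>l. (l - p) * f l) \<longlongrightarrow> 0) (at p)"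
  shows "\<exists>g. g holomorphic_on L \<and> (\<forall>l\<in>L - K. g l = f l)"
  using assms
proof (induction K arbitrary: L rule: finite_induct)
  case empty
  then show ?case by auto
next
  case (insert p K)
  have "open (L - {p})" using insert.prems(1) by auto
  moreover have "f holomorphic_on (L - {p} - K)"
    using insert.prems(2) by (simp only: Diff_insert2[of L p K])
  ultimately obtain g where g: "g holomorphic_on L - {p}" "\<forall>l\<in>L - {p} - K. g l = f l"
    using insert.IH[of "L - {p}"] insert.prems(3) by auto
  show ?case
  proof (cases "p \<in> L")
    case True
    have "open (L - K)" using insert.prems(1) insert.hyps(1) by (intro open_Diff finite_imp_closed) auto
    then have "eventually (\<lambda>x. x \<in> L - K - {p}) (at p)"
      using True insert.hyps by (intro eventually_at_in_open) auto
    then have "eventually (\<lambda>l. (l - p) * f l = (l - p) * g l) (at p)"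
      by eventually_elim (use g in auto)
    from tendsto_cong[OF this] have "((\<lambda>l. (l - p) * g l) \<longlongrightarrow> 0) (at p)"
      using insert.prems(3)[of p] True by blast
    then obtain g' where "g' holomorphic_on L" "\<forall>l\<in>L - {p}. g' l = g l"
      using holomorphic_on_extend_lim[OF g(1)] True insert.prems(1) by (auto simp: interior_open)
    then show ?thesis using g(2) by (intro exI[of _ g']) auto
  next
    case False
    with g show ?thesis by (intro exI[of _ g]) auto
  qed
qed

text \<open>Smoothness across the singularities comes from the Cauchy integral over a circle that avoids them,
  by differentiation under the integral sign.\<close>

lemma smooth_extension:
  fixes G :: "complex \<Rightarrow> complex \<Rightarrow> complex"
  assumes D: "open D" and L: "open L" and K: "finite K"
    and smooth: "smooth_on (D \<times> (L - K)) (\<lambda>(z, l). G z l)"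
    and hol: "\<And>z. z \<in> D \<Longrightarrow> G z holomorphic_on (L - K)"
    and lim: "\<And>z p. z \<in> D \<Longrightarrow> p \<in> K \<Longrightarrow> p \<in> L \<Longrightarrow> ((\<lambda>l. (l - p) * G z l) \<longlongrightarrow> 0) (at p)"
  shows "\<exists>Gt. smooth_on (D \<times> L) (\<lambda>(z, l). Gt z l) \<and>
    (\<forall>z\<in>D. Gt z holomorphic_on L \<and> (\<forall>l\<in>L - K. Gt z l = G z l))"
proof -
  have "\<forall>z\<in>D. \<exists>g. g holomorphic_on L \<and> (\<forall>l\<in>L - K. g l = G z l)"
    using holomorphic_extend_finite[OF K L] hol lim by blast
  then obtain Gt where Gt: "\<And>z. z \<in> D \<Longrightarrow> Gt z holomorphic_on L"
      "\<And>z l. z \<in> D \<Longrightarrow> l \<in> L - K \<Longrightarrow> Gt z l = G z l"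
    by metis
  have "smooth_on (D \<times> L) (\<lambda>(z, l). Gt z l)"
  proof (rule smooth_on_locally, clarify)
    fix z0 l0 assume z0: "z0 \<in> D" and l0: "l0 \<in> L"
    \<comment> \<open>Keeping \<open>l0\<close> itself yields a closed disc that meets
      \<open>K\<close> at most in its centre; its boundary circle avoids \<open>K\<close> even when
      \<open>l0\<close> is one of the singularities.\<close>
    have "open (L - (K - {l0}))"
      using L K by (intro open_Diff finite_imp_closed) auto
    then obtain r where r: "r > 0" "cball l0 r \<subseteq> L - (K - {l0})"
      using l0 open_contains_cball by blast
    \<comment> \<open>The circle is parametrised over the whole real line, so that the integrand is
      smooth on an open set.\<close>
    define C where "C = (\<lambda>t::real. l0 + r * exp (2 * of_real pi * \<i> * of_real t))"
    have Csphere: "cmod (C t - l0) = r" for t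
    proof -
      have "cmod (exp (\<i> * of_real (2 * pi * t))) = 1" by (rule norm_exp_i_times)
      then show ?thesis using r by (simp add: C_def norm_mult mult_ac)
    qed
    have C: "C t \<in> L - K" for t
    proof -
      have "C t \<noteq> l0" using Csphere[of t] r by auto
      moreover have "C t \<in> cball l0 r" using Csphere[of t] by (simp add: dist_norm norm_minus_commute)
      ultimately show ?thesis using r(2) by blast
    qed
    \<comment> \<open>The Cauchy integrand on this circle; the factor 2 pi i from the derivative of
      the path is already cancelled against the one in Cauchy's formula.\<close>
    define F where "F = (\<lambda>p. G (fst (fst p)) (C (snd p)) / (C (snd p) - snd (fst p)) *
        exp (2 * of_real pi * \<i> * of_real (snd p)) * of_real r)"
    let ?S = "D \<times> ball l0 r"
    have oS: "open ?S" using D by (simp add: open_Times)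
    have oSU: "open (?S \<times> (UNIV::real set))" using oS by (simp add: open_Times)
    have oLK: "open (D \<times> (L - K))" using D L K by (intro open_Times open_Diff finite_imp_closed)
    have sC: "smooth_on (?S \<times> (UNIV::real set)) (\<lambda>p. C (snd p))"
      unfolding C_def
      by (intro smooth_on_add smooth_on_mult smooth_on_exp smooth_on_const smooth_on_of_real smooth_on_snd smooth_on_id oSU)
    have sG: "smooth_on (?S \<times> (UNIV::real set)) (\<lambda>p. (\<lambda>(z, l). G z l) (fst (fst p), C (snd p)))"
      by (rule smooth_on_compose[OF oSU oLK _ smooth])
         (use C in \<open>auto intro!: smooth_on_Pair sC smooth_on_fst oSU smooth_on_id\<close>)
    have "C (snd p) - snd (fst p) \<noteq> 0" if "p \<in> ?S \<times> (UNIV::real set)" for p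
    proof
      assume "C (snd p) - snd (fst p) = 0"
      then have "cmod (snd (fst p) - l0) = r" using Csphere[of "snd p"] by simp
      moreover have "cmod (snd (fst p) - l0) < r" using that by (auto simp: dist_norm norm_minus_commute)
      ultimately show False by simp
    qed
    then have "smooth_on (?S \<times> (UNIV::real set)) (\<lambda>p. G (fst (fst p)) (C (snd p)) / (C (snd p) - snd (fst p)) *
        exp (2 * of_real pi * \<i> * of_real (snd p)) * of_real r)"
      using sG
      by (intro smooth_on_mult smooth_on_divide smooth_on_diff smooth_on_exp smooth_on_const
          smooth_on_of_real smooth_on_snd smooth_on_fst smooth_on_id oSU sC) auto
    then have "smooth_on (?S \<times> (UNIV::real set)) F"
      unfolding F_def .
    then have sI: "smooth_on ?S (\<lambda>x. integral {0..1} (\<lambda>t. F (x, t)))"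
      by (rule smooth_on_integral[OF oS])
    have "integral {0..1} (\<lambda>t. F (x, t)) = (\<lambda>(z, l). Gt z l) x" if xS: "x \<in> ?S" for x
    proof -
      obtain z l where x: "x = (z, l)" "z \<in> D" "cmod (l - l0) < r"
        using xS by (cases x) (auto simp: dist_norm norm_minus_commute)
      have "Gt z holomorphic_on cball l0 r"
        by (rule holomorphic_on_subset[OF Gt(1)[OF x(2)]]) (use r(2) in blast)
      from Cauchy_integral_circlepath_simple[OF this x(3)]
      have "((\<lambda>t. Gt z (circlepath l0 r t) / (circlepath l0 r t - l)
          * vector_derivative (circlepath l0 r) (at t within {0..1}))
          has_integral (2 * of_real pi * \<i> * Gt z l)) {0..1}"
        unfolding has_contour_integral_def .
      then have I: "((\<lambda>t. inverse c * (Gt z (circlepath l0 r t) / (circlepath l0 r t - l)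
          * vector_derivative (circlepath l0 r) (at t within {0..1})))
          has_integral (inverse c * (2 * of_real pi * \<i> * Gt z l))) {0..1}" for c
        by (rule has_integral_mult_right)
      define c where "c = 2 * complex_of_real pi * \<i>"
      have c0: "c \<noteq> 0" by (simp add: c_def)
      have "inverse c * (Gt z (circlepath l0 r t) / (circlepath l0 r t - l)
          * vector_derivative (circlepath l0 r) (at t within {0..1})) = F (x, t)" if "t \<in> {0..1}" for t
      proof -
        have "circlepath l0 r t = C t" by (simp add: circlepath C_def)
        moreover have "vector_derivative (circlepath l0 r) (at t within {0..1})
            = c * r * exp (2 * of_real pi * \<i> * t)"
          using that by (simp add: vector_derivative_circlepath01 c_def)
        ultimately show ?thesis
          using Gt(2)[OF x(2) C[of t]] c0 by (simp add: F_def x(1) field_simps)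
      qed
      from has_integral_eq[OF this I[of c]]
      have "((\<lambda>t. F (x, t)) has_integral (inverse c * (c * Gt z l))) {0..1}"
        unfolding c_def[symmetric] .
      moreover have "inverse c * (c * Gt z l) = Gt z l"
        using c0 left_inverse[OF c0] by (simp only: mult.assoc[symmetric] mult_1_left)
      ultimately have "((\<lambda>t. F (x, t)) has_integral Gt z l) {0..1}"
        by (simp only:)
      then show ?thesis by (simp add: x(1) integral_unique)
    qed
    from smooth_on_cong[OF oS this sI] have "smooth_on ?S (\<lambda>(z, l). Gt z l)"
      by simp
    then show "\<exists>T. open T \<and> (z0, l0) \<in> T \<and> smooth_on T (\<lambda>(z, l). Gt z l)"
      using oS z0 r(1) by (intro exI[of _ ?S]) auto
  qed
  with Gt show ?thesis by blast
qed

text \<open>The first limit removes the singularity at 0, the second makes the entire extension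
  vanish at infinity. It suits functions whose polar part at 0 has already been subtracted.\<close>

lemma Liouville_punctured:
  assumes "f holomorphic_on (- {0})" "((\<lambda>l. l * f l) \<longlongrightarrow> 0) (at 0)"
    "((\<lambda>w. f (inverse w)) \<longlongrightarrow> 0) (at 0)" "l \<noteq> 0"
  shows "f l = 0"
proof -
  obtain g where g: "g holomorphic_on UNIV" "\<forall>l\<in>UNIV - {0}. g l = f l"
    using holomorphic_on_extend_lim[of f UNIV 0] assms(1,2) by (auto simp: Compl_eq_Diff_UNIV)
  have "((\<lambda>w. g (inverse w)) \<longlongrightarrow> 0) (at 0)"
    by (rule Lim_transform_within[OF assms(3), of 1]) (use g in auto)
  then have "(g \<longlongrightarrow> 0) at_infinity" by (simp add: lim_at_infinity_0 comp_def)
  with Liouville_weak_0[OF g(1)] g(2) assms(4) show ?thesis by auto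
qed

text \<open>Obtained from the previous lemma by \<open>l\<close> to \<open>inverse l\<close>; here
  it is at infinity that growth slower than a simple pole is tolerated.\<close>

lemma Liouville_punctured':
  assumes "f holomorphic_on (- {0})" "(f \<longlongrightarrow> 0) (at 0)"
    "((\<lambda>w. w * f (inverse w)) \<longlongrightarrow> 0) (at 0)" "l \<noteq> 0"
  shows "f l = 0"
proof -
  have "(\<lambda>w. f (inverse w)) holomorphic_on (- {0})"
    using holomorphic_on_compose_gen[of inverse "- {0}" f "- {0}"] assms(1)
    by (fastforce simp: comp_def intro!: holomorphic_on_inverse holomorphic_on_ident)
  from Liouville_punctured[OF this assms(3), of "inverse l"] assms(2,4) show ?thesis by simp
qed

subsection \<open>The simple factors\<close>

lemma eps_cube: "eps ^ 3 = -1"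
proof -
  have "eps ^ 3 = exp (\<i> * of_real pi)"
    unfolding eps_def by (simp add: exp_of_nat_mult[symmetric])
  then show ?thesis by simp
qed

lemma eps_nonzero: "eps \<noteq> 0" by (simp add: eps_def)

lemma eps_6: "eps ^ 6 = 1"
proof -
  have "eps ^ 6 = (eps ^ 3) ^ 2" by (simp flip: power_mult)
  then show ?thesis by (simp add: eps_cube)
qed

definition omega :: complex where "omega = eps ^ 2"

lemma omega_cube: "omega ^ 3 = 1"
  unfolding omega_def by (simp flip: power_mult add: eps_6)

lemma eps_powers: "eps = - (omega ^ 2)" "eps ^ 2 = omega" "eps ^ 4 = omega ^ 2"
proof -
  have "omega ^ 2 = eps * eps ^ 3" by (simp add: omega_def power_mult[symmetric] power_Suc[symmetric])
  then show "eps = - (omega ^ 2)" by (simp add: eps_cube)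
qed (simp_all add: omega_def flip: power_mult)

lemma omega_nonzero: "omega \<noteq> 0"
  by (simp add: omega_def eps_nonzero)

lemma omega_sq_sum: "omega ^ 2 + omega + 1 = 0"
proof -
  have "eps \<noteq> -1"
  proof
    assume "eps = -1"
    then have "Re eps = Re (-1)" by (rule arg_cong)
    moreover have "Re eps = 1/2"
      by (simp add: eps_def Re_exp cos_60)
    ultimately show False by simp
  qed
  then have "omega \<noteq> 1"
    using eps_cube by (metis mult_1 omega_def power2_eq_square power3_eq_cube)
  moreover have "(omega - 1) * (omega ^ 2 + omega + 1) = 0"
    using omega_cube by (simp add: power2_eq_square power3_eq_cube algebra_simps)
  ultimately show ?thesis by simp
qed

lemma cube_eq_cases:
  fixes a p :: complex
  assumes "p ^ 3 = a ^ 3"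
  obtains "p = a" | "p = a * omega" | "p = a * omega * omega"
proof -
  have o: "omega * omega = - omega - 1" using omega_sq_sum by algebra
  have o3: "omega * omega * omega = 1" using omega_cube by (simp add: power3_eq_cube)
  have "(p - a) * (p - a * omega) * (p - a * omega * omega) = 0"
    using assms o o3 by algebra
  then show thesis using that by auto
qed

section \<open>The adjoint and the algebra of the simple factor\<close>

lemma matrix_eq_3:
  fixes A B :: "'a^3^3"
  shows "A = B \<longleftrightarrow> A$1$1 = B$1$1 \<and> A$1$2 = B$1$2 \<and> A$1$3 = B$1$3 \<and>
    A$2$1 = B$2$1 \<and> A$2$2 = B$2$2 \<and> A$2$3 = B$2$3 \<and>
    A$3$1 = B$3$1 \<and> A$3$2 = B$3$2 \<and> A$3$3 = B$3$3"
  by (auto simp: vec_eq_iff forall_3)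

lemma matrix_mult_nth:
  "(A ** B) $ i $ j = A$i$1 * B$1$j + A$i$2 * B$2$j + A$i$3 * B$3$(j::3)" for A B :: "complex^3^3"
  by (simp add: matrix_matrix_mult_def sum_3)

lemma mat1_nth: "(mat 1 :: complex^3^3) $ i $ j = (if i = j then 1 else 0)"
  by (simp add: mat_def)

text \<open>Gram matrix of the bilinear form x1 y2 + x2 y1 + x3 y3. Up to a diagonal matrix it is
  \<open>Pmat\<close>, see \<open>Pmat_props\<close>.\<close>

definition Jmat :: "complex^3^3" where
  "Jmat = vector [vector [0, 1, 0], vector [1, 0, 0], vector [0, 0, 1]]"

definition Wmat :: "complex \<Rightarrow> complex^3^3" where
  "Wmat w = vector [vector [w, 0, 0], vector [0, w ^ 2, 0], vector [0, 0, 1]]"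

text \<open>The adjoint of \<open>g\<close> for the bilinear form with Gram matrix
  \<open>Jmat\<close>; it is an involution that reverses products.\<close>

definition dual :: "complex^3^3 \<Rightarrow> complex^3^3" where
  "dual g = Jmat ** transpose g ** Jmat"

lemma transpose_nth: "transpose A $ i $ j = A $ j $ i"
  by (simp add: transpose_def)

lemma Jmat_involution: "Jmat ** Jmat = mat 1"
  by (simp add: matrix_eq_3 matrix_mult_nth mat1_nth Jmat_def)

lemma dual_nth:
  "dual g $ 1 $ 1 = g $ 2 $ 2" "dual g $ 1 $ 2 = g $ 1 $ 2" "dual g $ 1 $ 3 = g $ 3 $ 2"
  "dual g $ 2 $ 1 = g $ 2 $ 1" "dual g $ 2 $ 2 = g $ 1 $ 1" "dual g $ 2 $ 3 = g $ 3 $ 1"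
  "dual g $ 3 $ 1 = g $ 2 $ 3" "dual g $ 3 $ 2 = g $ 1 $ 3" "dual g $ 3 $ 3 = g $ 3 $ 3"
  by (simp_all add: dual_def matrix_mult_nth transpose_nth Jmat_def)

lemma dual_dual: "dual (dual g) = g"
  by (simp add: matrix_eq_3 dual_nth)

lemma dual_mult: "dual (A ** B) = dual B ** dual A"
  by (simp add: matrix_eq_3 dual_nth matrix_mult_nth mult.commute add_ac)

lemma dual_mat1: "dual (mat 1) = mat 1"
  by (simp add: matrix_eq_3 dual_nth mat1_nth)

lemma gfac_nth:
  "gfac a b c l $ 1 $ 1 = 1 + 2 / (l^3 - a^3) * (a^3 * b * c / (2*b*c - 1))"
  "gfac a b c l $ 1 $ 2 = 2 / (l^3 - a^3) * (a * l^2 * c^2 / (2*b*c - 1))"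
  "gfac a b c l $ 1 $ 3 = 2 / (l^3 - a^3) * (a^2 * l * c / (2*b*c - 1))"
  "gfac a b c l $ 2 $ 1 = 2 / (l^3 - a^3) * (a^2 * l * b^2)"
  "gfac a b c l $ 2 $ 2 = 1 + 2 / (l^3 - a^3) * (a^3 * b * c)"
  "gfac a b c l $ 2 $ 3 = 2 / (l^3 - a^3) * (a * l^2 * b)"
  "gfac a b c l $ 3 $ 1 = 2 / (l^3 - a^3) * (a * l^2 * b)"
  "gfac a b c l $ 3 $ 2 = 2 / (l^3 - a^3) * (a^2 * l * c)"
  "gfac a b c l $ 3 $ 3 = 1 + 2 / (l^3 - a^3) * a^3"
  by (simp_all add: gfac_def mat1_nth map_matrix_def)

text \<open>An inverse in closed form, which shows its poles: they are the roots of
  \<open>l^3 = - (a^3)\<close>, the negatives of the poles of the factor itself.\<close>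

lemma gfac_mult_dual:
  assumes "l^3 \<noteq> a^3" "l^3 \<noteq> - (a^3)" "2*b*c \<noteq> 1"
  shows "gfac a b c l ** dual (gfac a b c (-l)) = mat 1"
proof -
  define q where "q = 2 / (l^3 - a^3)"
  define q' where "q' = 2 / ((- l)^3 - a^3)"
  define e where "e = inverse (2*b*c - 1)"
  have "l^3 - a^3 \<noteq> 0" "(- l)^3 - a^3 \<noteq> 0"
    using assms by (auto simp: eq_neg_iff_add_eq_0 neg_eq_iff_add_eq_0)
  then have q: "q * (l^3 - a^3) = 2" "q' * ((- l)^3 - a^3) = 2"
    unfolding q_def q'_def by (auto intro: nonzero_eq_divide_eq[THEN iffD1, OF _ refl] simp del: times_divide_eq_left times_divide_eq_right)
  then have "q' * (q * (l^3 - a^3)) = 2 * q'" "q * (q' * ((- l)^3 - a^3)) = 2 * q"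
    by simp_all
  then have "2 * (q * q' * (a * a * a)) = 2 * - (q + q')" "2 * (q * q' * (l * l * l)) = 2 * (q' - q)"
    by (simp_all add: power3_eq_cube) algebra+
  \<comment> \<open>Partial fractions: products of \<open>q\<close> and \<open>q'\<close> become
    linear. Together with the relation for \<open>e\<close>, these two equations imply all nine
    entries.\<close>
  then have q: "q * q' * (a * a * a) = - (q + q')" "q * q' * (l * l * l) = q' - q"
    by (simp_all only: mult_left_cancel[OF zero_neq_numeral[symmetric]])
  have e: "e * (2*b*c - 1) = 1" using assms by (simp add: e_def)
  have d: "x / (2*b*c - 1) = x * e" for x by (simp add: e_def divide_inverse)
  note g = gfac_nth[of a b c l, folded q_def, unfolded d] gfac_nth[of a b c "- l", folded q'_def, unfolded d]
  show ?thesis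
    unfolding matrix_eq_3 matrix_mult_nth mat1_nth dual_nth g
    using q e
    by (simp add: power2_eq_square power3_eq_cube) (intro conjI; algebra)
qed

text \<open>The determinant does not see the line. Therefore \<open>h\<close> and \<open>ht\<close>
  have equal determinants, which later gives \<open>det (Et z l) = 1\<close>. In the computation,
  \<open>Y = X + 2\<close> and the relation for \<open>e\<close> reduce everything to
  \<open>1 + X\<close>.\<close>

lemma det_gfac:
  assumes "l^3 \<noteq> a^3" "2*b*c \<noteq> 1"
  shows "det (gfac a b c l) = (l^3 + a^3) / (l^3 - a^3)"
proof -
  define q where "q = 2 / (l^3 - a^3)"
  define e where "e = inverse (2*b*c - 1)"
  define X where "X = q * a^3"
  define Y where "Y = q * l^3"
  define t where "t = b * c"
  have l: "l^3 - a^3 \<noteq> 0" using assms by simp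
  then have "q * (l^3 - a^3) = 2"
    unfolding q_def by (auto intro: nonzero_eq_divide_eq[THEN iffD1, OF _ refl] simp del: times_divide_eq_left times_divide_eq_right)
  then have Y: "Y = X + 2" by (simp add: X_def Y_def algebra_simps)
  have e: "e * (2*t - 1) = 1" using assms by (simp add: e_def t_def mult.assoc)
  have d: "x / (2*b*c - 1) = x * e" for x by (simp add: e_def divide_inverse)
  have "det (gfac a b c l) = (1 + X*t*e) * (1 + X*t) * (1 + X) + X*Y^2*t^2*e + X^2*Y*t^2*e
      - (1 + X*t*e)*X*Y*t - X*Y*t^2*e*(1 + X) - X*Y*t*e*(1 + X*t)"
    unfolding det_3 gfac_nth[of a b c l, folded q_def, unfolded d]
    by (simp add: X_def Y_def t_def power2_eq_square power3_eq_cube algebra_simps)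
  also have "\<dots> = 1 + X" using Y e by algebra
  also have "\<dots> = (l^3 + a^3) / (l^3 - a^3)"
    using l by (simp add: X_def q_def field_simps)
  finally show ?thesis .
qed

text \<open>Reduces the poles of \<open>gfac a b c\<close> at the other cube roots of \<open>a^3\<close> to the pole at \<open>a\<close>.\<close>

lemma gfac_rotate:
  assumes "w^3 = 1"
  shows "gfac (a*w) (b*w^2) (c*w) = gfac a b c"
proof -
  have 1: "(a*w)^3 = a^3" using assms by (simp add: power_mult_distrib)
  have 2: "b*w^2*(c*w) = b*c" using assms by (simp add: power2_eq_square power3_eq_cube mult_ac)
  have D: "2*(b*w^2)*(c*w) = 2*b*c" using 2 by (simp add: mult.assoc)
  have 3: "a*w*x^2*(c*w)^2 = a*x^2*c^2" "(a*w)^2*x*(c*w) = a^2*x*c" "(a*w)^2*x*(b*w^2)^2 = a^2*x*b^2"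
    "a*w*x^2*(b*w^2) = a*x^2*b" "a^3*(b*w^2)*(c*w) = a^3*b*c" for x
    using assms by (simp_all add: power2_eq_square power3_eq_cube) algebra+
  show ?thesis
    by (rule ext) (simp add: matrix_eq_3 gfac_nth 1 D 3)
qed

lemma Wmat_inverse: "w^3 = 1 \<Longrightarrow> Wmat w ** Wmat (w^2) = mat 1" "w^3 = 1 \<Longrightarrow> Wmat (w^2) ** Wmat w = mat 1"
  by (simp_all add: matrix_eq_3 matrix_mult_nth mat1_nth Wmat_def power2_eq_square power3_eq_cube mult_ac)

text \<open>Up to functions of \<open>l^3\<close>, each entry is a monomial in \<open>l\<close>
  whose exponent modulo 3 depends on the position only; conjugation by a diagonal matrix of cube
  roots of unity reproduces the rotation of \<open>l\<close>.\<close>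

lemma gfac_twist:
  assumes "w^3 = 1"
  shows "gfac a b c (w * l) = Wmat w ** gfac a b c l ** Wmat (w^2)"
proof -
  have 1: "(w*l)^3 = l^3" using assms by (simp add: power_mult_distrib)
  have 2: "w * (w * w) = 1" using assms by (simp add: power3_eq_cube mult.assoc)
  then have 3: "w * (w * (w * w)) = w" "w * (w * (w * (w * (w * w)))) = 1" by simp_all
  have 4: "w ^ 4 = w" "w ^ 6 = 1" using 3 by (simp_all add: numeral_eq_Suc)
  show ?thesis
    by (simp add: matrix_eq_3 matrix_mult_nth gfac_nth 1 Wmat_def)
       (use 2 3 4 in \<open>simp add: power2_eq_square distrib_left mult_ac\<close>)
qed

lemma Pmat_props: "Pmat ** Pmat = mat 1" "Pmat ** Jmat = Wmat (omega^2)" "Jmat ** Pmat = Wmat omega"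
proof -
  have o: "omega * (omega * omega) = 1" using omega_cube by (simp add: power3_eq_cube mult.assoc)
  show "Pmat ** Pmat = mat 1" "Pmat ** Jmat = Wmat (omega^2)" "Jmat ** Pmat = Wmat omega"
    unfolding matrix_eq_3 Pmat_def eps_powers(2,3)
    using o by (simp_all add: matrix_mult_nth mat1_nth Jmat_def Wmat_def power2_eq_square mult_ac)
qed

subsection \<open>The symmetry sigma and the cancellation of poles\<close>

lemma matrix_inv_eq:
  fixes A B :: "complex^3^3"
  assumes "A ** B = mat 1"
  shows "matrix_inv A = B"
proof -
  have BA: "B ** A = mat 1" using assms matrix_left_right_inverse by blast
  have "A ** matrix_inv A = mat 1"
    unfolding matrix_inv_def using someI_ex[of "\<lambda>B. A ** B = mat 1 \<and> B ** A = mat 1"] assms BA by blast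
  then have "B ** (A ** matrix_inv A) = B" by (simp add: matrix_mul_rid)
  then show ?thesis by (simp add: matrix_mul_assoc BA matrix_mul_lid)
qed

lemma matrix_inv_right_inverse:
  fixes A :: "complex^3^3"
  assumes "invertible A"
  shows "A ** matrix_inv A = mat 1" "matrix_inv A ** A = mat 1"
  using assms matrix_inv_eq unfolding invertible_def by metis+

lemma dual_Wmat: "w^3 = 1 \<Longrightarrow> dual (Wmat w) = Wmat (w^2)" "w^3 = 1 \<Longrightarrow> dual (Wmat (w^2)) = Wmat w"
  by (simp_all add: matrix_eq_3 dual_nth Wmat_def power2_eq_square power3_eq_cube mult.assoc)

lemmas W_rules = Wmat_inverse[OF omega_cube] dual_Wmat[OF omega_cube]

lemma Wmat_omega_sq: "Wmat omega ** Wmat omega = Wmat (omega^2)" "Wmat (omega^2) ** Wmat (omega^2) = Wmat omega"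
proof -
  have o: "omega * (omega * omega) = 1" using omega_cube by (simp add: power3_eq_cube mult.assoc)
  show "Wmat omega ** Wmat omega = Wmat (omega^2)" "Wmat (omega^2) ** Wmat (omega^2) = Wmat omega"
    using o by (simp_all add: matrix_eq_3 matrix_mult_nth Wmat_def power2_eq_square mult.assoc)
qed

text \<open>\<open>Pmat\<close> equals both \<open>Wmat (omega^2) ** Jmat\<close> and
  \<open>Jmat ** Wmat omega\<close>. Inserting \<open>Jmat ** Jmat\<close> on either side of the
  transpose turns it into \<open>dual\<close>.\<close>

lemma sigma_eq_dual:
  assumes "A ** B = mat 1"
  shows "sigma A = Wmat (omega^2) ** dual B ** Wmat omega"
proof -
  have "B ** A = mat 1" using assms matrix_left_right_inverse by blast
  then have "transpose A ** transpose B = mat 1"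
    by (metis matrix_transpose_mul transpose_mat)
  then have 1: "matrix_inv (transpose A) = transpose B" by (rule matrix_inv_eq)
  have 2: "matrix_inv Pmat = Pmat" using Pmat_props(1) by (rule matrix_inv_eq)
  have "sigma A = Pmat ** (Jmat ** (Jmat ** transpose B ** Jmat) ** Jmat) ** Pmat"
    unfolding sigma_def 1 2
    by (simp add: matrix_mul_assoc[symmetric] Jmat_involution matrix_mul_lid matrix_mul_rid)
       (simp add: matrix_mul_assoc Jmat_involution matrix_mul_lid)
  also have "\<dots> = Wmat (omega^2) ** dual B ** Wmat omega"
    unfolding dual_def Pmat_props(2)[symmetric] Pmat_props(3)[symmetric]
    by (simp add: matrix_mul_assoc)
  finally show ?thesis .
qed

text \<open>Since \<open>sigma ^ 3\<close> maps \<open>g\<close> to \<open>dual\<close> of its inverse, a loop \<open>g\<close> with the symmetry \<open>sigma\<close> has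
  the inverse \<open>dual (g (-l))\<close>; this replaces \<open>matrix_inv\<close> below.\<close>

definition twisted :: "complex set \<Rightarrow> (complex \<Rightarrow> complex^3^3) \<Rightarrow> bool" where
  "twisted S F \<longleftrightarrow> (\<forall>l\<in>S. F l ** dual (F (-l)) = mat 1 \<and> F (omega * l) = Wmat omega ** F l ** Wmat (omega^2))"

text \<open>The sixth root of unity \<open>eps\<close> generates \<open>l \<mapsto> - l\<close> and \<open>l \<mapsto> omega * l\<close>.\<close>

definition rot_closed :: "complex set \<Rightarrow> bool" where
  "rot_closed S \<longleftrightarrow> (\<forall>l\<in>S. eps * l \<in> S)"

lemma rot_closedD:
  assumes "rot_closed S" "l \<in> S"
  shows "- l \<in> S" "omega * l \<in> S" "eps * l \<in> S"
proof -
  show 1: "eps * l \<in> S" using assms by (simp add: rot_closed_def)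
  then have "eps * (eps * l) \<in> S" using assms by (simp add: rot_closed_def)
  moreover from this have "eps * (eps * (eps * l)) \<in> S" using assms by (simp add: rot_closed_def)
  ultimately show "omega * l \<in> S" "- l \<in> S"
    using eps_cube by (simp_all add: omega_def power2_eq_square power3_eq_cube mult.assoc[symmetric])
qed

text \<open>As \<open>eps\<close> is minus the square of \<open>omega\<close>, rotation by
  \<open>eps\<close> is the reflection \<open>l\<close> to \<open>- l\<close> followed by two
  rotations by \<open>omega\<close>; the diagonal conjugations multiply up to the one in
  \<open>sigma_eq_dual\<close>.\<close>

lemma twisted_sigma:
  assumes "rot_closed S" "twisted S F" "l \<in> S"
  shows "sigma (F l) = F (eps * l)"
proof -
  have "F l ** dual (F (-l)) = mat 1" using assms by (simp add: twisted_def)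
  from sigma_eq_dual[OF this] have sF: "sigma (F l) = Wmat (omega^2) ** F (-l) ** Wmat omega"
    by (simp add: dual_dual)
  have tw: "F (omega * x) = Wmat omega ** F x ** Wmat (omega^2)" if "x \<in> S" for x
    using assms(2) that unfolding twisted_def by blast
  have "F (omega * - l) = Wmat omega ** F (-l) ** Wmat (omega^2)"
    "F (omega * (omega * - l)) = Wmat omega ** F (omega * - l) ** Wmat (omega^2)"
    using rot_closedD[OF assms(1)] assms(3) by (blast intro: tw)+
  moreover have "omega * (omega * - l) = eps * l"
    by (simp add: eps_powers(1) power2_eq_square)
  ultimately have "F (eps * l) = (Wmat omega ** Wmat omega) ** F (-l) ** (Wmat (omega^2) ** Wmat (omega^2))"
    by (simp only: matrix_mul_assoc)
  then show ?thesis
    using sF by (simp add: Wmat_omega_sq)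
qed

text \<open>Iterating \<open>sigma\<close>: in two applications the duals and the inverses cancel,
  which leaves the rotation by \<open>omega\<close>; three applications reach \<open>- l\<close> and
  give the inverse.\<close>

lemma sigma_twisted:
  assumes "rot_closed S" "\<And>l. l \<in> S \<Longrightarrow> invertible (F l) \<and> sigma (F l) = F (eps * l)"
  shows "twisted S F"
  unfolding twisted_def
proof
  fix l assume l: "l \<in> S"
  let ?W = "Wmat omega" and ?V = "Wmat (omega^2)"
  define G where "G = matrix_inv (F l)"
  have G: "F l ** G = mat 1" "G ** F l = mat 1"
    using matrix_inv_right_inverse assms(2)[OF l] by (auto simp: G_def)
  have 1: "F (eps * l) = ?V ** dual G ** ?W"
    using sigma_eq_dual[OF G(1)] assms(2)[OF l] by simp
  have dd: "dual G ** dual (F l) = mat 1" "dual (F l) ** dual G = mat 1"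
    using G by (simp_all add: dual_mult[symmetric] dual_mat1)
  have "F (eps * l) ** (?V ** dual (F l) ** ?W) = ?V ** (dual G ** ((?W ** ?V) ** dual (F l))) ** ?W"
    unfolding 1 by (simp add: matrix_mul_assoc)
  also have "\<dots> = mat 1"
    by (simp add: W_rules matrix_mul_lid matrix_mul_rid dd)
  finally have 2: "F (eps * l) ** (?V ** dual (F l) ** ?W) = mat 1" .
  have "F (eps * (eps * l)) = ?V ** dual (?V ** dual (F l) ** ?W) ** ?W"
    using sigma_eq_dual[OF 2] assms(2)[of "eps * l"] rot_closedD[OF assms(1) l] by simp
  also have "\<dots> = (?V ** ?V) ** F l ** (?W ** ?W)"
    by (simp add: dual_mult W_rules dual_dual matrix_mul_assoc)
  also have "eps * (eps * l) = omega * l" by (simp add: omega_def power2_eq_square)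
  finally have 3: "F (omega * l) = ?W ** F l ** ?V"
    by (simp add: Wmat_omega_sq)
  have 4: "F (omega * l) ** (?W ** G ** ?V) = mat 1"
  proof -
    have "F (omega * l) ** (?W ** G ** ?V) = ?W ** (F l ** ((?V ** ?W) ** G)) ** ?V"
      unfolding 3 by (simp add: matrix_mul_assoc)
    then show ?thesis by (simp add: W_rules matrix_mul_lid matrix_mul_rid G)
  qed
  have "F (eps * (omega * l)) = ?V ** dual (?W ** G ** ?V) ** ?W"
    using sigma_eq_dual[OF 4] assms(2)[of "omega * l"] rot_closedD[OF assms(1) l] by simp
  also have "\<dots> = (?V ** ?W) ** dual G ** (?V ** ?W)"
    by (simp add: dual_mult W_rules(3,4) matrix_mul_assoc)
  also have "\<dots> = dual G" by (simp add: W_rules matrix_mul_lid matrix_mul_rid)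
  also have "eps * (omega * l) = - l"
    using eps_cube by (simp add: omega_def power2_eq_square power3_eq_cube mult.assoc[symmetric])
  finally have "F l ** dual (F (-l)) = mat 1" using G by (simp add: dual_dual)
  with 3 show "F l ** dual (F (- l)) = mat 1 \<and> F (omega * l) = ?W ** F l ** ?V" by simp
qed

lemma twisted_mult:
  assumes "twisted S F" "twisted S G"
  shows "twisted S (\<lambda>l. F l ** G l)"
  unfolding twisted_def
proof
  fix l assume l: "l \<in> S"
  let ?W = "Wmat omega" and ?V = "Wmat (omega^2)"
  have F: "F l ** dual (F (-l)) = mat 1" "F (omega * l) = ?W ** F l ** ?V"
   and G: "G l ** dual (G (-l)) = mat 1" "G (omega * l) = ?W ** G l ** ?V"
    using assms l by (auto simp: twisted_def)
  have "F l ** G l ** dual (F (- l) ** G (- l)) = F l ** (G l ** dual (G (-l))) ** dual (F (-l))"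
    by (simp add: dual_mult matrix_mul_assoc)
  also have "\<dots> = mat 1" by (simp add: F G matrix_mul_rid)
  finally have 1: "F l ** G l ** dual (F (- l) ** G (- l)) = mat 1" .
  have "F (omega * l) ** G (omega * l) = ?W ** F l ** (?V ** ?W) ** G l ** ?V"
    by (simp add: F G matrix_mul_assoc)
  then have "F (omega * l) ** G (omega * l) = ?W ** (F l ** G l) ** ?V"
    by (simp add: W_rules matrix_mul_rid matrix_mul_assoc)
  with 1 show "F l ** G l ** dual (F (- l) ** G (- l)) = mat 1 \<and>
    F (omega * l) ** G (omega * l) = ?W ** (F l ** G l) ** ?V" by simp
qed

lemma twisted_dual:
  assumes "twisted S F" "rot_closed S"
  shows "twisted S (\<lambda>l. dual (F (-l)))"
  unfolding twisted_def
proof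
  fix l assume l: "l \<in> S"
  have F: "F l ** dual (F (-l)) = mat 1" and F2: "F (omega * - l) = Wmat omega ** F (- l) ** Wmat (omega^2)"
    using assms l rot_closedD[OF assms(2) l] by (auto simp: twisted_def)
  have "dual (F (- l)) ** F l = mat 1" using F matrix_left_right_inverse by blast
  moreover have "dual (F (- (omega * l))) = Wmat omega ** dual (F (- l)) ** Wmat (omega^2)"
    using F2 by (simp add: dual_mult W_rules matrix_mul_assoc)
  ultimately show "dual (F (- l)) ** dual (dual (F (- (- l)))) = mat 1 \<and>
    dual (F (- (omega * l))) = Wmat omega ** dual (F (- l)) ** Wmat (omega^2)"
    by (simp add: dual_dual)
qed

lemma twisted_gfac:
  assumes "2*b*c \<noteq> 1"
  shows "twisted {l. l^3 \<noteq> a^3 \<and> l^3 \<noteq> - (a^3)} (gfac a b c)"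
  unfolding twisted_def using gfac_mult_dual[OF _ _ assms] gfac_twist[OF omega_cube] by auto

lemma twisted_subset: "twisted S F \<Longrightarrow> T \<subseteq> S \<Longrightarrow> twisted T F"
  by (auto simp: twisted_def)

lemma Adiag_inverse: "d \<noteq> 0 \<Longrightarrow> Adiag d ** Adiag (inverse d) = mat 1"
  by (simp add: matrix_eq_3 matrix_mult_nth mat1_nth Adiag_def)

lemma dual_Adiag: "dual (Adiag d) = Adiag (inverse d)"
  by (simp add: matrix_eq_3 dual_nth Adiag_def)

lemma twisted_Adiag: "d \<noteq> 0 \<Longrightarrow> twisted S (\<lambda>l. Adiag d)"
proof -
  have o: "omega * (omega * omega) = 1" using omega_cube by (simp add: power3_eq_cube mult.assoc)
  show "d \<noteq> 0 \<Longrightarrow> twisted S (\<lambda>l. Adiag d)"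
    unfolding twisted_def dual_Adiag using o
    by (auto simp: Adiag_inverse) (auto simp: matrix_eq_3 matrix_mult_nth Adiag_def Wmat_def power2_eq_square mult_ac)
qed

section \<open>Limits of matrices and removal of the poles\<close>

lemma tendsto_matrix_mult:
  fixes A B :: "complex^3^3"
  assumes "(F \<longlongrightarrow> A) X" "(G \<longlongrightarrow> B) X"
  shows "((\<lambda>x. F x ** G x) \<longlongrightarrow> A ** B) X"
  by (intro vec_tendstoI) (auto simp: matrix_mult_nth intro!: tendsto_intros assms)

lemma tendsto_dual:
  assumes "(F \<longlongrightarrow> A) X"
  shows "((\<lambda>x. dual (F x)) \<longlongrightarrow> dual A) X"
  unfolding dual_def
  by (intro tendsto_matrix_mult tendsto_const) (intro vec_tendstoI, simp add: transpose_nth, intro tendsto_intros assms)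

definition line_vec :: "complex \<Rightarrow> complex \<Rightarrow> complex^3" where
  "line_vec b c = vector [b, c, 1]"

lemma line_vec_nth: "line_vec b c $ 1 = b" "line_vec b c $ 2 = c" "line_vec b c $ 3 = 1"
  by (simp_all add: line_vec_def)

lemma vector_matrix_nth: "(v v* A) $ j = A$1$j * v$1 + A$2$j * v$2 + A$3$j * v$3" for v :: "complex^3"
  by (simp add: vector_matrix_mult_def sum_3)

text \<open>Equality of the image line with the new line, in terms of direction vectors. The nonzero
  factor \<open>t\<close> makes the relation reversible, as needed for the poles of the inverse
  factor.\<close>

definition line_rel :: "(complex^3^3) \<Rightarrow> complex \<Rightarrow> complex \<Rightarrow> complex \<Rightarrow> complex \<Rightarrow> bool" where
  "line_rel F b c b' c' \<longleftrightarrow> (\<exists>t. t \<noteq> 0 \<and> line_vec b c v* F = t *s line_vec b' c')"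

text \<open>Cancels the pole of \<open>gfac a b c\<close> at \<open>a\<close>: its residue there has rank one, with row space the line.\<close>

lemma line_vec_kills_dual_gfac:
  assumes "a \<noteq> 0" "2*b*c \<noteq> 1"
  shows "line_vec b c v* dual (gfac a b c (-a)) = 0"
proof -
  define e where "e = inverse (2*b*c - 1)"
  have e: "e * (2*b*c - 1) = 1" using assms by (simp add: e_def)
  have d: "x / (2*b*c - 1) = x * e" for x by (simp add: e_def divide_inverse)
  define q where "q = 2 / ((-a)^3 - a^3)"
  have q: "q * a^3 = -1" using assms by (simp add: q_def field_simps)
  note g = gfac_nth[of a b c "- a", folded q_def, unfolded d]
  have "\<forall>j. (line_vec b c v* dual (gfac a b c (-a))) $ j = 0"
    unfolding forall_3 vector_matrix_nth dual_nth g line_vec_nth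
    using q e by (simp add: power2_eq_square power3_eq_cube) (intro conjI; algebra)
  then show ?thesis by (simp add: vec_eq_iff)
qed

lemma at_minus_tendsto:
  fixes a :: complex
  shows "(f \<longlongrightarrow> L) (at (- a)) \<longleftrightarrow> ((\<lambda>m. f (- m)) \<longlongrightarrow> L) (at a)"
  using filtermap_at_minus[of a] by (simp add: filterlim_filtermap[symmetric] flip: filterlim_filtermap)

lemma isCont_gfac_nth:
  assumes "l^3 \<noteq> a^3"
  shows "isCont (\<lambda>l. gfac a b c l $ i $ j) l"
proof -
  have 1: "isCont (\<lambda>l. 2 / (l^3 - a^3)) l"
    using assms by (intro isCont_divide isCont_diff isCont_power continuous_ident continuous_const) simp
  have 2: "isCont (\<lambda>l. x * l * y) l" "isCont (\<lambda>l. x * l^2 * y) l" "isCont (\<lambda>l. x * l * y / z) l"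
    "isCont (\<lambda>l. x * l^2 * y / z) l" for x y z
    by (simp_all add: divide_inverse)
  have 3: "isCont (\<lambda>l. x * l) l" "isCont (\<lambda>l. x * l^2) l" for x
    by simp_all
  show ?thesis
    using exhaust_3[of i] exhaust_3[of j]
    by (elim disjE; simp only: gfac_nth; intro isCont_add isCont_mult[where f = "\<lambda>l. 2 / (l^3 - a^3)"] continuous_const 1 2 3)
qed

lemma tendsto_gfac: "l^3 \<noteq> a^3 \<Longrightarrow> (gfac a b c \<longlongrightarrow> gfac a b c l) (at l)"
  using isCont_gfac_nth by (intro vec_tendstoI) (auto simp: isCont_def)

lemma tendsto_dual_gfac:
  assumes "l^3 \<noteq> - (a^3)"
  shows "((\<lambda>l. dual (gfac a b c (-l))) \<longlongrightarrow> dual (gfac a b c (-l))) (at l)"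
proof -
  have "(-l)^3 \<noteq> a^3" using assms by (auto simp: minus_equation_iff)
  from tendsto_gfac[OF this, of b c] show ?thesis
    unfolding at_minus_tendsto by (rule tendsto_dual)
qed

lemma gfac_pole:
  assumes "a \<noteq> 0" "2*b'*c' \<noteq> 1" "(F \<longlongrightarrow> F a) (at a)" "line_rel (F a) b c b' c'"
  shows "((\<lambda>l. (l - a) * (gfac a b c l ** F l ** dual (gfac a b' c' (-l))) $ i $ j) \<longlongrightarrow> 0) (at a)"
proof -
  define M where "M = (\<lambda>l. vector [
          vector [a^3 * b * c / (2*b*c - 1), a * l^2 * c^2 / (2*b*c - 1), a^2 * l * c / (2*b*c - 1)],
          vector [a^2 * l * b^2, a^3 * b * c, a * l^2 * b],
          vector [a * l^2 * b, a^2 * l * c, a^3]] :: complex^3^3)"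
  \<comment> \<open>\<open>(l - a) * gfac a b c l\<close> continued through \<open>a\<close>: the
    factor \<open>l - a\<close> is divided out of \<open>l^3 - a^3\<close>.\<close>
  define G where "G = (\<lambda>l. \<chi> i j. (l - a) * (mat 1 :: complex^3^3) $ i $ j + 2 / (l^2 + l * a + a^2) * M l $ i $ j)"
  have a: "a^2 + a * a + a^2 \<noteq> 0" using assms(1) by (simp add: power2_eq_square)
  have "isCont (\<lambda>l. M l $ i $ j) a" for i j
    using exhaust_3[of i] exhaust_3[of j] by (elim disjE; simp add: M_def divide_inverse)
  moreover have "isCont (\<lambda>l. 2 / (l^2 + l * a + a^2)) a"
    using a by (intro isCont_divide isCont_add isCont_mult isCont_power continuous_ident continuous_const)
  ultimately have "isCont (\<lambda>l. (l - a) * (mat 1 :: complex^3^3) $ i $ j + 2 / (l^2 + l * a + a^2) * M l $ i $ j) a" for i j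
    by (intro isCont_add isCont_mult isCont_diff continuous_ident continuous_const)
  then have G: "(G \<longlongrightarrow> G a) (at a)" by (intro vec_tendstoI) (simp add: G_def isCont_def)
  have "a^3 \<noteq> - (a^3)" using assms(1) by (simp add: eq_neg_iff_add_eq_0)
  then have "((\<lambda>l. dual (gfac a b' c' (-l))) \<longlongrightarrow> dual (gfac a b' c' (-a))) (at a)"
    by (rule tendsto_dual_gfac)
  then have lim: "((\<lambda>l. G l ** F l ** dual (gfac a b' c' (-l))) \<longlongrightarrow> G a ** F a ** dual (gfac a b' c' (-a))) (at a)"
    by (intro tendsto_matrix_mult G assms(3))
  \<comment> \<open>The column of the rank-one residue \<open>G a\<close>, whose row is the line.
    The constant is \<open>2 / (3 * a^2)\<close> times the common factor \<open>a^3\<close>.\<close>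
  define u :: "complex^3" where "u = (2 * a / 3) *s vector [c / (2*b*c - 1), b, 1]"
  have Ga: "G a $ i $ j = u $ i * line_vec b c $ j" for i j
    using exhaust_3[of i] exhaust_3[of j] assms(1)
    by (auto simp: G_def M_def mat1_nth u_def line_vec_nth power2_eq_square power3_eq_cube field_simps)
  have outer: "(G a ** M) $ i $ j = u $ i * (line_vec b c v* M) $ j" for M :: "complex^3^3" and i j
    by (simp add: matrix_mult_nth Ga vector_matrix_nth algebra_simps)
  obtain t where t: "line_vec b c v* F a = t *s line_vec b' c'"
    using assms(4) by (auto simp: line_rel_def)
  have "line_vec b c v* (F a ** dual (gfac a b' c' (-a))) = 0"
    using line_vec_kills_dual_gfac[OF assms(1,2)]
    by (simp add: vector_matrix_mul_assoc[symmetric] t scalar_vector_matrix_assoc)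
  then have zero: "G a ** F a ** dual (gfac a b' c' (-a)) = 0"
    by (simp add: vec_eq_iff outer matrix_mul_assoc[symmetric])
  have eq: "(l - a) * gfac a b c l $ i $ j = G l $ i $ j" if "l \<noteq> a" for l i j
  proof -
    have "l^3 - a^3 = (l - a) * (l^2 + l * a + a^2)" by (simp add: power2_eq_square power3_eq_cube algebra_simps)
    then have "(l - a) * (2 / (l^3 - a^3) * x) = 2 / (l^2 + l * a + a^2) * x" for x
      using that by simp
    moreover have "gfac a b c l $ i $ j = (mat 1 :: complex^3^3) $ i $ j + 2 / (l^3 - a^3) * M l $ i $ j"
      using exhaust_3[of i] exhaust_3[of j] by (auto simp: M_def gfac_nth mat1_nth)
    ultimately show ?thesis by (simp add: G_def distrib_left)
  qed
  have "((\<lambda>l. (G l ** F l ** dual (gfac a b' c' (-l))) $ i $ j) \<longlongrightarrow> 0) (at a)"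
    using tendsto_vec_nth[OF tendsto_vec_nth[OF lim[unfolded zero]]] by simp
  then show ?thesis
  proof (rule Lim_transform_within[where d = 1])
    fix l assume "0 < dist l a"
    then have "l \<noteq> a" by auto
    then show "(G l ** F l ** dual (gfac a b' c' (-l))) $ i $ j
        = (l - a) * (gfac a b c l ** F l ** dual (gfac a b' c' (-l))) $ i $ j"
      by (simp add: matrix_mult_nth eq[symmetric] algebra_simps)
  qed simp
qed

text \<open>At \<open>- a\<close> it is the inverse factor that is singular. Taking
  \<open>dual\<close> and replacing \<open>l\<close> by \<open>- l\<close> exchanges the roles of
  the two factors and replaces \<open>F\<close> by its inverse, which maps the second line back to
  the first; so \<open>gfac_pole\<close> applies.\<close>

lemma gfac_pole_neg:
  assumes "a \<noteq> 0" "2*b*c \<noteq> 1" "F a ** dual (F (-a)) = mat 1" "(F \<longlongrightarrow> F (-a)) (at (-a))"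
    "line_rel (F a) b c b' c'"
  shows "((\<lambda>l. (l + a) * (gfac a b c l ** F l ** dual (gfac a b' c' (-l))) $ i $ j) \<longlongrightarrow> 0) (at (-a))"
proof -
  define F' where "F' = (\<lambda>m. dual (F (-m)))"
  have F': "(F' \<longlongrightarrow> F' a) (at a)"
    unfolding F'_def using assms(4) at_minus_tendsto by (intro tendsto_dual) blast
  obtain t where t: "t \<noteq> 0" "line_vec b c v* F a = t *s line_vec b' c'"
    using assms(5) by (auto simp: line_rel_def)
  have "(line_vec b c v* F a) v* F' a = line_vec b c"
    by (simp add: vector_matrix_mul_assoc F'_def assms(3))
  then have "t *s (line_vec b' c' v* F' a) = line_vec b c"
    by (simp add: t scalar_vector_matrix_assoc)
  then have "inverse t *s (t *s (line_vec b' c' v* F' a)) = inverse t *s line_vec b c"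
    by (rule arg_cong)
  then have "line_vec b' c' v* F' a = inverse t *s line_vec b c"
    using t(1) by (simp add: vector_smult_assoc vec_eq_iff)
  then have rel: "line_rel (F' a) b' c' b c"
    using t(1) by (auto simp: line_rel_def intro!: exI[of _ "inverse t"])
  define Y where "Y = (\<lambda>m. gfac a b' c' m ** F' m ** dual (gfac a b c (-m)))"
  have Y: "((\<lambda>m. (m - a) * Y m $ i $ j) \<longlongrightarrow> 0) (at a)" for i j
    unfolding Y_def by (rule gfac_pole[OF assms(1,2) F' rel])
  have X: "gfac a b c (-m) ** F (-m) ** dual (gfac a b' c' (- (- m))) = dual (Y m)" for m
    by (simp add: Y_def F'_def dual_mult dual_dual matrix_mul_assoc)
  have "((\<lambda>m. - ((m - a) * dual (Y m) $ i $ j)) \<longlongrightarrow> - 0) (at a)"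
    using exhaust_3[of i] exhaust_3[of j] by (elim disjE; simp only: dual_nth; intro tendsto_minus Y)
  then have "((\<lambda>m. (- m + a) * (gfac a b c (-m) ** F (-m) ** dual (gfac a b' c' (- (- m)))) $ i $ j) \<longlongrightarrow> 0) (at a)"
    unfolding X by (simp add: algebra_simps)
  then show ?thesis unfolding at_minus_tendsto .
qed

lemma line_rel_rotate:
  assumes "line_rel M b c b' c'"
  shows "line_rel (Wmat omega ** M ** Wmat (omega^2)) (b * omega^2) (c * omega) (b' * omega^2) (c' * omega)"
proof -
  have o: "omega * (omega * omega) = 1" using omega_cube by (simp add: power3_eq_cube mult.assoc)
  obtain t where t: "t \<noteq> 0" "line_vec b c v* M = t *s line_vec b' c'"
    using assms by (auto simp: line_rel_def)
  have "line_vec (b * omega^2) (c * omega) v* Wmat omega = line_vec b c"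
    using o by (simp add: vec_eq_iff forall_3 vector_matrix_nth line_vec_nth Wmat_def power2_eq_square mult_ac)
  moreover have "line_vec b' c' v* Wmat (omega^2) = line_vec (b' * omega^2) (c' * omega)"
    using o by (simp add: vec_eq_iff forall_3 vector_matrix_nth line_vec_nth Wmat_def power2_eq_square mult_ac)
  ultimately have "line_vec (b * omega^2) (c * omega) v* (Wmat omega ** M ** Wmat (omega^2)) = t *s line_vec (b' * omega^2) (c' * omega)"
    by (simp add: vector_matrix_mul_assoc[symmetric] t scalar_vector_matrix_assoc)
  with t(1) show ?thesis by (auto simp: line_rel_def)
qed

text \<open>\<open>F\<close> satisfies the line relation only at \<open>a\<close> by hypothesis. The
  rotation symmetry transports it to the other cube roots of \<open>a^3\<close>, and the negatives
  are covered by \<open>gfac_pole_neg\<close>.\<close>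

lemma gfac_pole_all:
  assumes a: "a \<noteq> 0" and b: "2*b*c \<noteq> 1" "2*b'*c' \<noteq> 1"
    and F: "twisted S F" "rot_closed S" "a \<in> S" "\<And>l. l \<in> S \<Longrightarrow> (F \<longlongrightarrow> F l) (at l)"
    and rel: "line_rel (F a) b c b' c'" and p: "p^3 = a^3 \<or> p^3 = - (a^3)"
  shows "((\<lambda>l. (l - p) * (gfac a b c l ** F l ** dual (gfac a b' c' (-l))) $ i $ j) \<longlongrightarrow> 0) (at p)"
proof -
  \<comment> \<open>Both factors can be written with pole parameter \<open>q\<close> and suitably
    rotated lines, and \<open>F q\<close> relates these lines. The property is stable under
    multiplying \<open>q\<close> by \<open>omega\<close>.\<close>
  define rep where "rep = (\<lambda>q. q \<in> S \<and> q \<noteq> 0 \<and> (\<exists>b1 c1 b2 c2. gfac a b c = gfac q b1 c1 \<and> gfac a b' c' = gfac q b2 c2 \<and>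
      2*b1*c1 \<noteq> 1 \<and> 2*b2*c2 \<noteq> 1 \<and> line_rel (F q) b1 c1 b2 c2))"
  have step: "rep (q * omega)" if qrep: "rep q" for q
  proof -
    obtain b1 c1 b2 c2 where r: "q \<in> S" "q \<noteq> 0" "gfac a b c = gfac q b1 c1" "gfac a b' c' = gfac q b2 c2"
      "2*b1*c1 \<noteq> 1" "2*b2*c2 \<noteq> 1" "line_rel (F q) b1 c1 b2 c2"
      using qrep unfolding rep_def by (elim conjE exE) (rule that; assumption)
    have o: "omega * (omega * omega) = 1" using omega_cube by (simp add: power3_eq_cube mult.assoc)
    have "F (q * omega) = Wmat omega ** F q ** Wmat (omega^2)"
      using F(1) r(1) unfolding twisted_def mult.commute[of q omega] by blast
    then have n6: "line_rel (F (q * omega)) (b1 * omega^2) (c1 * omega) (b2 * omega^2) (c2 * omega)"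
      using line_rel_rotate[OF r(7)] by simp
    have m: "2*(x * omega^2)*(y * omega) = 2*x*y" for x y
      using o by (simp add: power2_eq_square mult_ac)
    have n5: "2*(b1 * omega^2)*(c1 * omega) \<noteq> 1" "2*(b2 * omega^2)*(c2 * omega) \<noteq> 1"
      using r(5,6) by (simp_all only: m not_False_eq_True)
    have n1: "q * omega \<in> S" using rot_closedD(2)[OF F(2) r(1)] by (simp add: mult.commute)
    have n2: "q * omega \<noteq> 0" using r(2) omega_nonzero by simp
    have n3: "gfac a b c = gfac (q * omega) (b1 * omega^2) (c1 * omega)"
      "gfac a b' c' = gfac (q * omega) (b2 * omega^2) (c2 * omega)"
      by (simp_all only: r(3,4) gfac_rotate[OF omega_cube])
    show ?thesis
      unfolding rep_def by (intro conjI exI) (rule n1 n2 n3 n5 n6)+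
  qed
  have "rep a" unfolding rep_def
    by (intro conjI exI) (rule F(3) a refl b rel)+
  then have "rep a" "rep (a * omega)" "rep (a * omega * omega)" by (simp_all add: step)
  then have rep: "rep q" if "q^3 = a^3" for q
    by (rule_tac cube_eq_cases[OF that]) simp_all
  show ?thesis
    using p
  proof
    assume "p^3 = a^3"
    then have "rep p" by (rule rep)
    then obtain b1 c1 b2 c2 where r: "p \<in> S" "p \<noteq> 0" "gfac a b c = gfac p b1 c1" "gfac a b' c' = gfac p b2 c2"
      "2*b1*c1 \<noteq> 1" "2*b2*c2 \<noteq> 1" "line_rel (F p) b1 c1 b2 c2"
      unfolding rep_def by (elim conjE exE) (rule that; assumption)
    show ?thesis unfolding r(3,4) by (rule gfac_pole[OF r(2,6) F(4)[OF r(1)] r(7)])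
  next
    assume "p^3 = - (a^3)"
    then have "rep (-p)" by (intro rep) simp
    then obtain b1 c1 b2 c2 where r: "-p \<in> S" "-p \<noteq> 0" "gfac a b c = gfac (-p) b1 c1" "gfac a b' c' = gfac (-p) b2 c2"
      "2*b1*c1 \<noteq> 1" "2*b2*c2 \<noteq> 1" "line_rel (F (-p)) b1 c1 b2 c2"
      unfolding rep_def by (elim conjE exE) (rule that; assumption)
    have "p \<in> S" using rot_closedD(1)[OF F(2) r(1)] by simp
    moreover have "F (- p) ** dual (F (- (- p))) = mat 1" using F(1) r(1) by (auto simp: twisted_def)
    ultimately show ?thesis unfolding r(3,4)
      using gfac_pole_neg[where F = F, OF r(2,5) _ _ r(7), of i j] F(4)[of p] by simp
  qed
qed

subsection \<open>Dressing of the frame\<close>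

lemma cline_not_Delta: "\<not> cline b c \<subseteq> Delta \<Longrightarrow> 2 * b * c \<noteq> 1"
  by (auto simp: cline_def Delta_def power2_eq_square mult_ac)

lemma line_relI:
  assumes "line_mult (cline b c) M = cline b' c'"
  shows "line_rel M b c b' c'"
proof -
  have "line_vec b c \<in> cline b c"
    unfolding cline_def by (rule range_eqI[of _ _ 1]) (simp add: line_vec_def)
  then have "line_vec b c v* M \<in> cline b' c'" using assms by (auto simp: line_mult_def)
  then obtain t where t: "line_vec b c v* M = t *s line_vec b' c'"
    by (auto simp: cline_def line_vec_def)
  have "line_vec b' c' \<in> cline b' c'"
    unfolding cline_def by (rule range_eqI[of _ _ 1]) (simp add: line_vec_def)
  then have "line_vec b' c' \<in> (\<lambda>v. v v* M) ` cline b c" using assms by (simp add: line_mult_def)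
  then obtain s where "line_vec b' c' = (s *s line_vec b c) v* M"
    by (auto simp: cline_def line_vec_def)
  then have "line_vec b' c' $ 3 = (s *s (t *s line_vec b' c')) $ 3"
    by (simp add: scalar_vector_matrix_assoc t)
  then have "t \<noteq> 0" by (auto simp: line_vec_nth)
  with t show ?thesis by (auto simp: line_rel_def)
qed

lemma line_rel_solve:
  assumes "line_rel M b c b' c'"
  shows "(line_vec b c v* M) $ 3 \<noteq> 0"
    "b' = (line_vec b c v* M) $ 1 / (line_vec b c v* M) $ 3"
    "c' = (line_vec b c v* M) $ 2 / (line_vec b c v* M) $ 3"
  using assms by (auto simp: line_rel_def line_vec_nth)

section \<open>Smoothness and holomorphy of matrix-valued factors\<close>

lemma smooth_on_matrix:
  fixes F :: "'a::real_normed_vector \<Rightarrow> complex^3^3"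
  assumes "open S" "\<And>i j. smooth_on S (\<lambda>x. F x $ i $ j)"
  shows "smooth_on S F"
  by (intro smooth_on_vec assms)

lemma smooth_on_gfac:
  fixes b c l :: "'a::real_normed_vector \<Rightarrow> complex"
  assumes "open S" "smooth_on S b" "smooth_on S c" "smooth_on S l"
    "\<And>x. x \<in> S \<Longrightarrow> l x ^ 3 \<noteq> a ^ 3" "\<And>x. x \<in> S \<Longrightarrow> 2 * b x * c x \<noteq> 1"
  shows "smooth_on S (\<lambda>x. gfac a (b x) (c x) (l x))"
proof -
  have nz: "l x ^ 3 - a ^ 3 \<noteq> 0" "2 * b x * c x - 1 \<noteq> 0" if "x \<in> S" for x
    using assms(5,6) that by auto
  have q: "smooth_on S (\<lambda>x. 2 / (l x ^ 3 - a ^ 3))"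
    by (rule smooth_on_divide[OF assms(1) smooth_on_const _ nz(1)])
       (rule smooth_on_diff smooth_on_power smooth_on_const assms)+
  have e: "smooth_on S (\<lambda>x. 2 * b x * c x - 1)"
    by (rule smooth_on_diff smooth_on_mult smooth_on_const assms)+
  note d = smooth_on_divide[OF assms(1) _ e nz(2)]
  have "\<forall>i j. smooth_on S (\<lambda>x. gfac a (b x) (c x) (l x) $ i $ j)"
    unfolding forall_3 gfac_nth
    by (rule conjI q d smooth_on_add smooth_on_mult smooth_on_power smooth_on_const assms | assumption)+
  then show ?thesis by (intro smooth_on_matrix[OF assms(1)]) blast
qed

lemma smooth_on_matrix_nth: "open S \<Longrightarrow> smooth_on S F \<Longrightarrow> smooth_on S (\<lambda>x. F x $ i $ j)" for F :: "'a::real_normed_vector \<Rightarrow> complex^3^3"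
  by (intro smooth_on_nth)

lemma smooth_on_dual:
  fixes F :: "'a::real_normed_vector \<Rightarrow> complex^3^3"
  assumes "open S" "smooth_on S F"
  shows "smooth_on S (\<lambda>x. dual (F x))"
proof -
  have "\<forall>i j. smooth_on S (\<lambda>x. dual (F x) $ i $ j)"
    unfolding forall_3 dual_nth by (intro conjI smooth_on_matrix_nth assms)
  then show ?thesis by (intro smooth_on_matrix[OF assms(1)]) blast
qed

lemma smooth_on_Adiag:
  fixes d :: "'a::real_normed_vector \<Rightarrow> complex"
  assumes "open S" "smooth_on S d" "\<And>x. x \<in> S \<Longrightarrow> d x \<noteq> 0"
  shows "smooth_on S (\<lambda>x. Adiag (d x))"
proof -
  have "\<forall>i j. smooth_on S (\<lambda>x. Adiag (d x) $ i $ j)"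
    unfolding forall_3 Adiag_def vector_3
    by (intro conjI smooth_on_inverse smooth_on_const assms)
  then show ?thesis by (intro smooth_on_matrix[OF assms(1)]) blast
qed

lemma smooth_on_vector_matrix_nth:
  fixes F :: "'a::real_normed_vector \<Rightarrow> complex^3^3"
  assumes "open S" "smooth_on S F"
  shows "smooth_on S (\<lambda>x. (v v* F x) $ j)"
  unfolding vector_matrix_nth
  by (intro smooth_on_add smooth_on_mult smooth_on_const smooth_on_matrix_nth assms)

lemma mat_holomorphic_mult:
  assumes "mat_holomorphic_on F S" "mat_holomorphic_on G S"
  shows "mat_holomorphic_on (\<lambda>l. F l ** G l) S"
  using assms unfolding mat_holomorphic_on_def matrix_mult_nth by (auto intro!: holomorphic_intros)

lemma mat_holomorphic_diff:
  "mat_holomorphic_on F A \<Longrightarrow> mat_holomorphic_on G A \<Longrightarrow> mat_holomorphic_on (\<lambda>l. F l - G l) A"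
  by (auto simp: mat_holomorphic_on_def intro: holomorphic_on_diff)

lemma mat_holomorphic_const: "mat_holomorphic_on (\<lambda>l. A) S"
  by (simp add: mat_holomorphic_on_def)

lemma mat_holomorphic_gfac:
  assumes "\<And>l. l \<in> S \<Longrightarrow> l^3 \<noteq> a^3"
  shows "mat_holomorphic_on (gfac a b c) S"
  unfolding mat_holomorphic_on_def
proof (intro allI)
  fix i j :: 3
  have 1: "(\<lambda>l. 2 / (l^3 - a^3)) holomorphic_on S"
    using assms by (auto intro!: holomorphic_intros)
  have 2: "(\<lambda>l. x * l * y) holomorphic_on S" "(\<lambda>l. x * l^2 * y) holomorphic_on S"
    "(\<lambda>l. x * l * y / z) holomorphic_on S" "(\<lambda>l. x * l^2 * y / z) holomorphic_on S"
    "(\<lambda>l. x * l) holomorphic_on S" "(\<lambda>l. x * l^2) holomorphic_on S" for x y z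
    by (auto simp: divide_inverse intro!: holomorphic_intros)
  show "(\<lambda>l. gfac a b c l $ i $ j) holomorphic_on S"
    using exhaust_3[of i] exhaust_3[of j]
    by (elim disjE; simp only: gfac_nth; intro holomorphic_on_add holomorphic_on_mult[OF 1] holomorphic_on_const 2)
qed

lemma mat_holomorphic_dual_neg:
  assumes "mat_holomorphic_on F (uminus ` S)"
  shows "mat_holomorphic_on (\<lambda>l. dual (F (-l))) S"
  unfolding mat_holomorphic_on_def
proof (intro allI)
  fix i j :: 3
  have "(\<lambda>l. - l) holomorphic_on S" by (intro holomorphic_intros)
  then have "(\<lambda>l. F (-l) $ i $ j) holomorphic_on S" for i j
    using holomorphic_on_compose_gen[of "\<lambda>l. - l" S "\<lambda>l. F l $ i $ j" "uminus ` S"] assms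
    by (auto simp: mat_holomorphic_on_def comp_def)
  then show "(\<lambda>l. dual (F (-l)) $ i $ j) holomorphic_on S"
    using exhaust_3[of i] exhaust_3[of j] by (elim disjE; simp only: dual_nth)
qed

lemma mat_holomorphic_subset: "mat_holomorphic_on F S \<Longrightarrow> T \<subseteq> S \<Longrightarrow> mat_holomorphic_on F T"
  by (auto simp: mat_holomorphic_on_def intro: holomorphic_on_subset)

lemma mat_holomorphic_tendsto:
  assumes "mat_holomorphic_on F S" "open S" "l \<in> S"
  shows "(F \<longlongrightarrow> F l) (at l)"
proof (intro vec_tendstoI)
  fix i j
  have "continuous_on S (\<lambda>l. F l $ i $ j)"
    using assms(1) holomorphic_on_imp_continuous_on unfolding mat_holomorphic_on_def by blast
  then have "((\<lambda>l. F l $ i $ j) \<longlongrightarrow> F l $ i $ j) (at l within S)"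
    using assms(3) unfolding continuous_on_def by blast
  then show "((\<lambda>l. F l $ i $ j) \<longlongrightarrow> F l $ i $ j) (at l)"
    unfolding at_within_open[OF assms(3,2)] .
qed

lemma mat_holomorphic_continuous_on: 
  assumes "mat_holomorphic_on F S" shows "continuous_on S F"
  unfolding continuous_on_def
proof (intro ballI vec_tendstoI)
  fix l i j assume l: "l \<in> S"
  have "continuous_on S (\<lambda>l. F l $ i $ j)"
    using assms(1) holomorphic_on_imp_continuous_on unfolding mat_holomorphic_on_def by blast
  then show "((\<lambda>l. F l $ i $ j) \<longlongrightarrow> F l $ i $ j) (at l within S)"
    using l unfolding continuous_on_def by blast
qed
text \<open>Factors on either side that converge at \<open>p\<close> do not disturb a removable
  singularity. This lets the two simple factors of \<open>h\<close> be treated one at a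
  time.\<close>

lemma tendsto_sandwich_pole:
  fixes P Q Y :: "complex \<Rightarrow> complex^3^3"
  assumes "\<And>i j. ((\<lambda>l. (l - p) * Y l $ i $ j) \<longlongrightarrow> 0) (at p)" "(P \<longlongrightarrow> P0) (at p)" "(Q \<longlongrightarrow> Q0) (at p)"
  shows "((\<lambda>l. (l - p) * (P l ** Y l ** Q l) $ i $ j) \<longlongrightarrow> 0) (at p)"
proof -
  define Z where "Z = (\<lambda>l. (\<chi> i j. (l - p) * Y l $ i $ j) :: complex^3^3)"
  have "(Z \<longlongrightarrow> 0) (at p)" using assms(1) by (intro vec_tendstoI) (simp add: Z_def)
  from tendsto_matrix_mult[OF tendsto_matrix_mult[OF assms(2) this] assms(3)]
  have "((\<lambda>l. (P l ** Z l ** Q l) $ i $ j) \<longlongrightarrow> (P0 ** 0 ** Q0) $ i $ j) (at p)"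
    by (intro tendsto_vec_nth)
  moreover have "(P0 ** 0 ** Q0) $ i $ j = 0" by (simp add: matrix_mult_nth)
  moreover have "(P l ** Z l ** Q l) $ i $ j = (l - p) * (P l ** Y l ** Q l) $ i $ j" for l
    by (simp add: matrix_mult_nth Z_def algebra_simps)
  ultimately show ?thesis by simp
qed

lemma finite_cube_roots: "finite {l::complex. l^3 = a}"
  using finite_nth_roots[of 3 a] by simp

lemma neg_eq_iff: "- x = y \<longleftrightarrow> x = - y" for x y :: complex
  by auto

text \<open>Lines enter here through direction vectors and \<open>line_rel\<close>; the inequality
  \<open>2 * b * c \<noteq> 1\<close> expresses that a line is not contained in
  \<open>Delta\<close>.\<close>

locale dressing_data =
  fixes H r0 :: real
    and D :: "complex set"
    and \<psi> :: "complex \<Rightarrow> real"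
    and U :: "complex \<Rightarrow> complex"
    and E :: "complex \<Rightarrow> complex \<Rightarrow> complex^3^3"
    and \<alpha> d b1 c1 b2 c2 :: complex
    and bt1 ct1 bt2 ct2 :: "complex \<Rightarrow> complex"
  assumes H: "H = 2 \<or> H = -2"
    and D: "open D"
    and psi: "smooth_on D \<psi>"
    and frame: "extended_frame D H \<psi> U E"
    and alpha: "\<alpha> \<noteq> 0" "cmod \<alpha> \<noteq> 1"
    and r0: "0 < r0" "r0 < 1" "r0 < cmod \<alpha>" "cmod \<alpha> < 1 / r0"
    and bc1: "2 * b1 * c1 \<noteq> 1" and bc2: "2 * b2 * c2 \<noteq> 1"
    and d: "d \<noteq> 0"
    and h_loop: "loop_GL H r0 (dressing \<alpha> d b1 c1 b2 c2)"
    and line2: "\<And>z. z \<in> D \<Longrightarrow> line_rel (E z (inverse (cnj \<alpha>))) b2 c2 (bt2 z) (ct2 z)"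
    and line1: "\<And>z. z \<in> D \<Longrightarrow> line_rel (gfac (inverse (cnj \<alpha>)) b2 c2 \<alpha> ** E z \<alpha>
               ** matrix_inv (gfac (inverse (cnj \<alpha>)) (bt2 z) (ct2 z) \<alpha>)) b1 c1 (bt1 z) (ct1 z)"
    and bct1: "\<And>z. z \<in> D \<Longrightarrow> 2 * bt1 z * ct1 z \<noteq> 1"
    and bct2: "\<And>z. z \<in> D \<Longrightarrow> 2 * bt2 z * ct2 z \<noteq> 1"
    and pos: "\<And>z. z \<in> D \<Longrightarrow> (2 * bt1 z * ct1 z - 1) * (2 * bt2 z * ct2 z - 1) \<in> \<real> \<and>
          0 < Re ((2 * bt1 z * ct1 z - 1) * (2 * bt2 z * ct2 z - 1))"
begin

definition \<beta> :: complex where "\<beta> = inverse (cnj \<alpha>)"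

definition dt :: "complex \<Rightarrow> real" where
  "dt z = sqrt (Re ((2 * bt1 z * ct1 z - 1) * (2 * bt2 z * ct2 z - 1)))"

definition h :: "complex \<Rightarrow> complex^3^3" where "h = dressing \<alpha> d b1 c1 b2 c2"

definition ht :: "complex \<Rightarrow> complex \<Rightarrow> complex^3^3" where
  "ht z = dressing \<alpha> (of_real (dt z)) (bt1 z) (ct1 z) (bt2 z) (ct2 z)"

definition K :: "complex set" where
  "K = {l. l^3 = \<alpha>^3} \<union> {l. l^3 = - (\<alpha>^3)} \<union> {l. l^3 = \<beta>^3} \<union> {l. l^3 = - (\<beta>^3)}"

definition S :: "complex set" where "S = - {0} - K"

definition S\<beta> :: "complex set" where "S\<beta> = {l. l \<noteq> 0 \<and> l^3 \<noteq> \<beta>^3 \<and> l^3 \<noteq> - (\<beta>^3)}"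

text \<open>The intermediate frame, dressed by the factor at \<open>\<beta>\<close> alone. It is
  regular at \<open>\<alpha>\<close>, and its value there is the matrix that carries the first line
  to the new first line (\<open>X\<beta>_alpha\<close>); so it is the input of the second dressing
  step.\<close>

definition X\<beta> :: "complex \<Rightarrow> complex \<Rightarrow> complex^3^3" where
  "X\<beta> z l = gfac \<beta> b2 c2 l ** E z l ** dual (gfac \<beta> (bt2 z) (ct2 z) (-l))"

definition X :: "complex \<Rightarrow> complex \<Rightarrow> complex^3^3" where
  "X z l = h l ** E z l ** dual (ht z (-l))"

text \<open>Since \<open>\<alpha>\<close> is off the unit circle, \<open>\<alpha>\<close> and its
  reflection \<open>\<beta>\<close> have different moduli. Hence the poles of the two factors and of
  their inverses are disjoint.\<close>

lemma beta_cube: "\<beta> \<noteq> 0" "\<alpha>^3 \<noteq> \<beta>^3" "\<alpha>^3 \<noteq> - (\<beta>^3)"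
proof -
  show "\<beta> \<noteq> 0" using alpha by (simp add: \<beta>_def)
  have "cmod (\<alpha>^3) \<noteq> cmod (\<beta>^3)"
  proof
    assume "cmod (\<alpha>^3) = cmod (\<beta>^3)"
    then have "cmod \<alpha> ^ 3 = inverse (cmod \<alpha>) ^ 3" by (simp add: \<beta>_def norm_power norm_inverse)
    then have "cmod \<alpha> = inverse (cmod \<alpha>)" by (rule power_eq_imp_eq_base) auto
    then have "cmod \<alpha> ^ 2 = 1" using alpha by (simp add: power2_eq_square field_simps)
    then have "cmod \<alpha> = 1" using power2_eq_1_iff[of "cmod \<alpha>"] norm_ge_zero[of \<alpha>] by linarith
    then show False using alpha by simp
  qed
  then show "\<alpha>^3 \<noteq> \<beta>^3" "\<alpha>^3 \<noteq> - (\<beta>^3)" by (auto simp del: norm_power)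
qed

lemma K_finite: "finite K" unfolding K_def using finite_cube_roots by auto

lemma open_S: "open S" unfolding S_def using K_finite by (intro open_Diff finite_imp_closed) auto

lemma open_S\<beta>: "open S\<beta>"
proof -
  have "S\<beta> = - {0} - ({l. l^3 = \<beta>^3} \<union> {l. l^3 = - (\<beta>^3)})" by (auto simp: S\<beta>_def)
  then show ?thesis using finite_cube_roots by (auto intro!: open_Diff finite_imp_closed)
qed

lemma S_iff: "l \<in> S \<longleftrightarrow> l \<noteq> 0 \<and> l^3 \<noteq> \<alpha>^3 \<and> l^3 \<noteq> - (\<alpha>^3) \<and> l^3 \<noteq> \<beta>^3 \<and> l^3 \<noteq> - (\<beta>^3)"
  by (auto simp: S_def K_def)

lemma cube_eps: "(eps * l)^3 = - (l^3)" by (simp add: power_mult_distrib eps_cube)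

lemma rot_S: "rot_closed S" "rot_closed S\<beta>" "rot_closed (- {0})"
  by (auto simp: rot_closed_def S_iff S\<beta>_def cube_eps eps_nonzero neg_eq_iff)

lemma S_sub: "S \<subseteq> S\<beta>" by (auto simp: S_iff S\<beta>_def)

lemma alpha_S\<beta>: "\<alpha> \<in> S\<beta>" "- \<alpha> \<in> S\<beta>"
  using alpha beta_cube by (auto simp: S\<beta>_def neg_eq_iff)

lemma dt_pos: "z \<in> D \<Longrightarrow> dt z > 0"
  using pos by (simp add: dt_def)

lemma dt_sq: "z \<in> D \<Longrightarrow> complex_of_real ((dt z)\<^sup>2) = (2 * bt1 z * ct1 z - 1) * (2 * bt2 z * ct2 z - 1)"
  using pos[of z] by (simp add: dt_def complex_is_Real_iff complex_eq_iff)

lemma E_smooth: "smooth_on (D \<times> (- {0})) (\<lambda>(z, l). E z l)"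
  and E_loop: "z \<in> D \<Longrightarrow> loop_SL H (E z)"
  and E_mc: "z \<in> D \<Longrightarrow> l \<noteq> 0 \<Longrightarrow> matrix_inv (E z l) ** dirderiv (\<lambda>w. E w l) V z = mc_form H \<psi> U l z V"
  using frame by (auto simp: extended_frame_def)

lemma E_hol: "z \<in> D \<Longrightarrow> mat_holomorphic_on (E z) (- {0})"
  using E_loop by (simp add: loop_SL_def)

lemma E_det: "z \<in> D \<Longrightarrow> l \<noteq> 0 \<Longrightarrow> det (E z l) = 1"
  using E_loop by (simp add: loop_SL_def)

lemma E_twisted: "z \<in> D \<Longrightarrow> twisted (- {0}) (E z)"
  by (rule sigma_twisted[OF rot_S(3)]) (use E_loop in \<open>auto simp: loop_SL_def invertible_det_nz\<close>)

lemma E_smooth_slice: "l \<noteq> 0 \<Longrightarrow> smooth_on D (\<lambda>z. E z l)"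
  by (rule smooth_on_slice[OF D _ E_smooth]) auto

text \<open>The new line is known only as a line. Its direction vector is normalised to third
  coordinate 1, so \<open>bt2\<close> and \<open>ct2\<close> are quotients of coordinates of the
  smooth image vector, with nonvanishing denominator.\<close>

lemma bt2_smooth: "smooth_on D bt2" "smooth_on D ct2"
proof -
  let ?v = "\<lambda>z. line_vec b2 c2 v* E z \<beta>"
  have v: "smooth_on D (\<lambda>z. ?v z $ j)" for j
    using E_smooth_slice beta_cube(1) D by (intro smooth_on_vector_matrix_nth) auto
  have r: "z \<in> D \<Longrightarrow> line_rel (E z \<beta>) b2 c2 (bt2 z) (ct2 z)" for z
    using line2 by (simp add: \<beta>_def)
  have "smooth_on D (\<lambda>z. ?v z $ 1 / ?v z $ 3)" "smooth_on D (\<lambda>z. ?v z $ 2 / ?v z $ 3)"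
    using line_rel_solve(1)[OF r] by (intro smooth_on_divide D v; simp)+
  from smooth_on_cong[OF D _ this(1), of bt2] smooth_on_cong[OF D _ this(2), of ct2]
  show "smooth_on D bt2" "smooth_on D ct2"
    using line_rel_solve(2,3)[OF r] by simp_all
qed

lemma X\<beta>_alpha: "z \<in> D \<Longrightarrow> line_rel (X\<beta> z \<alpha>) b1 c1 (bt1 z) (ct1 z)"
proof -
  assume z: "z \<in> D"
  have "matrix_inv (gfac \<beta> (bt2 z) (ct2 z) \<alpha>) = dual (gfac \<beta> (bt2 z) (ct2 z) (-\<alpha>))"
    by (intro matrix_inv_eq gfac_mult_dual beta_cube bct2 z)
  with line1[OF z] show ?thesis by (simp add: X\<beta>_def \<beta>_def)
qed

lemma bt1_smooth: "smooth_on D bt1" "smooth_on D ct1"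
proof -
  have "(- \<alpha>)^3 \<noteq> \<beta>^3" using beta_cube by (simp add: neg_eq_iff)
  then have "smooth_on D (\<lambda>z. X\<beta> z \<alpha>)"
    unfolding X\<beta>_def using bct2 alpha
    by (intro smooth_on_matrix_mult smooth_on_const smooth_on_dual smooth_on_gfac bt2_smooth D E_smooth_slice) auto
  then have v: "smooth_on D (\<lambda>z. (line_vec b1 c1 v* X\<beta> z \<alpha>) $ j)" for j
    by (intro smooth_on_vector_matrix_nth D)
  let ?v = "\<lambda>z. line_vec b1 c1 v* X\<beta> z \<alpha>"
  have "smooth_on D (\<lambda>z. ?v z $ 1 / ?v z $ 3)" "smooth_on D (\<lambda>z. ?v z $ 2 / ?v z $ 3)"
    using line_rel_solve(1)[OF X\<beta>_alpha] by (intro smooth_on_divide D v; simp)+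
  from smooth_on_cong[OF D _ this(1), of bt1] smooth_on_cong[OF D _ this(2), of ct1]
  show "smooth_on D bt1" "smooth_on D ct1"
    using line_rel_solve(2,3)[OF X\<beta>_alpha] by simp_all
qed

lemma ln_dt_smooth: "smooth_on D (\<lambda>z. ln ((dt z)\<^sup>2))"
proof -
  let ?f = "\<lambda>z. Re ((2 * bt1 z * ct1 z - 1) * (2 * bt2 z * ct2 z - 1))"
  have "smooth_on D (\<lambda>z. ln (?f z))"
    using pos by (intro smooth_on_ln smooth_on_Re smooth_on_mult smooth_on_diff smooth_on_const bt1_smooth bt2_smooth D) auto
  moreover have "ln (?f z) = ln ((dt z)\<^sup>2)" if "z \<in> D" for z
    using pos[OF that] by (simp add: dt_def)
  ultimately show ?thesis using smooth_on_cong[OF D, of "\<lambda>z. ln (?f z)"] by simp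
qed

lemma dt_smooth: "smooth_on D dt"
proof -
  \<comment> \<open>The square root is written as the exponential of half the logarithm, both of
    which are known to preserve smoothness.\<close>
  have "smooth_on D (\<lambda>z. exp (ln ((dt z)\<^sup>2) * (1/2)))"
    by (intro smooth_on_exp smooth_on_mult smooth_on_const ln_dt_smooth D)
  moreover have "exp (ln ((dt z)\<^sup>2) * (1/2)) = dt z" if "z \<in> D" for z
    using dt_pos[OF that] by (simp add: ln_realpow)
  ultimately show ?thesis using smooth_on_cong[OF D, of "\<lambda>z. exp (ln ((dt z)\<^sup>2) * (1/2))"] by simp
qed

end

section \<open>The singularities of the dressed frame are removable\<close>

context dressing_data
begin

lemma h_eq: "h = (\<lambda>l. Adiag d ** gfac \<alpha> b1 c1 l ** gfac \<beta> b2 c2 l)"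
  by (rule ext) (simp add: h_def dressing_def \<beta>_def)

lemma ht_eq: "ht z = (\<lambda>l. Adiag (of_real (dt z)) ** gfac \<alpha> (bt1 z) (ct1 z) l ** gfac \<beta> (bt2 z) (ct2 z) l)"
  by (rule ext) (simp add: ht_def dressing_def \<beta>_def)

lemma K_iff: "l \<in> - K \<longleftrightarrow> l^3 \<noteq> \<alpha>^3 \<and> l^3 \<noteq> - (\<alpha>^3) \<and> l^3 \<noteq> \<beta>^3 \<and> l^3 \<noteq> - (\<beta>^3)"
  by (auto simp: K_def)

lemma rot_K: "rot_closed (- K)"
  by (auto simp: rot_closed_def K_def cube_eps neg_eq_iff)

lemma h_twisted: "twisted (- K) h"
  unfolding h_eq
  by (intro twisted_mult twisted_Adiag d twisted_subset[OF twisted_gfac] bc1 bc2) (auto simp: K_def)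

lemma ht_twisted: "z \<in> D \<Longrightarrow> twisted (- K) (ht z)"
  unfolding ht_eq using dt_pos[of z]
  by (intro twisted_mult twisted_Adiag twisted_subset[OF twisted_gfac] bct1 bct2) (auto simp: K_def)

lemma S_sub_K: "S \<subseteq> - K" "S \<subseteq> - {0}" by (auto simp: S_def)

lemma X_twisted: "z \<in> D \<Longrightarrow> twisted S (X z)"
  unfolding X_def
  by (intro twisted_mult twisted_dual rot_S twisted_subset[OF h_twisted] twisted_subset[OF ht_twisted]
      twisted_subset[OF E_twisted] S_sub_K)

lemma X\<beta>_twisted: "z \<in> D \<Longrightarrow> twisted S\<beta> (X\<beta> z)"
  unfolding X\<beta>_def
  by (intro twisted_mult twisted_dual rot_S twisted_subset[OF twisted_gfac]
      twisted_subset[OF E_twisted] bc2 bct2) (auto simp: S\<beta>_def)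

lemma X_eq: "X z l = Adiag d ** (gfac \<alpha> b1 c1 l ** X\<beta> z l ** dual (gfac \<alpha> (bt1 z) (ct1 z) (-l)))
    ** Adiag (inverse (of_real (dt z)))"
  by (simp add: X_def X\<beta>_def h_eq ht_eq dual_mult dual_Adiag matrix_mul_assoc)

text \<open>The same product, bracketed so that at the poles belonging to \<open>\<beta>\<close>
  only \<open>X\<beta>\<close> is singular. In \<open>X_eq\<close> the bracket collects the
  singularities at the poles belonging to \<open>\<alpha>\<close>.\<close>

lemma X_eq': "X z l = (Adiag d ** gfac \<alpha> b1 c1 l) ** X\<beta> z l ** (dual (gfac \<alpha> (bt1 z) (ct1 z) (-l))
    ** Adiag (inverse (of_real (dt z))))"
  by (simp add: X_eq matrix_mul_assoc)

lemma X\<beta>_hol: "z \<in> D \<Longrightarrow> mat_holomorphic_on (X\<beta> z) S\<beta>"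
  unfolding X\<beta>_def
  by (intro mat_holomorphic_mult mat_holomorphic_dual_neg mat_holomorphic_gfac mat_holomorphic_subset[OF E_hol])
     (auto simp: S\<beta>_def neg_eq_iff)

lemma X_hol: "z \<in> D \<Longrightarrow> mat_holomorphic_on (X z) S"
  unfolding X_eq
  by (intro mat_holomorphic_mult mat_holomorphic_const mat_holomorphic_dual_neg mat_holomorphic_gfac
      mat_holomorphic_subset[OF X\<beta>_hol] S_sub) (auto simp: S_iff neg_eq_iff)

lemma X_smooth: "smooth_on (D \<times> S) (\<lambda>(z, l). X z l)"
proof -
  have o: "open (D \<times> S)" using D open_S by (rule open_Times)
  have f: "smooth_on (D \<times> S) (\<lambda>p. g (fst p))" if "smooth_on D g" for g :: "complex \<Rightarrow> complex"
    by (rule smooth_on_compose[OF o D _ that]) (auto intro!: smooth_on_fst smooth_on_id o)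
  have s: "smooth_on (D \<times> S) (\<lambda>p. snd p)" "smooth_on (D \<times> S) (\<lambda>p. - snd p)"
    by (intro smooth_on_minus smooth_on_snd smooth_on_id o)+
  have dt: "smooth_on D (\<lambda>z. complex_of_real (dt z))"
    by (intro smooth_on_of_real D dt_smooth)
  have E: "smooth_on (D \<times> S) (\<lambda>p. E (fst p) (snd p))"
    using smooth_on_subset[OF E_smooth, of "D \<times> S"] S_sub_K by (auto simp: case_prod_unfold)
  have "smooth_on (D \<times> S) (\<lambda>p. gfac \<beta> b2 c2 (snd p))" "smooth_on (D \<times> S) (\<lambda>p. gfac \<alpha> b1 c1 (snd p))"
    "smooth_on (D \<times> S) (\<lambda>p. gfac \<beta> (bt2 (fst p)) (ct2 (fst p)) (- snd p))"
    "smooth_on (D \<times> S) (\<lambda>p. gfac \<alpha> (bt1 (fst p)) (ct1 (fst p)) (- snd p))"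
    by (intro smooth_on_gfac o s smooth_on_const f bt1_smooth bt2_smooth;
        use bc1 bc2 bct1 bct2 in \<open>force simp: S_iff neg_eq_iff\<close>)+
  moreover have "smooth_on (D \<times> S) (\<lambda>p. Adiag (of_real (dt (fst p))))"
    using dt_pos by (intro smooth_on_Adiag o f dt) force
  ultimately have "smooth_on (D \<times> S) (\<lambda>p. Adiag d ** gfac \<alpha> b1 c1 (snd p) ** gfac \<beta> b2 c2 (snd p) ** E (fst p) (snd p)
    ** dual (Adiag (of_real (dt (fst p))) ** gfac \<alpha> (bt1 (fst p)) (ct1 (fst p)) (- snd p)
      ** gfac \<beta> (bt2 (fst p)) (ct2 (fst p)) (- snd p)))"
    by (intro smooth_on_matrix_mult smooth_on_dual o E smooth_on_const)
  then show ?thesis by (simp add: X_def h_eq ht_eq case_prod_unfold)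
qed

text \<open>At a pole of the inner factor, \<open>gfac_pole_all\<close> is applied to
  \<open>E\<close> and the outer factors converge by \<open>beta_cube\<close>. At a pole of the
  outer factor it is applied to \<open>X\<beta>\<close>, which is holomorphic and twisted
  there.\<close>

lemma X_pole:
  assumes z: "z \<in> D" and p: "p \<in> K"
  shows "((\<lambda>l. (l - p) * X z l $ i $ j) \<longlongrightarrow> 0) (at p)"
proof (cases "p^3 = \<beta>^3 \<or> p^3 = - (\<beta>^3)")
  case True
  have "((\<lambda>l. (l - p) * X\<beta> z l $ i $ j) \<longlongrightarrow> 0) (at p)" for i j
    unfolding X\<beta>_def
  proof (rule gfac_pole_all[OF beta_cube(1) bc2 bct2[OF z] E_twisted[OF z] rot_S(3)])
    show "l \<in> - {0} \<Longrightarrow> (E z \<longlongrightarrow> E z l) (at l)" for l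
      by (rule mat_holomorphic_tendsto[OF E_hol[OF z]]) auto
  qed (use True line2[OF z] beta_cube in \<open>auto simp: \<beta>_def\<close>)
  moreover have "p^3 \<noteq> \<alpha>^3" "p^3 \<noteq> - (\<alpha>^3)" using True beta_cube by (auto simp: neg_eq_iff)
  ultimately show ?thesis unfolding X_eq'
    by (intro tendsto_sandwich_pole[OF _ tendsto_matrix_mult[OF tendsto_const tendsto_gfac]
          tendsto_matrix_mult[OF tendsto_dual_gfac tendsto_const]])
next
  case False
  then have p': "p^3 = \<alpha>^3 \<or> p^3 = - (\<alpha>^3)" using p by (auto simp: K_def)
  have "((\<lambda>l. (l - p) * (gfac \<alpha> b1 c1 l ** X\<beta> z l ** dual (gfac \<alpha> (bt1 z) (ct1 z) (-l))) $ i $ j) \<longlongrightarrow> 0) (at p)" for i j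
  proof (rule gfac_pole_all[OF alpha(1) bc1 bct1[OF z] X\<beta>_twisted[OF z] rot_S(2) alpha_S\<beta>(1) _ X\<beta>_alpha[OF z] p'])
    show "l \<in> S\<beta> \<Longrightarrow> (X\<beta> z \<longlongrightarrow> X\<beta> z l) (at l)" for l
      by (rule mat_holomorphic_tendsto[OF X\<beta>_hol[OF z] open_S\<beta>])
  qed
  then show ?thesis unfolding X_eq
    by (rule tendsto_sandwich_pole[OF _ tendsto_const tendsto_const])
qed

lemma extension_exists:
  "\<exists>Et. smooth_on (D \<times> (- {0})) (\<lambda>(z, l). Et z l) \<and>
    (\<forall>z\<in>D. mat_holomorphic_on (Et z) (- {0}) \<and> (\<forall>l\<in>S. Et z l = X z l))"
proof -
  have "\<exists>G. smooth_on (D \<times> (- {0})) (\<lambda>(z, l). G z l) \<and>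
    (\<forall>z\<in>D. G z holomorphic_on (- {0}) \<and> (\<forall>l\<in>- {0} - K. G z l = X z l $ i $ j))" for i j
  proof (rule smooth_extension[OF D _ K_finite])
    show "smooth_on (D \<times> (- {0} - K)) (\<lambda>(z, l). X z l $ i $ j)"
      using smooth_on_matrix_nth[OF open_Times[OF D open_S] X_smooth, of i j]
      by (simp add: S_def case_prod_unfold)
  qed (use X_hol X_pole in \<open>auto simp: mat_holomorphic_on_def S_def\<close>)
  then obtain G where G: "\<And>i j. smooth_on (D \<times> (- {0})) (\<lambda>(z, l). G i j z l)"
    "\<And>i j z. z \<in> D \<Longrightarrow> G i j z holomorphic_on (- {0})"
    "\<And>i j z l. z \<in> D \<Longrightarrow> l \<in> S \<Longrightarrow> G i j z l = X z l $ i $ j"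
    unfolding S_def by metis
  define Et :: "complex \<Rightarrow> complex \<Rightarrow> complex^3^3" where "Et = (\<lambda>z l. \<chi> i j. G i j z l)"
  have o: "open (D \<times> (- {0::complex}))" using D by (intro open_Times) auto
  have "smooth_on (D \<times> (- {0})) (\<lambda>(z, l). Et z l)"
    using G(1) by (intro smooth_on_matrix o) (simp add: Et_def case_prod_unfold)
  moreover have "mat_holomorphic_on (Et z) (- {0})" if "z \<in> D" for z
    using G(2)[OF that] by (simp add: mat_holomorphic_on_def Et_def)
  moreover have "Et z l = X z l" if "z \<in> D" "l \<in> S" for z l
    using G(3)[OF that] by (simp add: vec_eq_iff Et_def)
  ultimately show ?thesis by blast
qed

end

subsection \<open>The reality condition\<close>

text \<open>The last diagonal entry of \<open>Tmat\<close>: 1 in the hyperbolic and -1 in the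
  elliptic case.\<close>

definition eta :: "real \<Rightarrow> complex" where "eta H = - of_real H / 2"

lemma eta_sq: "H = 2 \<or> H = -2 \<Longrightarrow> eta H * eta H = 1" "H = 2 \<or> H = -2 \<Longrightarrow> cnj (eta H) = eta H"
  by (auto simp: eta_def)

lemma tau_eq: "H = 2 \<or> H = -2 \<Longrightarrow> tau H g = Tmat H ** map_matrix cnj g ** Tmat H"
  "H = 2 \<or> H = -2 \<Longrightarrow> Tmat H ** Tmat H = mat 1"
proof -
  assume H: "H = 2 \<or> H = -2"
  show 1: "Tmat H ** Tmat H = mat 1"
    using eta_sq(1)[OF H]
    by (simp add: matrix_eq_3 matrix_mult_nth mat1_nth Tmat_def eta_def)
  then show "tau H g = Tmat H ** map_matrix cnj g ** Tmat H"
    unfolding tau_def using matrix_inv_eq by metis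
qed

lemma map_matrix_nth: "map_matrix f A $ i $ j = f (A $ i $ j)"
  by (simp add: map_matrix_def)

lemma tau_nth:
  assumes "H = 2 \<or> H = -2"
  shows "tau H g $ 1 $ 1 = cnj (g $ 2 $ 2)" "tau H g $ 1 $ 2 = cnj (g $ 2 $ 1)" "tau H g $ 1 $ 3 = eta H * cnj (g $ 2 $ 3)"
    "tau H g $ 2 $ 1 = cnj (g $ 1 $ 2)" "tau H g $ 2 $ 2 = cnj (g $ 1 $ 1)" "tau H g $ 2 $ 3 = eta H * cnj (g $ 1 $ 3)"
    "tau H g $ 3 $ 1 = eta H * cnj (g $ 3 $ 2)" "tau H g $ 3 $ 2 = eta H * cnj (g $ 3 $ 1)" "tau H g $ 3 $ 3 = cnj (g $ 3 $ 3)"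
  using eta_sq(1)[OF assms]
  by (simp_all add: tau_eq[OF assms] matrix_mult_nth map_matrix_nth Tmat_def eta_def)

lemma map_matrix_cnj_mult: "map_matrix cnj (A ** B) = map_matrix cnj A ** map_matrix cnj B" for A B :: "complex^3^3"
  by (simp add: matrix_eq_3 matrix_mult_nth map_matrix_nth)

lemma tau_mult:
  assumes "H = 2 \<or> H = -2"
  shows "tau H (A ** B) = tau H A ** tau H B"
proof -
  have "tau H A ** tau H B = Tmat H ** map_matrix cnj A ** (Tmat H ** Tmat H) ** map_matrix cnj B ** Tmat H"
    by (simp add: tau_eq(1)[OF assms] matrix_mul_assoc)
  then show ?thesis
    by (simp add: tau_eq[OF assms] matrix_mul_rid map_matrix_cnj_mult matrix_mul_assoc)
qed

lemma tau_mat1: "H = 2 \<or> H = -2 \<Longrightarrow> tau H (mat 1) = mat 1"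
  using eta_sq(1)[of H] by (simp add: matrix_eq_3 tau_nth mat1_nth)

lemma tau_Adiag: "H = 2 \<or> H = -2 \<Longrightarrow> tau H (Adiag (of_real x)) = Adiag (inverse (of_real x))"
  using eta_sq(1)[of H] by (simp add: matrix_eq_3 tau_nth Adiag_def)

lemma tendsto_tau:
  assumes "H = 2 \<or> H = -2" "(F \<longlongrightarrow> A) X"
  shows "((\<lambda>x. tau H (F x)) \<longlongrightarrow> tau H A) X"
  unfolding tau_eq(1)[OF assms(1)]
  by (intro tendsto_matrix_mult tendsto_const vec_tendstoI)
     (auto simp: map_matrix_nth intro!: tendsto_intros assms(2))

text \<open>The conjugation of the argument and the one in \<open>tau\<close> are both
  antiholomorphic, so together they leave a holomorphic map.\<close>

lemma mat_holomorphic_reflect: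
  assumes "H = 2 \<or> H = -2" "mat_holomorphic_on F (- {0})"
  shows "mat_holomorphic_on (\<lambda>l. tau H (F (inverse (cnj l)))) (- {0})"
proof -
  have 1: "(\<lambda>l. cnj (F (inverse (cnj l)) $ i $ j)) holomorphic_on - {0}" for i j
  proof -
    have c: "cnj ` (- {0}) = - {0}"
    proof -
      have "x \<in> cnj ` (- {0})" if "x \<noteq> 0" for x
        by (rule image_eqI[of x cnj "cnj x"]) (use that in auto)
      then show ?thesis by auto
    qed
    have "inverse ` (- {0::complex}) \<subseteq> - {0}" by auto
    then have "(\<lambda>l. F (inverse l) $ i $ j) holomorphic_on - {0}"
      using holomorphic_on_compose_gen[of inverse "- {0}" "\<lambda>l. F l $ i $ j" "- {0}"] assms(2)
        holomorphic_on_inverse[OF holomorphic_on_ident, of "- {0}"]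
      by (auto simp: comp_def mat_holomorphic_on_def)
    then show ?thesis
      using holomorphic_on_compose_cnj_cnj[of "\<lambda>l. F (inverse l) $ i $ j" "- {0}"]
      by (simp add: c comp_def open_Compl)
  qed
  show ?thesis
    unfolding mat_holomorphic_on_def forall_3 tau_nth[OF assms(1)]
    by (intro conjI holomorphic_on_mult holomorphic_on_const 1)
qed

lemma mat_holomorphic_scale:
  assumes "mat_holomorphic_on F (- {0})" "c \<noteq> 0"
  shows "mat_holomorphic_on (\<lambda>l. F (c * l)) (- {0})"
  unfolding mat_holomorphic_on_def
proof (intro allI)
  fix i j
  have "(\<lambda>l. c * l) holomorphic_on (- {0})" by (intro holomorphic_intros)
  moreover have "(\<lambda>l. c * l) ` (- {0}) \<subseteq> - {0}" using assms(2) by auto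
  ultimately show "(\<lambda>l. F (c * l) $ i $ j) holomorphic_on - {0}"
    using holomorphic_on_compose_gen[of "\<lambda>l. c * l" "- {0}" "\<lambda>l. F l $ i $ j" "- {0}"] assms
    by (auto simp: comp_def mat_holomorphic_on_def)
qed

lemma mat_holomorphic_dual_neg':
  "mat_holomorphic_on F (- {0}) \<Longrightarrow> mat_holomorphic_on (\<lambda>l. dual (F (-l))) (- {0})"
  by (rule mat_holomorphic_dual_neg, rule mat_holomorphic_subset) auto

lemma continuous_on_det: "continuous_on S F \<Longrightarrow> continuous_on S (\<lambda>l. det (F l :: complex^3^3))"
  unfolding det_3 by (intro continuous_intros)

text \<open>The simple factor in the chart \<open>w = inverse l\<close> around infinity.\<close>

definition gchart :: "complex \<Rightarrow> complex \<Rightarrow> complex \<Rightarrow> complex \<Rightarrow> complex^3^3" where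
  "gchart a b c w = mat 1 + map_matrix (\<lambda>x. 2 / (1 - a^3 * w^3) * x)
     (vector [
          vector [a^3 * b * c * w^3 / (2*b*c - 1), a * w * c^2 / (2*b*c - 1), a^2 * w^2 * c / (2*b*c - 1)],
          vector [a^2 * w^2 * b^2, a^3 * b * c * w^3, a * w * b],
          vector [a * w * b, a^2 * w^2 * c, a^3 * w^3]])"

lemma gchart_nth:
  "gchart a b c w $ 1 $ 1 = 1 + 2 / (1 - a^3 * w^3) * (a^3 * b * c * w^3 / (2*b*c - 1))"
  "gchart a b c w $ 1 $ 2 = 2 / (1 - a^3 * w^3) * (a * w * c^2 / (2*b*c - 1))"
  "gchart a b c w $ 1 $ 3 = 2 / (1 - a^3 * w^3) * (a^2 * w^2 * c / (2*b*c - 1))"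
  "gchart a b c w $ 2 $ 1 = 2 / (1 - a^3 * w^3) * (a^2 * w^2 * b^2)"
  "gchart a b c w $ 2 $ 2 = 1 + 2 / (1 - a^3 * w^3) * (a^3 * b * c * w^3)"
  "gchart a b c w $ 2 $ 3 = 2 / (1 - a^3 * w^3) * (a * w * b)"
  "gchart a b c w $ 3 $ 1 = 2 / (1 - a^3 * w^3) * (a * w * b)"
  "gchart a b c w $ 3 $ 2 = 2 / (1 - a^3 * w^3) * (a^2 * w^2 * c)"
  "gchart a b c w $ 3 $ 3 = 1 + 2 / (1 - a^3 * w^3) * (a^3 * w^3)"
  by (simp_all add: gchart_def mat1_nth map_matrix_def)

lemma gchart_0: "gchart a b c 0 = mat 1"
  by (simp add: matrix_eq_3 gchart_nth mat1_nth)

lemma gfac_inverse_eq_gchart: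
  assumes "w \<noteq> 0"
  shows "gfac a b c (inverse w) = gchart a b c w"
proof -
  have "inverse w ^ 3 - a^3 = (1 - a^3 * w^3) / w^3" using assms by (simp add: field_simps)
  then have 1: "2 / (inverse w ^ 3 - a^3) = 2 / (1 - a^3 * w^3) * w^3" by simp
  have "w * (w * (inverse w * inverse w)) = 1" using assms by (simp add: field_simps)
  then have 3: "q * w^3 * (x * inverse w * y) = q * (x * w^2 * y)" "q * w^3 * (x * (inverse w)^2 * y) = q * (x * w * y)"
     "q * w^3 * (x * inverse w) = q * (x * w^2)" "q * w^3 * (x * (inverse w)^2) = q * (x * w)"
     "q * w^3 * (x * inverse w * y / z) = q * (x * w^2 * y / z)" "q * w^3 * (x * (inverse w)^2 * y / z) = q * (x * w * y / z)" for q x y z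
    using assms by (simp_all add: power2_eq_square power3_eq_cube divide_inverse)
  show ?thesis
    unfolding matrix_eq_3 gfac_nth gchart_nth 1 3 by (simp add: mult_ac)
qed

lemma mat_holomorphic_gchart:
  assumes "\<And>l. l \<in> S \<Longrightarrow> a^3 * l^3 \<noteq> 1"
  shows "mat_holomorphic_on (gchart a b c) S"
proof -
  have 1: "(\<lambda>l. 2 / (1 - a^3 * l^3)) holomorphic_on S"
    using assms by (auto intro!: holomorphic_intros)
  have 2: "(\<lambda>l. x * l * y) holomorphic_on S" "(\<lambda>l. x * l^2 * y) holomorphic_on S"
    "(\<lambda>l. x * l * y / z) holomorphic_on S" "(\<lambda>l. x * l^2 * y / z) holomorphic_on S"
    "(\<lambda>l. x * l^3) holomorphic_on S" "(\<lambda>l. x * l^3 / z) holomorphic_on S" for x y z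
    by (auto simp: divide_inverse intro!: holomorphic_intros)
  show ?thesis
    unfolding mat_holomorphic_on_def forall_3 gchart_nth
    by (intro conjI holomorphic_on_add holomorphic_on_mult[OF 1] holomorphic_on_const 2)
qed

lemma smooth_on_gchart:
  fixes b c l :: "'a::real_normed_vector \<Rightarrow> complex"
  assumes "open S" "smooth_on S b" "smooth_on S c" "smooth_on S l"
    "\<And>x. x \<in> S \<Longrightarrow> a ^ 3 * l x ^ 3 \<noteq> 1" "\<And>x. x \<in> S \<Longrightarrow> 2 * b x * c x \<noteq> 1"
  shows "smooth_on S (\<lambda>x. gchart a (b x) (c x) (l x))"
proof -
  have nz: "1 - a ^ 3 * l x ^ 3 \<noteq> 0" "2 * b x * c x - 1 \<noteq> 0" if "x \<in> S" for x
    using assms(5,6) that by auto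
  have q: "smooth_on S (\<lambda>x. 2 / (1 - a ^ 3 * l x ^ 3))"
    by (rule smooth_on_divide[OF assms(1) smooth_on_const _ nz(1)])
       (rule smooth_on_diff smooth_on_mult smooth_on_power smooth_on_const assms)+
  have e: "smooth_on S (\<lambda>x. 2 * b x * c x - 1)"
    by (rule smooth_on_diff smooth_on_mult smooth_on_const assms)+
  note d = smooth_on_divide[OF assms(1) _ e nz(2)]
  have "\<forall>i j. smooth_on S (\<lambda>x. gchart a (b x) (c x) (l x) $ i $ j)"
    unfolding forall_3 gchart_nth
    by (rule conjI q d smooth_on_add smooth_on_mult smooth_on_power smooth_on_const assms | assumption)+
  then show ?thesis by (intro smooth_on_matrix[OF assms(1)]) blast
qed

lemma gfac_0: "a \<noteq> 0 \<Longrightarrow> 2*b*c \<noteq> 1 \<Longrightarrow> gfac a b c 0 = - (vector [vector [inverse (2*b*c - 1), 0, 0], vector [0, 2*b*c - 1, 0], vector [0, 0, 1]])"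
  by (simp add: matrix_eq_3 gfac_nth power2_eq_square power3_eq_cube field_simps)

section \<open>The factors near 0 and infinity\<close>

context dressing_data
begin

text \<open>The bounds on \<open>r0\<close> give \<open>r0\<close> smaller than the moduli of both
  \<open>\<alpha>\<close> and \<open>\<beta>\<close>. So the two discs of the loop group avoid all
  poles, at 0 as well as in the chart at infinity.\<close>

lemma small_cubes:
  assumes "cmod l < r0"
  shows "l^3 \<noteq> \<alpha>^3" "l^3 \<noteq> - (\<alpha>^3)" "l^3 \<noteq> \<beta>^3" "l^3 \<noteq> - (\<beta>^3)" "\<alpha>^3 * l^3 \<noteq> 1" "\<beta>^3 * l^3 \<noteq> 1"
    "\<alpha>^3 * l^3 \<noteq> -1" "\<beta>^3 * l^3 \<noteq> -1"
proof -
  have a: "cmod l < cmod \<alpha>" using assms r0 by simp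
  have ar: "cmod \<alpha> * r0 < 1" using r0 by (simp add: field_simps)
  have b: "cmod \<beta> = inverse (cmod \<alpha>)" by (simp add: \<beta>_def norm_inverse)
  have pos: "cmod \<alpha> > 0" using alpha by simp
  have b': "cmod l < cmod \<beta>" unfolding b using ar pos assms by (simp add: field_simps) (smt (verit) mult_right_mono norm_ge_zero mult.commute mult_strict_left_mono)
  have c1: "cmod (x^3) < cmod (y^3)" if "cmod x < cmod y" for x y :: complex
    using that by (simp add: norm_power power_strict_mono)
  have "cmod (\<alpha> * l) < 1" unfolding norm_mult using ar assms pos by (smt (verit) mult_strict_left_mono)
  then have "cmod ((\<alpha> * l)^3) < 1" using c1[of "\<alpha> * l" 1] by simp
  moreover have "cmod (\<beta> * l) < 1" unfolding norm_mult b using a pos by (simp add: field_simps)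
  then have "cmod ((\<beta> * l)^3) < 1" using c1[of "\<beta> * l" 1] by simp
  ultimately show "\<alpha>^3 * l^3 \<noteq> 1" "\<beta>^3 * l^3 \<noteq> 1" "\<alpha>^3 * l^3 \<noteq> -1" "\<beta>^3 * l^3 \<noteq> -1"
    by (auto simp: power_mult_distrib simp del: norm_power)
  show "l^3 \<noteq> \<alpha>^3" "l^3 \<noteq> - (\<alpha>^3)" using c1[OF a] by (auto simp del: norm_power)
  show "l^3 \<noteq> \<beta>^3" "l^3 \<noteq> - (\<beta>^3)" using c1[OF b'] by (auto simp del: norm_power)
qed

lemma small_K: "cmod l < r0 \<Longrightarrow> l \<in> - K"
  unfolding K_iff using small_cubes by blast

lemma unit_K: "cmod l = 1 \<Longrightarrow> l \<in> - K"
proof -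
  assume l: "cmod l = 1"
  have "cmod (l^3) = 1" using l by (simp add: norm_power)
  have c: "x ^ 3 \<noteq> 1" if "0 \<le> x" "x \<noteq> 1" for x :: real
    using that power_eq_imp_eq_base[of x 3 1] by auto
  have "cmod (\<alpha>^3) \<noteq> 1" "cmod (\<beta>^3) \<noteq> 1"
    using alpha(2) c[of "cmod \<alpha>"] c[of "inverse (cmod \<alpha>)"] by (auto simp: norm_power \<beta>_def norm_inverse)
  with \<open>cmod (l^3) = 1\<close> show ?thesis unfolding K_iff by (metis norm_minus_cancel)
qed

lemma small_S: "cmod l < r0 \<Longrightarrow> l \<noteq> 0 \<Longrightarrow> l \<in> S" "cmod l < r0 \<Longrightarrow> l \<noteq> 0 \<Longrightarrow> inverse l \<in> S"
proof -
  assume l: "cmod l < r0" "l \<noteq> 0"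
  show "l \<in> S" using small_K[OF l(1)] l(2) by (simp add: S_def)
  have "inverse l ^ 3 = y \<longleftrightarrow> y * l^3 = 1" for y using l(2) by (auto simp: field_simps)
  then show "inverse l \<in> S" using small_cubes[OF l(1)] l(2) by (simp add: S_iff neg_eq_iff)
qed

definition htw :: "complex \<Rightarrow> complex \<Rightarrow> complex^3^3" where
  "htw z w = Adiag (of_real (dt z)) ** gchart \<alpha> (bt1 z) (ct1 z) w ** gchart \<beta> (bt2 z) (ct2 z) w"

lemma htw_eq: "w \<noteq> 0 \<Longrightarrow> ht z (inverse w) = htw z w"
  by (simp add: ht_eq htw_def gfac_inverse_eq_gchart)

lemma htw_0: "htw z 0 = Adiag (of_real (dt z))"
  by (simp add: htw_def gchart_0 matrix_mul_rid)

text \<open>Each simple factor is minus a diagonal matrix at 0 (\<open>gfac_0\<close>). The signs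
  cancel in the product, and because the square of \<open>dt\<close> is \<open>x * y\<close> the
  remaining diagonal matrix is the inverse of the value at infinity.\<close>

lemma ht_0: "z \<in> D \<Longrightarrow> ht z 0 = Adiag (inverse (of_real (dt z)))"
proof -
  assume z: "z \<in> D"
  define x where "x = 2 * bt1 z * ct1 z - 1"
  define y where "y = 2 * bt2 z * ct2 z - 1"
  define t where "t = complex_of_real (dt z)"
  have xy: "x \<noteq> 0" "y \<noteq> 0" using bct1[OF z] bct2[OF z] by (auto simp: x_def y_def)
  have t: "t * t = x * y" "t \<noteq> 0"
    using dt_sq[OF z] dt_pos[OF z] by (auto simp: t_def x_def y_def power2_eq_square)
  have "t / (x * y) = inverse t" "inverse t * (x * y) = t"
    using t(2) xy by (simp_all add: t(1)[symmetric] field_simps)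
  then show ?thesis
    unfolding ht_eq gfac_0[OF alpha(1) bct1[OF z]] gfac_0[OF beta_cube(1) bct2[OF z]]
      x_def[symmetric] y_def[symmetric] t_def[symmetric]
    by (simp add: matrix_eq_3 matrix_mult_nth Adiag_def field_simps)
qed

lemma htw_hol: "z \<in> D \<Longrightarrow> mat_holomorphic_on (htw z) (ball 0 r0)"
  unfolding htw_def using small_cubes
  by (intro mat_holomorphic_mult mat_holomorphic_const mat_holomorphic_gchart) auto

lemma ht_hol: "z \<in> D \<Longrightarrow> mat_holomorphic_on (ht z) (- K)"
  unfolding ht_eq
  by (intro mat_holomorphic_mult mat_holomorphic_const mat_holomorphic_gfac) (auto simp: K_def)

lemma ht_inverse: "z \<in> D \<Longrightarrow> l \<in> - K \<Longrightarrow> ht z l ** dual (ht z (-l)) = mat 1"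
  "z \<in> D \<Longrightarrow> l \<in> - K \<Longrightarrow> dual (ht z (-l)) ** ht z l = mat 1"
  using ht_twisted matrix_left_right_inverse by (auto simp: twisted_def)

lemma h_inverse: "l \<in> - K \<Longrightarrow> h l ** dual (h (-l)) = mat 1"
  "l \<in> - K \<Longrightarrow> dual (h (-l)) ** h l = mat 1"
  using h_twisted matrix_left_right_inverse by (auto simp: twisted_def)

lemma E_inverse: "z \<in> D \<Longrightarrow> l \<noteq> 0 \<Longrightarrow> E z l ** dual (E z (-l)) = mat 1"
  "z \<in> D \<Longrightarrow> l \<noteq> 0 \<Longrightarrow> dual (E z (-l)) ** E z l = mat 1"
  using E_twisted matrix_left_right_inverse by (auto simp: twisted_def)

text \<open>The reality of \<open>h\<close> is given on the two discs only. This suffices, because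
  the reality defect of \<open>Et\<close> is compared with that of \<open>ht\<close> just near 0 and
  infinity.\<close>

lemma h_reflect:
  assumes "cmod l < r0" "l \<noteq> 0"
  shows "tau H (h (inverse (cnj l))) = h l" "tau H (h (cnj l)) = h (inverse l)"
proof -
  obtain ginf where g: "\<forall>l\<in>ball 0 r0. tau H (if cnj l = 0 then ginf else h (inverse (cnj l))) = h l
      \<and> tau H (h (cnj l)) = (if l = 0 then ginf else h (inverse l))"
    using h_loop unfolding loop_GL_def h_def by auto
  have "l \<in> ball 0 r0" using assms by simp
  from bspec[OF g this] show "tau H (h (inverse (cnj l))) = h l" "tau H (h (cnj l)) = h (inverse l)"
    using assms(2) by simp_all
qed

lemma E_reflect: "z \<in> D \<Longrightarrow> l \<noteq> 0 \<Longrightarrow> tau H (E z (inverse (cnj l))) = E z l"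
  using E_loop by (simp add: loop_SL_def)

lemma tau_inverse:
  assumes "A ** B = mat 1" shows "tau H A ** tau H B = mat 1"
  using assms tau_mult[OF H] tau_mat1[OF H] by metis

lemma det_ht:
  assumes "z \<in> D" "l \<in> - K"
  shows "det (ht z l) = det (h l)"
proof -
  have "dt z \<noteq> 0" using dt_pos[OF assms(1)] by simp
  moreover have "det (Adiag x) = 1" if "x \<noteq> 0" for x using that by (simp add: det_3 Adiag_def)
  ultimately show ?thesis
    using assms(1) assms(2)[unfolded K_iff] d bc1 bc2 bct1 bct2 by (simp add: ht_eq h_eq det_mul det_gfac)
qed

end

text \<open>Fixes one jointly smooth extension of the product. Its algebraic properties are those of
  \<open>X\<close> on \<open>S\<close>, carried over to the punctured plane by continuity.\<close>

locale dressing_result = dressing_data +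
  fixes Et :: "complex \<Rightarrow> complex \<Rightarrow> complex^3^3"
  assumes Et_smooth: "smooth_on (D \<times> (- {0})) (\<lambda>(z, l). Et z l)"
    and Et_hol: "\<And>z. z \<in> D \<Longrightarrow> mat_holomorphic_on (Et z) (- {0})"
    and Et_X: "\<And>z l. z \<in> D \<Longrightarrow> l \<in> S \<Longrightarrow> Et z l = X z l"
begin

lemma eq_off_K:
  fixes F G :: "complex \<Rightarrow> 'b::t2_space"
  assumes "continuous_on (- {0}) F" "continuous_on (- {0}) G" "\<And>l. l \<in> S \<Longrightarrow> F l = G l" "l \<noteq> 0"
  shows "F l = G l"
  using continuous_eq_off_finite[OF _ K_finite assms(1,2), of l] assms(3,4) by (auto simp: S_def)

lemma Et_inverse:
  assumes z: "z \<in> D" and l: "l \<noteq> 0"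
  shows "Et z l ** dual (Et z (-l)) = mat 1" "dual (Et z (-l)) ** Et z l = mat 1"
proof -
  show "Et z l ** dual (Et z (-l)) = mat 1"
  proof (rule eq_off_K[OF _ _ _ l])
    show "continuous_on (- {0}) (\<lambda>l. Et z l ** dual (Et z (-l)))"
      by (intro mat_holomorphic_continuous_on mat_holomorphic_mult mat_holomorphic_dual_neg' Et_hol z)
    show "Et z l ** dual (Et z (-l)) = mat 1" if "l \<in> S" for l
      using X_twisted[OF z] that rot_closedD(1)[OF rot_S(1) that] Et_X[OF z] by (simp add: twisted_def)
  qed auto
  then show "dual (Et z (-l)) ** Et z l = mat 1" using matrix_left_right_inverse by blast
qed

lemma Et_twisted:
  assumes z: "z \<in> D"
  shows "twisted (- {0}) (Et z)"
  unfolding twisted_def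
proof (intro ballI conjI)
  fix l :: complex assume "l \<in> - {0}"
  then have l: "l \<noteq> 0" by simp
  show "Et z l ** dual (Et z (- l)) = mat 1" by (rule Et_inverse[OF z l])
  show "Et z (omega * l) = Wmat omega ** Et z l ** Wmat (omega^2)"
  proof (rule eq_off_K[OF _ _ _ l])
    show "continuous_on (- {0}) (\<lambda>l. Et z (omega * l))"
      by (intro mat_holomorphic_continuous_on mat_holomorphic_scale Et_hol z omega_nonzero)
    show "continuous_on (- {0}) (\<lambda>l. Wmat omega ** Et z l ** Wmat (omega^2))"
      by (intro mat_holomorphic_continuous_on mat_holomorphic_mult mat_holomorphic_const Et_hol z)
    show "Et z (omega * l) = Wmat omega ** Et z l ** Wmat (omega^2)" if "l \<in> S" for l
      using X_twisted[OF z] that rot_closedD(2)[OF rot_S(1) that] Et_X[OF z] by (simp add: twisted_def)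
  qed
qed

text \<open>Off \<open>K\<close> the determinant is that of \<open>h\<close> times that of the
  inverse of \<open>ht\<close>, and these cancel by \<open>det_ht\<close>.\<close>

lemma Et_det:
  assumes z: "z \<in> D" and l: "l \<noteq> 0"
  shows "det (Et z l) = 1"
proof (rule eq_off_K[OF _ _ _ l])
  show "continuous_on (- {0}) (\<lambda>l. det (Et z l))"
    by (intro continuous_on_det mat_holomorphic_continuous_on Et_hol z)
  show "det (Et z l) = 1" if "l \<in> S" for l
  proof -
    have l: "l \<in> - K" "l \<noteq> 0" using that by (auto simp: S_def)
    have "det (ht z l) * det (dual (ht z (-l))) = 1"
      using ht_inverse(1)[OF z l(1)] by (metis det_mul det_I)
    then show ?thesis
      using E_det[OF z l(2)] by (simp add: Et_X[OF z that] X_def det_mul det_ht[OF z l(1)])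
  qed
qed auto

text \<open>The definition of \<open>X\<close> gives the equation off \<open>K\<close>. Both sides
  stay regular at the roots of \<open>l^3 = - (\<alpha>^3)\<close> and
  \<open>l^3 = - (\<beta>^3)\<close>, where only the inverses have poles, so continuity extends it
  to those points.\<close>

lemma factorization:
  assumes z: "z \<in> D" and l: "l \<noteq> 0" "l^3 \<noteq> \<alpha>^3" "l^3 \<noteq> \<beta>^3"
  shows "h l ** E z l = Et z l ** ht z l"
proof -
  define L where "L = - {0} - ({l. l^3 = \<alpha>^3} \<union> {l. l^3 = \<beta>^3})"
  have L: "open L" unfolding L_def using finite_cube_roots by (auto intro!: open_Diff finite_imp_closed)
  have g: "mat_holomorphic_on (gfac \<alpha> b c) L" "mat_holomorphic_on (gfac \<beta> b c) L" for b c
    by (auto intro!: mat_holomorphic_gfac simp: L_def)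
  have sub: "L \<subseteq> - {0}" by (auto simp: L_def)
  show ?thesis
  proof (rule continuous_eq_off_finite[OF L K_finite])
    show "continuous_on L (\<lambda>l. h l ** E z l)" "continuous_on L (\<lambda>l. Et z l ** ht z l)"
      unfolding h_eq ht_eq
      by (intro mat_holomorphic_continuous_on mat_holomorphic_mult mat_holomorphic_const g
          mat_holomorphic_subset[OF E_hol[OF z] sub] mat_holomorphic_subset[OF Et_hol[OF z] sub])+
    show "l \<in> L" using l by (simp add: L_def)
    show "h l ** E z l = Et z l ** ht z l" if "l \<in> L - K" for l
    proof -
      have l: "l \<in> S" "l \<in> - K" using that by (auto simp: S_def L_def)
      show ?thesis
        by (simp add: Et_X[OF z l(1)] X_def matrix_mul_assoc[symmetric] ht_inverse(2)[OF z l(2)] matrix_mul_rid)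
    qed
  qed
qed

text \<open>The defect \<open>R\<close> of the reality condition for \<open>Et\<close> is holomorphic off 0; near 0 and infinity it equals
  the corresponding defect for \<open>ht\<close>, which is bounded, and at 0 it vanishes by the choice of \<open>dt\<close>.\<close>

definition R :: "complex \<Rightarrow> complex \<Rightarrow> complex^3^3" where
  "R z l = tau H (dual (Et z (- inverse (cnj l)))) ** Et z l"

text \<open>After inserting \<open>h E ht\<close>^-1 for \<open>Et\<close>, the inner part of
  \<open>R\<close> consists of \<open>tau\<close> of the inverses of \<open>E\<close> and
  \<open>h\<close> followed by \<open>h\<close> and \<open>E\<close>. It collapses by the reality of
  these two, and only \<open>ht\<close> is left.\<close>

lemma R_eq:
  assumes z: "z \<in> D" and l: "l \<in> S" "inverse (cnj l) \<in> S" and h: "tau H (h (inverse (cnj l))) = h l"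
  shows "R z l = tau H (ht z (inverse (cnj l))) ** dual (ht z (-l))"
proof -
  define m where "m = inverse (cnj l)"
  have m: "m \<in> S" "- m \<in> S" "m \<in> - K" "m \<noteq> 0" "l \<noteq> 0"
    using l rot_closedD(1)[OF rot_S(1) l(2)] by (auto simp: S_def m_def)
  have 1: "tau H (dual (E z (-m))) ** E z l = mat 1"
    using tau_inverse[OF E_inverse(2)[OF z m(4)]] E_reflect[OF z m(5)] by (simp add: m_def)
  have 2: "tau H (dual (h (-m))) ** h l = mat 1"
    using tau_inverse[OF h_inverse(2)[OF m(3)]] h by (simp add: m_def)
  have "R z l = tau H (dual (h (-m) ** E z (-m) ** dual (ht z (- (- m))))) ** (h l ** E z l ** dual (ht z (-l)))"
    by (simp add: R_def m_def[symmetric] Et_X[OF z l(1)] Et_X[OF z m(2)] X_def)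
  also have "\<dots> = tau H (ht z m) ** (tau H (dual (E z (-m))) ** ((tau H (dual (h (-m))) ** h l) ** E z l)) ** dual (ht z (-l))"
    by (simp add: dual_mult dual_dual tau_mult[OF H] matrix_mul_assoc)
  also have "\<dots> = tau H (ht z m) ** dual (ht z (-l))"
    by (simp add: 1 2 matrix_mul_lid matrix_mul_rid)
  finally show ?thesis by (simp add: m_def)
qed

lemma R_small:
  assumes z: "z \<in> D" and l: "cmod l < r0" "l \<noteq> 0"
  shows "R z l = tau H (ht z (inverse (cnj l))) ** dual (ht z (-l))"
    "R z (inverse l) = tau H (ht z (cnj l)) ** dual (ht z (- inverse l))"
proof -
  have c: "cmod (cnj l) < r0" "cnj l \<noteq> 0" using l by auto
  show "R z l = tau H (ht z (inverse (cnj l))) ** dual (ht z (-l))"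
    by (rule R_eq[OF z small_S(1)[OF l] small_S(2)[OF c] h_reflect(1)[OF l]])
  have "inverse (cnj (inverse l)) = cnj l" by simp
  with R_eq[OF z small_S(2)[OF l]] small_S(1)[OF c] h_reflect(2)[OF l]
  show "R z (inverse l) = tau H (ht z (cnj l)) ** dual (ht z (- inverse l))" by simp
qed

lemma htw_tendsto: "z \<in> D \<Longrightarrow> (f \<longlongrightarrow> 0) F \<Longrightarrow> ((\<lambda>l. htw z (f l)) \<longlongrightarrow> htw z 0) F"
  using mat_holomorphic_tendsto[OF htw_hol, of z 0] r0(1)
  by (intro isCont_tendsto_compose[of _ "htw z"]) (auto simp: isCont_def)

lemma ht_tendsto: "z \<in> D \<Longrightarrow> (f \<longlongrightarrow> 0) F \<Longrightarrow> ((\<lambda>l. ht z (f l)) \<longlongrightarrow> ht z 0) F"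
proof -
  assume z: "z \<in> D" and f: "(f \<longlongrightarrow> 0) F"
  have "mat_holomorphic_on (ht z) (ball 0 r0)"
    using small_K by (intro mat_holomorphic_subset[OF ht_hol[OF z]]) auto
  from mat_holomorphic_tendsto[OF this, of 0] r0(1) f
  show ?thesis by (intro isCont_tendsto_compose[of _ "ht z"]) (auto simp: isCont_def)
qed

lemma eventually_small: "eventually (\<lambda>l. cmod l < r0 \<and> l \<noteq> 0) (at 0)"
  using r0(1) by (auto simp: eventually_at intro!: exI[of _ r0])

lemma R_eq_1:
  assumes z: "z \<in> D" and l: "l \<noteq> 0"
  shows "R z l = mat 1"
proof -
  have "R z l $ i $ j - (mat 1 :: complex^3^3) $ i $ j = 0" for i j
  proof (rule Liouville_punctured'[OF _ _ _ l])
    have "mat_holomorphic_on (R z) (- {0})"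
      using mat_holomorphic_reflect[OF H mat_holomorphic_dual_neg'[OF Et_hol[OF z]]]
      unfolding R_def by (intro mat_holomorphic_mult Et_hol z)
    then show "(\<lambda>l. R z l $ i $ j - (mat 1 :: complex^3^3) $ i $ j) holomorphic_on - {0}"
      unfolding mat_holomorphic_on_def by (intro holomorphic_on_diff holomorphic_on_const) blast
    have c: "(cnj \<longlongrightarrow> 0) (at 0)" "((\<lambda>x. - x :: complex) \<longlongrightarrow> 0) (at 0)"
      by (auto intro!: tendsto_eq_intros)
    have L: "((\<lambda>l. tau H (htw z (cnj l)) ** dual (ht z (- l))) \<longlongrightarrow> tau H (htw z 0) ** dual (ht z 0)) (at 0)"
      by (intro tendsto_matrix_mult tendsto_tau H tendsto_dual htw_tendsto ht_tendsto z c)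
    \<comment> \<open>Here the choice of \<open>dt\<close> enters: \<open>tau\<close> inverts
      \<open>Adiag\<close> of the real number \<open>dt\<close>, which matches the value of
      \<open>ht\<close> at 0.\<close>
    have A: "tau H (htw z 0) ** dual (ht z 0) = mat 1"
      using dt_pos[OF z] Adiag_inverse[of "inverse (complex_of_real (dt z))"]
      by (simp add: htw_0 ht_0[OF z] tau_Adiag[OF H] dual_Adiag)
    have ev: "eventually (\<lambda>l. tau H (htw z (cnj l)) ** dual (ht z (- l)) = R z l) (at 0)"
      using eventually_small by eventually_elim (simp add: R_small(1)[OF z] htw_eq)
    have "((R z) \<longlongrightarrow> mat 1) (at 0)"
      using Lim_transform_eventually[OF L ev] unfolding A .
    then have "((\<lambda>l. R z l $ i $ j) \<longlongrightarrow> (mat 1 :: complex^3^3) $ i $ j) (at 0)"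
      by (intro tendsto_vec_nth)
    then show "((\<lambda>l. R z l $ i $ j - (mat 1 :: complex^3^3) $ i $ j) \<longlongrightarrow> 0) (at 0)"
      by (rule LIM_zero)
    \<comment> \<open>At infinity any finite limit suffices, since it is multiplied by
      \<open>w\<close> in the hypothesis of \<open>Liouville_punctured'\<close>.\<close>
    have "((\<lambda>l. tau H (ht z (cnj l)) ** dual (htw z (- l))) \<longlongrightarrow> tau H (ht z 0) ** dual (htw z 0)) (at 0)"
      by (intro tendsto_matrix_mult tendsto_tau H tendsto_dual htw_tendsto ht_tendsto z c)
    then have L: "((\<lambda>w. w * ((tau H (ht z (cnj w)) ** dual (htw z (- w))) $ i $ j - (mat 1 :: complex^3^3) $ i $ j)) \<longlongrightarrow>
      0 * ((tau H (ht z 0) ** dual (htw z 0)) $ i $ j - (mat 1 :: complex^3^3) $ i $ j)) (at 0)"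
      by (intro tendsto_mult tendsto_diff tendsto_const tendsto_vec_nth tendsto_ident_at)
    have ev: "eventually (\<lambda>w. w * ((tau H (ht z (cnj w)) ** dual (htw z (- w))) $ i $ j - (mat 1 :: complex^3^3) $ i $ j)
        = w * (R z (inverse w) $ i $ j - (mat 1 :: complex^3^3) $ i $ j)) (at 0)"
      using eventually_small
    proof eventually_elim
      case (elim w)
      have "htw z (- w) = ht z (- inverse w)" using elim htw_eq[of "- w" z] by simp
      then show ?case using elim by (simp add: R_small(2)[OF z])
    qed
    show "((\<lambda>w. w * (R z (inverse w) $ i $ j - (mat 1 :: complex^3^3) $ i $ j)) \<longlongrightarrow> 0) (at 0)"
      using Lim_transform_eventually[OF L ev] by simp
  qed
  then show ?thesis by (simp add: vec_eq_iff)
qed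

lemma Et_reflect:
  assumes z: "z \<in> D" and l: "l \<noteq> 0"
  shows "tau H (Et z (inverse (cnj l))) = Et z l"
proof -
  let ?m = "inverse (cnj l)"
  have 1: "tau H (Et z ?m) ** tau H (dual (Et z (- ?m))) = mat 1"
    using l by (intro tau_inverse Et_inverse z) auto
  have "tau H (Et z ?m) = tau H (Et z ?m) ** R z l" using R_eq_1[OF z l] by (simp add: matrix_mul_rid)
  also have "\<dots> = (tau H (Et z ?m) ** tau H (dual (Et z (- ?m)))) ** Et z l"
    by (simp add: R_def matrix_mul_assoc)
  finally show ?thesis by (simp add: 1 matrix_mul_lid)
qed

lemma Et_loop: "z \<in> D \<Longrightarrow> loop_SL H (Et z)"
  unfolding loop_SL_def using Et_hol Et_det Et_reflect twisted_sigma[OF rot_S(3) Et_twisted] by auto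

text \<open>With \<open>R\<close> known to be the identity, \<open>R_small\<close> is read
  backwards: the defect of \<open>ht\<close> vanishes as well.\<close>

lemma ht_reflect:
  assumes z: "z \<in> D" and l: "cmod l < r0" "l \<noteq> 0"
  shows "tau H (ht z (inverse (cnj l))) = ht z l" "tau H (ht z (cnj l)) = ht z (inverse l)"
proof -
  have *: "A = ht z l" if "A ** dual (ht z (-l)) = mat 1" "l \<in> - K" for A l
  proof -
    have "A = A ** (dual (ht z (-l)) ** ht z l)" by (simp add: ht_inverse(2)[OF z that(2)] matrix_mul_rid)
    also have "\<dots> = ht z l" by (simp add: matrix_mul_assoc that(1) matrix_mul_lid)
    finally show ?thesis .
  qed
  show "tau H (ht z (inverse (cnj l))) = ht z l"
    using R_small(1)[OF z l] R_eq_1[OF z l(2)] small_K[OF l(1)] by (intro *) simp_all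
  show "tau H (ht z (cnj l)) = ht z (inverse l)"
    using R_small(2)[OF z l] R_eq_1[OF z, of "inverse l"] small_S(2)[OF l] l(2) by (intro *) (simp_all add: S_def)
qed

lemma ht_loop:
  assumes z: "z \<in> D"
  shows "loop_GL H r0 (ht z)"
proof -
  \<comment> \<open>The value at infinity is the diagonal factor alone, since both simple factors
    become the identity there.\<close>
  define g' where "g' = (\<lambda>w. if w = 0 then Adiag (of_real (dt z)) else ht z (inverse w))"
  have dt: "complex_of_real (dt z) \<noteq> 0" using dt_pos[OF z] by simp
  have g': "g' w = htw z w" for w by (simp add: g'_def htw_0 htw_eq)
  have hol: "mat_holomorphic_on (ht z) (ball 0 r0)"
    using small_K by (intro mat_holomorphic_subset[OF ht_hol[OF z]]) auto
  have hol': "mat_holomorphic_on g' (ball 0 r0)"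
    using htw_hol[OF z] by (simp add: g'[abs_def])
  have "invertible (ht z l) \<and> invertible (g' l) \<and>
           tau H (g' (cnj l)) = ht z l \<and> tau H (ht z (cnj l)) = g' l \<and>
           sigma (ht z l) = ht z (eps * l) \<and> sigma (g' l) = g' (l / eps)" if "l \<in> ball 0 r0" for l
  proof -
    have l: "cmod l < r0" using that by simp
    have lK: "l \<in> - K" using small_K[OF l] .
    have inv: "invertible (ht z m)" if "m \<in> - K" for m
      using ht_inverse[OF z that] by (auto simp: invertible_def)
    have sig: "sigma (ht z m) = ht z (eps * m)" if "m \<in> - K" for m
      by (rule twisted_sigma[OF rot_K ht_twisted[OF z] that])
    show ?thesis
    proof (cases "l = 0")
      case True
      have "sigma (Adiag (of_real (dt z))) = Adiag (of_real (dt z))"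
        using twisted_sigma[OF _ twisted_Adiag[OF dt], of UNIV 0] by (simp add: rot_closed_def)
      moreover have "invertible (Adiag (of_real (dt z)))"
        using Adiag_inverse[OF dt] by (auto simp: invertible_def intro: matrix_left_right_inverse[THEN iffD1])
      ultimately show ?thesis
        using True inv[OF lK] sig[OF lK] tau_Adiag[OF H, of "dt z"] tau_Adiag[OF H, of "inverse (dt z)"]
        by (simp add: g'_def ht_0[OF z])
    next
      case False
      have iK: "inverse l \<in> - K" using small_S(2)[OF l False] by (simp add: S_def)
      have "inverse (l / eps) = eps * inverse l" by (simp add: field_simps)
      then show ?thesis
        using False inv[OF lK] inv[OF iK] sig[OF lK] sig[OF iK] ht_reflect[OF z l False] eps_nonzero
        by (simp add: g'_def)
    qed
  qed
  then show ?thesis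
    unfolding loop_GL_def
    by (intro exI[of _ "Adiag (of_real (dt z))"] exI[of _ g'] conjI ballI hol hol') (auto simp: g'_def)
qed

end

subsection \<open>The Maurer-Cartan form\<close>

lemma dirderiv_eqI: "(f has_derivative f') (at z) \<Longrightarrow> dirderiv f V z = f' V"
  using frechet_derivative_at[of f f' z] by (simp add: dirderiv_def)

lemma differentiable_has_derivative: "f differentiable (at z) \<Longrightarrow> (f has_derivative (\<lambda>V. dirderiv f V z)) (at z)"
  by (simp add: dirderiv_def frechet_derivative_works[symmetric] eta_contract_eq)

lemma dirderiv_linear:
  assumes "f differentiable (at z)"
  shows "dirderiv f V z = Re V *\<^sub>R dirderiv f 1 z + Im V *\<^sub>R dirderiv f \<i> z"
proof -
  have lin: "linear (\<lambda>V. dirderiv f V z)"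
    using has_derivative_linear[OF differentiable_has_derivative[OF assms]] .
  have "V = Re V *\<^sub>R 1 + Im V *\<^sub>R \<i>" by (simp add: complex_eq_iff)
  then have "dirderiv f V z = dirderiv f (Re V *\<^sub>R 1 + Im V *\<^sub>R \<i>) z" by simp
  also have "\<dots> = Re V *\<^sub>R dirderiv f 1 z + Im V *\<^sub>R dirderiv f \<i> z"
    using linear_add[OF lin] linear_scale[OF lin] by simp
  finally show ?thesis .
qed

lemma dirderiv_cong:
  assumes "open D" "z \<in> D" "\<And>w. w \<in> D \<Longrightarrow> f w = g w" "f differentiable (at z)"
  shows "dirderiv f V z = dirderiv g V z"
  unfolding dirderiv_def using frechet_derivative_transform_within_open[OF assms(4,1,2)] assms(3) by metis

lemma bounded_bilinear_matrix_mult3: "bounded_bilinear ((**) :: complex^3^3 \<Rightarrow> complex^3^3 \<Rightarrow> complex^3^3)"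
proof -
  have "bilinear ((**) :: complex^3^3 \<Rightarrow> complex^3^3 \<Rightarrow> complex^3^3)"
    by (auto simp: bilinear_def matrix_eq_3 matrix_mult_nth algebra_simps intro!: linearI)
  then show ?thesis by (simp add: bilinear_conv_bounded_bilinear)
qed

lemma dirderiv_matrix_mult:
  fixes F G :: "complex \<Rightarrow> complex^3^3"
  assumes "F differentiable (at z)" "G differentiable (at z)"
  shows "dirderiv (\<lambda>w. F w ** G w) V z = F z ** dirderiv G V z + dirderiv F V z ** G z"
  by (rule dirderiv_eqI[OF bounded_bilinear.FDERIV[OF bounded_bilinear_matrix_mult3
      differentiable_has_derivative[OF assms(1)] differentiable_has_derivative[OF assms(2)]]])

lemma dirderiv_nth:
  fixes F :: "complex \<Rightarrow> 'b::real_normed_vector^'n"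
  assumes "F differentiable (at z)"
  shows "dirderiv (\<lambda>w. F w $ i) V z = dirderiv F V z $ i" "(\<lambda>w. F w $ i) differentiable (at z)"
proof -
  have "((\<lambda>w. F w $ i) has_derivative (\<lambda>V. dirderiv F V z $ i)) (at z)"
    by (rule bounded_linear.has_derivative[OF bounded_linear_vec_nth differentiable_has_derivative[OF assms]])
  then show "dirderiv (\<lambda>w. F w $ i) V z = dirderiv F V z $ i" "(\<lambda>w. F w $ i) differentiable (at z)"
    by (auto intro: dirderiv_eqI differentiableI)
qed

text \<open>Functions of \<open>z\<close> and \<open>l\<close> whose first derivatives in \<open>z\<close> are holomorphic in \<open>l\<close> as well.  The class is
  closed under sums and products, so no theorem on interchanging derivatives is needed.\<close>

definition zhol :: "complex \<Rightarrow> complex set \<Rightarrow> (complex \<Rightarrow> complex \<Rightarrow> complex) \<Rightarrow> bool" where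
  "zhol z L F \<longleftrightarrow> (\<forall>l\<in>L. (\<lambda>w. F w l) differentiable (at z)) \<and> F z holomorphic_on L \<and>
     (\<forall>V. (\<lambda>l. dirderiv (\<lambda>w. F w l) V z) holomorphic_on L)"

lemma zhol_const: "\<phi> holomorphic_on L \<Longrightarrow> zhol z L (\<lambda>w l. \<phi> l)"
  by (auto simp: zhol_def dirderiv_def)

lemma zhol_base: "n differentiable (at z) \<Longrightarrow> zhol z L (\<lambda>w l. n w)"
  by (auto simp: zhol_def)

lemma zhol_mult:
  assumes "zhol z L F" "zhol z L G"
  shows "zhol z L (\<lambda>w l. F w l * G w l)"
proof -
  have d: "((\<lambda>w. F w l * G w l) has_derivative
      (\<lambda>V. F z l * dirderiv (\<lambda>w. G w l) V z + dirderiv (\<lambda>w. F w l) V z * G z l)) (at z)" if "l \<in> L" for l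
    using assms that by (intro has_derivative_mult differentiable_has_derivative) (auto simp: zhol_def)
  have "(\<lambda>l. F z l * dirderiv (\<lambda>w. G w l) V z + dirderiv (\<lambda>w. F w l) V z * G z l) holomorphic_on L" for V
    using assms by (intro holomorphic_intros) (auto simp: zhol_def)
  then have "(\<lambda>l. dirderiv (\<lambda>w. F w l * G w l) V z) holomorphic_on L" for V
    by (rule holomorphic_transform) (simp add: dirderiv_eqI[OF d])
  moreover have "(\<lambda>l. F z l * G z l) holomorphic_on L"
    using assms by (intro holomorphic_on_mult) (auto simp: zhol_def)
  ultimately show ?thesis using d unfolding zhol_def by (auto intro: differentiableI)
qed

lemma zhol_add:
  assumes "zhol z L F" "zhol z L G"
  shows "zhol z L (\<lambda>w l. F w l + G w l)"
proof -
  have d: "((\<lambda>w. F w l + G w l) has_derivative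
      (\<lambda>V. dirderiv (\<lambda>w. F w l) V z + dirderiv (\<lambda>w. G w l) V z)) (at z)" if "l \<in> L" for l
    using assms that by (intro has_derivative_add differentiable_has_derivative) (auto simp: zhol_def)
  have "(\<lambda>l. dirderiv (\<lambda>w. F w l) V z + dirderiv (\<lambda>w. G w l) V z) holomorphic_on L" for V
    using assms by (intro holomorphic_on_add) (auto simp: zhol_def)
  then have "(\<lambda>l. dirderiv (\<lambda>w. F w l + G w l) V z) holomorphic_on L" for V
    by (rule holomorphic_transform) (simp add: dirderiv_eqI[OF d])
  moreover have "(\<lambda>l. F z l + G z l) holomorphic_on L"
    using assms by (intro holomorphic_on_add) (auto simp: zhol_def)
  ultimately show ?thesis using d unfolding zhol_def by (auto intro: differentiableI)
qed

definition mat_zhol :: "complex \<Rightarrow> complex set \<Rightarrow> (complex \<Rightarrow> complex \<Rightarrow> complex^3^3) \<Rightarrow> bool" where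
  "mat_zhol z L F \<longleftrightarrow> (\<forall>i j. zhol z L (\<lambda>w l. F w l $ i $ j))"

lemma mat_zhol_mult: "mat_zhol z L F \<Longrightarrow> mat_zhol z L G \<Longrightarrow> mat_zhol z L (\<lambda>w l. F w l ** G w l)"
  unfolding mat_zhol_def matrix_mult_nth by (auto intro!: zhol_add zhol_mult)

lemma mat_zhol_base:
  assumes "N differentiable (at z)" shows "mat_zhol z L (\<lambda>w l. N w)"
  unfolding mat_zhol_def by (intro allI zhol_base dirderiv_nth(2) assms)

text \<open>Up to the identity matrix, each entry is a function of \<open>l\<close> times a function
  of \<open>z\<close>; the equations \<open>r\<close> bring the entries into this separated form, to
  which \<open>zhol_const\<close> and \<open>zhol_base\<close> apply.\<close>

lemma mat_zhol_gfac:
  assumes "\<And>l. l \<in> L \<Longrightarrow> l^3 \<noteq> a^3" "b differentiable (at z)" "c differentiable (at z)" "2 * b z * c z \<noteq> 1"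
  shows "mat_zhol z L (\<lambda>w l. gfac a (b w) (c w) l)"
proof -
  define q where "q = (\<lambda>l. 2 / (l^3 - a^3))"
  have q: "(\<lambda>l. q l) holomorphic_on L" "(\<lambda>l. q l * l) holomorphic_on L" "(\<lambda>l. q l * l^2) holomorphic_on L"
    unfolding q_def using assms(1) by (auto intro!: holomorphic_intros)
  have e: "(\<lambda>w. x / (2 * b w * c w - 1)) differentiable (at z)" for x
    using assms by (intro derivative_intros) auto
  have n: "(\<lambda>w. a^3 * b w * c w * (1 / (2 * b w * c w - 1))) differentiable (at z)"
    "(\<lambda>w. a * c w * c w * (1 / (2 * b w * c w - 1))) differentiable (at z)"
    "(\<lambda>w. a * a * c w * (1 / (2 * b w * c w - 1))) differentiable (at z)"
    "(\<lambda>w. a * a * (b w)^2) differentiable (at z)" "(\<lambda>w. a^3 * b w * c w) differentiable (at z)"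
    "(\<lambda>w. a * b w) differentiable (at z)" "(\<lambda>w. a * a * c w) differentiable (at z)" "(\<lambda>w. a^3) differentiable (at z)"
    by (intro differentiable_mult differentiable_power differentiable_const assms e)+
  have r: "2 / (l^3 - a^3) * (a^3 * x * y / t) = q l * (a^3 * x * y * (1 / t))"
    "2 / (l^3 - a^3) * (a * l^2 * y^2 / t) = q l * l^2 * (a * y * y * (1 / t))"
    "2 / (l^3 - a^3) * (a^2 * l * y / t) = q l * l * (a * a * y * (1 / t))"
    "2 / (l^3 - a^3) * (a^3 * x * y) = q l * (a^3 * x * y)"
    "2 / (l^3 - a^3) * (a * l^2 * x) = q l * l^2 * (a * x)"
    "2 / (l^3 - a^3) * (a^2 * l * y) = q l * l * (a * a * y)"
    "2 / (l^3 - a^3) * a^3 = q l * a^3" for l x y t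
    by (simp_all add: q_def power2_eq_square divide_inverse)
  show ?thesis
    unfolding mat_zhol_def forall_3 gfac_nth r
    by (intro conjI zhol_add zhol_const[OF holomorphic_on_const] zhol_mult[OF zhol_const[OF q(1)] zhol_base[OF n(1)]]
        zhol_mult[OF zhol_const[OF q(1)] zhol_base[OF n(5)]] zhol_mult[OF zhol_const[OF q(1)] zhol_base[OF n(8)]]
        zhol_mult[OF zhol_const[OF q(2)] zhol_base[OF n(3)]] zhol_mult[OF zhol_const[OF q(2)] zhol_base[OF n(4)]]
        zhol_mult[OF zhol_const[OF q(2)] zhol_base[OF n(7)]]
        zhol_mult[OF zhol_const[OF q(3)] zhol_base[OF n(2)]] zhol_mult[OF zhol_const[OF q(3)] zhol_base[OF n(6)]])
qed

text \<open>The coefficients of \<open>dz\<close> and of its conjugate are treated separately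
  because each has a pole at one end only: \<open>mcA\<close> is affine in \<open>l\<close>, and
  \<open>mcB\<close> is affine in \<open>inverse l\<close>.\<close>

definition mcA :: "real \<Rightarrow> (complex \<Rightarrow> real) \<Rightarrow> (complex \<Rightarrow> complex) \<Rightarrow> complex \<Rightarrow> complex \<Rightarrow> complex^3^3" where
  "mcA H \<psi> U l z =
     (let s = csqrt (- of_real H / 2); e = of_real (exp (\<psi> z / 2)); em = of_real (exp (- \<psi> z));
          pz = wirt_z (\<lambda>w. of_real (\<psi> w)) z
      in vector [vector [pz / 2, 0, s * l * e], vector [l * U z * em, - pz / 2, 0], vector [0, s * l * e, 0]])"

definition mcB :: "real \<Rightarrow> (complex \<Rightarrow> real) \<Rightarrow> (complex \<Rightarrow> complex) \<Rightarrow> complex \<Rightarrow> complex \<Rightarrow> complex^3^3" where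
  "mcB H \<psi> U l z =
     (let s = csqrt (- of_real H / 2); e = of_real (exp (\<psi> z / 2)); em = of_real (exp (- \<psi> z));
          pzb = wirt_zb (\<lambda>w. of_real (\<psi> w)) z
      in vector [vector [- pzb / 2, inverse l * cnj (U z) * em, 0], vector [0, pzb / 2, s * inverse l * e],
           vector [s * inverse l * e, 0, 0]])"

lemma mc_form_nth: "mc_form H \<psi> U l z V $ i $ j = V * mcA H \<psi> U l z $ i $ j + cnj V * mcB H \<psi> U l z $ i $ j"
  using exhaust_3[of i] exhaust_3[of j]
  by (auto simp: mc_form_def mcA_def mcB_def Let_def field_simps)

text \<open>Complexification of a real-linear map of the tangent vector: \<open>t = 1\<close> and \<open>t = -1\<close> give the coefficients
  of \<open>dz\<close> and of its conjugate.\<close>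

definition wcoeff :: "complex \<Rightarrow> (complex \<Rightarrow> complex^3^3) \<Rightarrow> complex^3^3" where
  "wcoeff t f = (\<chi> i j. (f 1 $ i $ j - t * \<i> * f \<i> $ i $ j) / 2)"

lemma wcoeff_mult: "wcoeff t (\<lambda>V. A ** f V ** B) = A ** wcoeff t f ** B"
  by (simp add: matrix_eq_3 matrix_mult_nth wcoeff_def field_simps)

lemma wcoeff_diff: "wcoeff t (\<lambda>V. f V - g V) = wcoeff t f - wcoeff t g"
  by (simp add: vec_eq_iff wcoeff_def field_simps)

lemma wcoeff_mc: "wcoeff 1 (mc_form H \<psi> U l z) = mcA H \<psi> U l z" "wcoeff (-1) (mc_form H \<psi> U l z) = mcB H \<psi> U l z"
  by (simp_all add: vec_eq_iff wcoeff_def mc_form_nth field_simps)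

lemma tendsto_wcoeff:
  assumes "(\<And>V. ((\<lambda>x. f x V) \<longlongrightarrow> g V) X)"
  shows "((\<lambda>x. wcoeff t (f x)) \<longlongrightarrow> wcoeff t g) X"
  unfolding wcoeff_def by (intro vec_tendstoI) (auto intro!: tendsto_intros assms)

section \<open>The new metric and the gauge transformation by \<open>ht\<close>\<close>

context dressing_result
begin

definition \<psi>t :: "complex \<Rightarrow> real" where "\<psi>t z = \<psi> z + ln ((dt z)\<^sup>2)"

lemma psit_smooth: "smooth_on D \<psi>t"
  unfolding \<psi>t_def by (intro smooth_on_add D psi ln_dt_smooth)

lemma exp_psit: "z \<in> D \<Longrightarrow> exp (\<psi>t z) = (dt z)\<^sup>2 * exp (\<psi> z)"
  using dt_pos[of z] by (simp add: \<psi>t_def exp_add)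

lemma exp_psit_half: "z \<in> D \<Longrightarrow> exp (\<psi>t z / 2) = dt z * exp (\<psi> z / 2)"
proof -
  assume z: "z \<in> D"
  have "ln ((dt z)\<^sup>2) / 2 = ln (dt z)" using dt_pos[OF z] by (simp add: ln_realpow)
  then have "\<psi>t z / 2 = ln (dt z) + \<psi> z / 2" by (simp add: \<psi>t_def add_divide_distrib)
  then show ?thesis using dt_pos[OF z] by (simp only: exp_add) simp
qed

lemma exp_psit_neg: "z \<in> D \<Longrightarrow> exp (- \<psi>t z) = exp (- \<psi> z) / (dt z)\<^sup>2"
  using exp_psit[of z] by (simp add: exp_minus divide_inverse)

text \<open>The logarithmic derivative of \<open>dt\<close>, as a real one-form;
  \<open>\<delta>c\<close> holds its complex coefficients in the convention of
  \<open>wcoeff\<close>.\<close>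

definition \<delta> :: "complex \<Rightarrow> complex \<Rightarrow> real" where "\<delta> z V = dirderiv dt V z / dt z"

definition \<delta>c :: "complex \<Rightarrow> complex \<Rightarrow> complex" where
  "\<delta>c t z = (of_real (\<delta> z 1) - t * \<i> * of_real (\<delta> z \<i>)) / 2"

lemma dt_diff: "z \<in> D \<Longrightarrow> (dt has_derivative (\<lambda>V. dirderiv dt V z)) (at z)"
  by (intro differentiable_has_derivative smooth_on_differentiable[OF dt_smooth])

lemma dirderiv_psit: "z \<in> D \<Longrightarrow> dirderiv (\<lambda>w. of_real (\<psi>t w) :: complex) V z
    = dirderiv (\<lambda>w. of_real (\<psi> w)) V z + 2 * of_real (\<delta> z V)"
proof -
  assume z: "z \<in> D"
  have p: "(\<psi> has_derivative (\<lambda>V. dirderiv \<psi> V z)) (at z)"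
    by (intro differentiable_has_derivative smooth_on_differentiable[OF psi] z)
  have 1: "((\<lambda>w. complex_of_real (\<psi> w)) has_derivative (\<lambda>V. of_real (dirderiv \<psi> V z))) (at z)"
    by (intro has_derivative_of_real p)
  have "((\<lambda>w. ln ((dt w)\<^sup>2)) has_derivative (\<lambda>V. 2 * \<delta> z V)) (at z)"
    using dt_pos[OF z] unfolding \<delta>_def
    by (auto intro!: derivative_eq_intros dt_diff[OF z] simp: field_simps power2_eq_square)
  then have "((\<lambda>w. complex_of_real (\<psi>t w)) has_derivative (\<lambda>V. of_real (dirderiv \<psi> V z + 2 * \<delta> z V))) (at z)"
    unfolding \<psi>t_def by (intro has_derivative_of_real has_derivative_add p)
  from dirderiv_eqI[OF this] dirderiv_eqI[OF 1] show ?thesis by simp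
qed

lemma wirt_psit:
  assumes "z \<in> D"
  shows "wirt_z (\<lambda>w. of_real (\<psi>t w)) z = wirt_z (\<lambda>w. of_real (\<psi> w)) z + 2 * \<delta>c 1 z"
    "wirt_zb (\<lambda>w. of_real (\<psi>t w)) z = wirt_zb (\<lambda>w. of_real (\<psi> w)) z + 2 * \<delta>c (-1) z"
  by (simp_all add: wirt_z_def wirt_zb_def dirderiv_psit[OF assms] \<delta>c_def field_simps)

text \<open>The Lie algebra element belonging to \<open>Adiag\<close>: differentiating
  \<open>Adiag\<close> multiplies it by \<open>Ddiag\<close> of the logarithmic derivative.\<close>

definition Ddiag :: "complex \<Rightarrow> complex^3^3" where
  "Ddiag x = vector [vector [x, 0, 0], vector [0, - x, 0], vector [0, 0, 0]]"

lemma Adiag_deriv: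
  assumes z: "z \<in> D"
  shows "((\<lambda>w. Adiag (of_real (dt w))) has_derivative (\<lambda>V. Ddiag (of_real (\<delta> z V)) ** Adiag (of_real (dt z)))) (at z)"
    (is "(?F has_derivative ?F') _")
    and "((\<lambda>w. Adiag (inverse (of_real (dt w)))) has_derivative (\<lambda>V. Ddiag (- of_real (\<delta> z V)) ** Adiag (inverse (of_real (dt z))))) (at z)"
    (is "(?G has_derivative ?G') _")
proof -
  have p: "dt z \<noteq> 0" using dt_pos[OF z] by simp
  have 1: "((\<lambda>w. complex_of_real (dt w)) has_derivative (\<lambda>V. of_real (\<delta> z V) * of_real (dt z))) (at z)"
    using has_derivative_of_real[OF dt_diff[OF z]] p by (simp add: \<delta>_def)
  have 2: "((\<lambda>w. inverse (complex_of_real (dt w))) has_derivative (\<lambda>V. - of_real (\<delta> z V) * inverse (of_real (dt z)))) (at z)"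
    using Deriv.has_derivative_inverse[OF _ 1] p by (simp add: field_simps)
  define L :: "complex \<times> complex \<Rightarrow> complex^3^3" where
    "L = (\<lambda>p. vector [vector [fst p, 0, 0], vector [0, snd p, 0], vector [0, 0, 0]])"
  have L: "bounded_linear L"
    unfolding linear_conv_bounded_linear[symmetric]
    by (rule linearI) (simp_all add: L_def matrix_eq_3)
  \<comment> \<open>\<open>Adiag x\<close> is a bounded linear map of the pair
    \<open>(x, inverse x)\<close> plus a constant. Thus one rule covers both claims, with the two
    coordinates exchanged.\<close>
  have A: "Adiag x = L (x, inverse x) + L (0, 0) + (mat 1 - L (1, 1))" for x
    by (simp add: matrix_eq_3 L_def Adiag_def mat1_nth)
  have B: "((\<lambda>w. Adiag (f w)) has_derivative (\<lambda>V. L (f' V, g' V))) (at z)"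
    if "(f has_derivative f') (at z)" "((\<lambda>w. inverse (f w)) has_derivative g') (at z)" for f f' g'
  proof -
    have "((\<lambda>w. L (f w, inverse (f w)) + L (0, 0) + (mat 1 - L (1, 1))) has_derivative (\<lambda>V. L (f' V, g' V) + 0 + 0)) (at z)"
      by (intro has_derivative_add has_derivative_const bounded_linear.has_derivative[OF L] has_derivative_Pair that)
    then show ?thesis unfolding A by simp
  qed
  have C: "?F' V = L (of_real (\<delta> z V) * of_real (dt z), - of_real (\<delta> z V) * inverse (of_real (dt z)))"
    "?G' V = L (- of_real (\<delta> z V) * inverse (of_real (dt z)), of_real (\<delta> z V) * of_real (dt z))" for V
    by (simp_all add: matrix_eq_3 matrix_mult_nth L_def Adiag_def Ddiag_def)
  show "(?F has_derivative ?F') (at z)"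
    unfolding C by (rule B[OF 1 2])
  show "(?G has_derivative ?G') (at z)"
    unfolding C by (rule B[OF 2]) (use 1 in simp)
qed

lemma open_K: "open (- K)" using K_finite by (intro open_Compl finite_imp_closed)

lemma ht_smooth: "smooth_on (D \<times> (- K)) (\<lambda>(z, l). ht z l)"
  and htw_smooth: "smooth_on (D \<times> ball 0 r0) (\<lambda>(z, l). htw z l)"
proof -
  have f: "smooth_on (D \<times> L) (\<lambda>p. g (fst p))" if "smooth_on D g" "open (D \<times> L)" for g :: "complex \<Rightarrow> complex" and L :: "complex set"
    by (rule smooth_on_compose[OF that(2) D _ that(1)]) (auto intro!: smooth_on_fst smooth_on_id that)
  have A: "smooth_on (D \<times> L) (\<lambda>p. Adiag (of_real (dt (fst p))))" if "open (D \<times> L)" for L :: "complex set"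
  proof -
    have "smooth_on D (\<lambda>z. complex_of_real (dt z))" by (intro smooth_on_of_real D dt_smooth)
    then show ?thesis by (intro smooth_on_Adiag that f) (auto simp: mem_Times_iff dest!: dt_pos)
  qed
  have o: "open (D \<times> (- K))" using D open_K by (rule open_Times)
  have s: "smooth_on (D \<times> (- K)) (\<lambda>p. snd p)" by (intro smooth_on_snd smooth_on_id o)
  have "smooth_on (D \<times> (- K)) (\<lambda>p. gfac \<alpha> (bt1 (fst p)) (ct1 (fst p)) (snd p))"
    "smooth_on (D \<times> (- K)) (\<lambda>p. gfac \<beta> (bt2 (fst p)) (ct2 (fst p)) (snd p))"
    by (intro smooth_on_gfac o s f bt1_smooth bt2_smooth; use bct1 bct2 in \<open>force simp: K_def\<close>)+
  then show "smooth_on (D \<times> (- K)) (\<lambda>(z, l). ht z l)"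
    unfolding ht_eq case_prod_unfold by (intro smooth_on_matrix_mult o A)
  have o: "open (D \<times> ball 0 r0)" using D by (intro open_Times) auto
  have s: "smooth_on (D \<times> ball 0 r0) (\<lambda>p. snd p)" by (intro smooth_on_snd smooth_on_id o)
  have "smooth_on (D \<times> ball 0 r0) (\<lambda>p. gchart \<alpha> (bt1 (fst p)) (ct1 (fst p)) (snd p))"
    "smooth_on (D \<times> ball 0 r0) (\<lambda>p. gchart \<beta> (bt2 (fst p)) (ct2 (fst p)) (snd p))"
    by (intro smooth_on_gchart o s f bt1_smooth bt2_smooth; use bct1 bct2 small_cubes in force)+
  then show "smooth_on (D \<times> ball 0 r0) (\<lambda>(z, l). htw z l)"
    unfolding htw_def case_prod_unfold by (intro smooth_on_matrix_mult o A)
qed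

lemma slice_differentiable:
  fixes F :: "complex \<Rightarrow> complex \<Rightarrow> complex^3^3"
  assumes "smooth_on (D \<times> L) (\<lambda>(z, l). F z l)" "open L" "z \<in> D" "l \<in> L"
  shows "(\<lambda>w. F w l) differentiable (at z)"
  by (rule smooth_on_differentiable[OF smooth_on_slice[OF D assms(2,1,4)] assms(3)])

lemma dirderiv_ht_0:
  assumes z: "z \<in> D"
  shows "dirderiv (\<lambda>w. ht w 0) V z = Ddiag (- of_real (\<delta> z V)) ** Adiag (inverse (of_real (dt z)))"
    "dirderiv (\<lambda>w. htw w 0) V z = Ddiag (of_real (\<delta> z V)) ** Adiag (of_real (dt z))"
proof -
  have "dirderiv (\<lambda>w. ht w 0) V z = dirderiv (\<lambda>w. Adiag (inverse (of_real (dt w)))) V z"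
    using r0(1) small_K[of 0] by (intro dirderiv_cong[OF D z] ht_0 slice_differentiable[OF ht_smooth open_K z]) auto
  then show "dirderiv (\<lambda>w. ht w 0) V z = Ddiag (- of_real (\<delta> z V)) ** Adiag (inverse (of_real (dt z)))"
    using dirderiv_eqI[OF Adiag_deriv(2)[OF z]] by simp
  show "dirderiv (\<lambda>w. htw w 0) V z = Ddiag (of_real (\<delta> z V)) ** Adiag (of_real (dt z))"
    unfolding htw_0 by (rule dirderiv_eqI[OF Adiag_deriv(1)[OF z]])
qed

text \<open>Limit in \<open>l\<close> and derivative in \<open>z\<close> may be exchanged, because
  \<open>ht\<close> and \<open>htw\<close> are jointly smooth around the value 0 of the second
  variable.\<close>

lemma dirderiv_ht_tendsto:
  assumes z: "z \<in> D"
  shows "((\<lambda>l. dirderiv (\<lambda>w. ht w l) V z) \<longlongrightarrow> Ddiag (- of_real (\<delta> z V)) ** Adiag (inverse (of_real (dt z)))) (at 0)"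
    "((\<lambda>l. dirderiv (\<lambda>w. htw w l) V z) \<longlongrightarrow> Ddiag (of_real (\<delta> z V)) ** Adiag (of_real (dt z))) (at 0)"
proof -
  have 0: "0 \<in> - K" "0 \<in> ball 0 r0" using r0(1) small_K[of 0] by auto
  show "((\<lambda>l. dirderiv (\<lambda>w. ht w l) V z) \<longlongrightarrow> Ddiag (- of_real (\<delta> z V)) ** Adiag (inverse (of_real (dt z)))) (at 0)"
    using bspec[OF continuous_on_dirderiv_slice[OF ht_smooth z, of V, unfolded continuous_on_def] 0(1)]
    unfolding dirderiv_ht_0(1)[OF z] at_within_open[OF 0(1) open_K] .
  show "((\<lambda>l. dirderiv (\<lambda>w. htw w l) V z) \<longlongrightarrow> Ddiag (of_real (\<delta> z V)) ** Adiag (of_real (dt z))) (at 0)"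
    using bspec[OF continuous_on_dirderiv_slice[OF htw_smooth z, of V, unfolded continuous_on_def] 0(2)]
    unfolding dirderiv_ht_0(2)[OF z] at_within_open[OF 0(2) open_ball] .
qed

definition Om :: "complex \<Rightarrow> complex \<Rightarrow> complex \<Rightarrow> complex^3^3" where
  "Om z l V = dual (Et z (-l)) ** dirderiv (\<lambda>w. Et w l) V z"

text \<open>Differentiating \<open>h E = Et ht\<close>, with \<open>h\<close> independent of
  \<open>z\<close>, gives a gauge transformation by \<open>ht\<close>. The factor
  \<open>mat 1\<close> puts the second term into the shape that \<open>wcoeff_mult\<close>
  handles.\<close>

lemma Om_S:
  assumes z: "z \<in> D" and l: "l \<in> S"
  shows "Om z l V = ht z l ** mc_form H \<psi> U l z V ** dual (ht z (-l)) - mat 1 ** dirderiv (\<lambda>w. ht w l) V z ** dual (ht z (-l))"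
proof -
  have l0: "l \<noteq> 0" "l \<in> - K" using l by (auto simp: S_def)
  have dE: "(\<lambda>w. E w l) differentiable (at z)"
    by (rule slice_differentiable[OF E_smooth _ z]) (use l0 in auto)
  have dEt: "(\<lambda>w. Et w l) differentiable (at z)"
    by (rule slice_differentiable[OF Et_smooth _ z]) (use l0 in auto)
  have dht: "(\<lambda>w. ht w l) differentiable (at z)"
    by (rule slice_differentiable[OF ht_smooth open_K z l0(2)])
  have "dirderiv (\<lambda>w. h l ** E w l) V z = dirderiv (\<lambda>w. Et w l ** ht w l) V z"
  proof (rule dirderiv_cong[OF D z])
    show "h l ** E w l = Et w l ** ht w l" if "w \<in> D" for w
      using factorization[OF that l0(1)] l by (simp add: S_iff)
    show "(\<lambda>w. h l ** E w l) differentiable at z"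
      by (rule differentiableI[OF bounded_bilinear.FDERIV[OF bounded_bilinear_matrix_mult3 has_derivative_const differentiable_has_derivative[OF dE]]])
  qed
  then have 1: "h l ** dirderiv (\<lambda>w. E w l) V z = Et z l ** dirderiv (\<lambda>w. ht w l) V z + dirderiv (\<lambda>w. Et w l) V z ** ht z l"
    using dirderiv_matrix_mult[OF differentiable_const dE, of "h l" V] dirderiv_matrix_mult[OF dEt dht, of V]
    by (simp add: dirderiv_def matrix_eq_3 matrix_mult_nth)
  have "E z l ** (matrix_inv (E z l) ** dirderiv (\<lambda>w. E w l) V z) = dirderiv (\<lambda>w. E w l) V z"
    using matrix_inv_eq[OF E_inverse(1)[OF z l0(1)]] E_inverse(1)[OF z l0(1)]
    by (simp add: matrix_mul_assoc matrix_mul_lid)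
  then have 2: "dirderiv (\<lambda>w. E w l) V z = E z l ** mc_form H \<psi> U l z V"
    using E_mc[OF z l0(1)] by simp
  have 3: "h l ** E z l = Et z l ** ht z l"
    using factorization[OF z l0(1)] l by (simp add: S_iff)
  have d: "A ** (B - C) = A ** B - A ** C" "(B - C) ** A = B ** A - C ** A" for A B C :: "complex^3^3"
    by (simp_all add: matrix_eq_3 matrix_mult_nth algebra_simps)
  have "dirderiv (\<lambda>w. Et w l) V z ** ht z l = h l ** (E z l ** mc_form H \<psi> U l z V) - Et z l ** dirderiv (\<lambda>w. ht w l) V z"
    using 1 by (simp add: 2)
  also have "\<dots> = Et z l ** (ht z l ** mc_form H \<psi> U l z V - dirderiv (\<lambda>w. ht w l) V z)"
    by (simp add: matrix_mul_assoc 3 d)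
  finally have 4: "dirderiv (\<lambda>w. Et w l) V z ** ht z l = Et z l ** (ht z l ** mc_form H \<psi> U l z V - dirderiv (\<lambda>w. ht w l) V z)" .
  have "Om z l V = dual (Et z (-l)) ** (dirderiv (\<lambda>w. Et w l) V z ** ht z l) ** dual (ht z (-l))"
    by (simp add: Om_def matrix_mul_assoc[symmetric] ht_inverse(1)[OF z l0(2)] matrix_mul_rid)
  also have "\<dots> = (dual (Et z (-l)) ** Et z l) ** (ht z l ** mc_form H \<psi> U l z V - dirderiv (\<lambda>w. ht w l) V z) ** dual (ht z (-l))"
    by (simp add: 4 matrix_mul_assoc)
  also have "\<dots> = (ht z l ** mc_form H \<psi> U l z V - dirderiv (\<lambda>w. ht w l) V z) ** dual (ht z (-l))"
    by (simp add: Et_inverse(2)[OF z l0(1)] matrix_mul_lid)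
  also have "\<dots> = ht z l ** mc_form H \<psi> U l z V ** dual (ht z (-l)) - mat 1 ** dirderiv (\<lambda>w. ht w l) V z ** dual (ht z (-l))"
    by (simp add: d matrix_mul_lid)
  finally show ?thesis .
qed

end

section \<open>Polar parts of the coefficients\<close>

lemma mcA_eq:
  "mcA H \<psi> U l z = vector [vector [wirt_z (\<lambda>w. of_real (\<psi> w)) z / 2, 0, csqrt (- of_real H / 2) * l * of_real (exp (\<psi> z / 2))],
     vector [l * U z * of_real (exp (- \<psi> z)), - wirt_z (\<lambda>w. of_real (\<psi> w)) z / 2, 0],
     vector [0, csqrt (- of_real H / 2) * l * of_real (exp (\<psi> z / 2)), 0]]"
  by (simp add: mcA_def Let_def)

lemma mcB_eq:
  "mcB H \<psi> U l z = vector [vector [- wirt_zb (\<lambda>w. of_real (\<psi> w)) z / 2, inverse l * cnj (U z) * of_real (exp (- \<psi> z)), 0],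
     vector [0, wirt_zb (\<lambda>w. of_real (\<psi> w)) z / 2, csqrt (- of_real H / 2) * inverse l * of_real (exp (\<psi> z / 2))],
     vector [csqrt (- of_real H / 2) * inverse l * of_real (exp (\<psi> z / 2)), 0, 0]]"
  by (simp add: mcB_def Let_def)

lemma mat_holomorphic_mcA: "mat_holomorphic_on (\<lambda>l. mcA H \<psi> U l z) S"
  unfolding mat_holomorphic_on_def forall_3 mcA_eq vector_3 by (intro conjI holomorphic_intros)

lemma mat_holomorphic_mcB: "0 \<notin> S \<Longrightarrow> mat_holomorphic_on (\<lambda>l. mcB H \<psi> U l z) S"
  unfolding mat_holomorphic_on_def forall_3 mcB_eq vector_3 by (intro conjI holomorphic_intros) auto

lemma mat_holomorphic_mc: "0 \<notin> S \<Longrightarrow> mat_holomorphic_on (\<lambda>l. mc_form H \<psi> U l z V) S"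
  using mat_holomorphic_mcA[of H \<psi> U z S] mat_holomorphic_mcB[of S H \<psi> U z]
  unfolding mat_holomorphic_on_def mc_form_nth by (intro allI holomorphic_intros) auto

definition cscale :: "complex \<Rightarrow> complex^3^3 \<Rightarrow> complex^3^3" where
  "cscale c M = (\<chi> i j. c * M $ i $ j)"

lemma cscale_nth: "cscale c M $ i $ j = c * M $ i $ j"
  by (simp add: cscale_def)

lemma cscale_mult: "cscale c (A ** M ** B) = A ** cscale c M ** B"
  by (simp add: matrix_eq_3 matrix_mult_nth cscale_nth algebra_simps)

lemma cscale_diff: "cscale c (A - B) = cscale c A - cscale c B"
  by (simp add: vec_eq_iff cscale_nth algebra_simps)

lemma tendsto_cscale_0: "(F \<longlongrightarrow> M) (at 0) \<Longrightarrow> ((\<lambda>w. cscale w (F w)) \<longlongrightarrow> 0) (at 0)"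
  by (intro vec_tendstoI) (auto simp: cscale_nth intro!: tendsto_eq_intros)

lemma mcA_scaled:
  "w \<noteq> 0 \<Longrightarrow> cscale w (mcA H \<psi> U (inverse w) z) = cscale w (mcA H \<psi> U 0 z) +
     vector [vector [0, 0, csqrt (- of_real H / 2) * of_real (exp (\<psi> z / 2))],
       vector [U z * of_real (exp (- \<psi> z)), 0, 0],
       vector [0, csqrt (- of_real H / 2) * of_real (exp (\<psi> z / 2)), 0]]"
  by (simp add: matrix_eq_3 cscale_nth mcA_eq)

text \<open>By the convention \<open>inverse 0 = 0\<close>, \<open>mcB\<close> at
  \<open>l = 0\<close> is just its diagonal part, that is, the value at infinity. The added matrix
  is the coefficient of \<open>inverse l\<close>.\<close>

lemma mcB_scaled:
  "l \<noteq> 0 \<Longrightarrow> cscale l (mcB H \<psi> U l z) = cscale l (mcB H \<psi> U 0 z) +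
     vector [vector [0, cnj (U z) * of_real (exp (- \<psi> z)), 0],
       vector [0, 0, csqrt (- of_real H / 2) * of_real (exp (\<psi> z / 2))],
       vector [csqrt (- of_real H / 2) * of_real (exp (\<psi> z / 2)), 0, 0]]"
  by (simp add: matrix_eq_3 cscale_nth mcB_eq)

lemma mcB_inverse_tendsto: "((\<lambda>w. mcB H \<psi> U (inverse w) z) \<longlongrightarrow> mcB H \<psi> U 0 z) (at 0)"
proof -
  have "mat_holomorphic_on (\<lambda>w. mcB H \<psi> U (inverse w) z) UNIV"
    unfolding mat_holomorphic_on_def forall_3 mcB_eq vector_3 inverse_inverse_eq by (intro conjI holomorphic_intros)
  from mat_holomorphic_tendsto[OF this open_UNIV, of 0] show ?thesis by simp
qed

lemma mcA_tendsto: "((\<lambda>l. mcA H \<psi> U l z) \<longlongrightarrow> mcA H \<psi> U 0 z) (at 0)"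
  by (rule mat_holomorphic_tendsto[OF mat_holomorphic_mcA open_UNIV]) simp

lemma wcoeff_linear:
  assumes "\<And>V. f V = Re V *\<^sub>R f 1 + Im V *\<^sub>R f \<i>"
  shows "f V $ i $ j = V * wcoeff 1 f $ i $ j + cnj V * wcoeff (-1) f $ i $ j"
proof -
  have "V * wcoeff 1 f $ i $ j + cnj V * wcoeff (-1) f $ i $ j = of_real (Re V) * f 1 $ i $ j + of_real (Im V) * f \<i> $ i $ j"
    by (simp add: wcoeff_def field_simps complex_eq_iff)
  then show ?thesis by (subst assms) (simp add: scaleR_conv_of_real[where 'a = complex])
qed

section \<open>Identification of the new Maurer-Cartan form\<close>

context dressing_result
begin

lemma ht_dirderiv_hol:
  assumes z: "z \<in> D"
  shows "mat_holomorphic_on (\<lambda>l. dirderiv (\<lambda>w. ht w l) V z) (- K)"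
  unfolding mat_holomorphic_on_def
proof (intro allI)
  fix i j
  have n: "n differentiable (at z)" if "smooth_on D n" for n :: "complex \<Rightarrow> complex"
    by (rule smooth_on_differentiable[OF that z])
  have A: "(\<lambda>w. Adiag (of_real (dt w))) differentiable (at z)"
    using Adiag_deriv(1)[OF z] by (rule differentiableI)
  have "mat_zhol z (- K) (\<lambda>w l. ht w l)"
    unfolding ht_eq
    by (intro mat_zhol_mult mat_zhol_base A mat_zhol_gfac n bt1_smooth bt2_smooth bct1 bct2 z) (auto simp: K_def)
  then have "(\<lambda>l. dirderiv (\<lambda>w. ht w l $ i $ j) V z) holomorphic_on (- K)"
    by (simp add: mat_zhol_def zhol_def)
  then show "(\<lambda>l. dirderiv (\<lambda>w. ht w l) V z $ i $ j) holomorphic_on (- K)"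
  proof (rule holomorphic_transform)
    fix l assume "l \<in> - K"
    then have d: "(\<lambda>w. ht w l) differentiable (at z)"
      by (rule slice_differentiable[OF ht_smooth open_K z])
    show "dirderiv (\<lambda>w. ht w l $ i $ j) V z = dirderiv (\<lambda>w. ht w l) V z $ i $ j"
      using dirderiv_nth[OF dirderiv_nth(2)[OF d]] dirderiv_nth[OF d] by metis
  qed
qed

lemma dual_ht_hol: "z \<in> D \<Longrightarrow> mat_holomorphic_on (\<lambda>l. dual (ht z (-l))) (- K)"
  using rot_closedD(1)[OF rot_K] by (intro mat_holomorphic_dual_neg mat_holomorphic_subset[OF ht_hol]) auto

text \<open>Joint smoothness of \<open>Et\<close> makes the form continuous on the punctured plane,
  and \<open>Om_S\<close> makes it holomorphic off \<open>K\<close>; a finite set is removable for a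
  continuous function.\<close>

lemma Om_hol:
  assumes z: "z \<in> D"
  shows "mat_holomorphic_on (\<lambda>l. Om z l V) (- {0})"
  unfolding mat_holomorphic_on_def
proof (intro allI)
  fix i j
  have "continuous_on (- {0}) (\<lambda>l. Om z l V)"
    unfolding Om_def
    by (intro bounded_bilinear.continuous_on[OF bounded_bilinear_matrix_mult3] mat_holomorphic_continuous_on
        mat_holomorphic_dual_neg' Et_hol z continuous_on_dirderiv_slice[OF Et_smooth])
  then have c: "continuous_on (- {0}) (\<lambda>l. Om z l V $ i $ j)" by (intro continuous_intros)
  have "mat_holomorphic_on (\<lambda>l. ht z l ** mc_form H \<psi> U l z V ** dual (ht z (-l)) -
      mat 1 ** dirderiv (\<lambda>w. ht w l) V z ** dual (ht z (-l))) S"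
    by (intro mat_holomorphic_diff mat_holomorphic_mult mat_holomorphic_const mat_holomorphic_mc
        mat_holomorphic_subset[OF ht_hol] mat_holomorphic_subset[OF dual_ht_hol]
        mat_holomorphic_subset[OF ht_dirderiv_hol] z S_sub_K) (auto simp: S_def)
  then have "(\<lambda>l. (ht z l ** mc_form H \<psi> U l z V ** dual (ht z (-l)) -
      mat 1 ** dirderiv (\<lambda>w. ht w l) V z ** dual (ht z (-l))) $ i $ j) holomorphic_on S"
    unfolding mat_holomorphic_on_def by blast
  then have "(\<lambda>l. Om z l V $ i $ j) holomorphic_on S"
    by (rule holomorphic_transform) (simp only: Om_S[OF z])
  then show "(\<lambda>l. Om z l V $ i $ j) holomorphic_on - {0}"
    by (intro no_isolated_singularity[OF c _ _ K_finite]) (auto simp: S_def)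
qed

lemma wcoeff_Om_hol: "z \<in> D \<Longrightarrow> mat_holomorphic_on (\<lambda>l. wcoeff t (Om z l)) (- {0})"
  using Om_hol unfolding mat_holomorphic_on_def wcoeff_def
  by (auto intro!: holomorphic_intros)

lemma wcoeff_Om_S:
  assumes z: "z \<in> D" and l: "l \<in> S"
  shows "wcoeff t (Om z l) = ht z l ** wcoeff t (mc_form H \<psi> U l z) ** dual (ht z (-l))
      - mat 1 ** wcoeff t (\<lambda>V. dirderiv (\<lambda>w. ht w l) V z) ** dual (ht z (-l))"
  unfolding wcoeff_mult[symmetric] wcoeff_diff[symmetric]
  by (rule arg_cong[of _ _ "wcoeff t"], rule ext, rule Om_S[OF z l])

lemma wcoeff_Om_S_inverse:
  assumes z: "z \<in> D" and w: "cmod w < r0" "w \<noteq> 0"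
  shows "wcoeff t (Om z (inverse w)) = htw z w ** wcoeff t (mc_form H \<psi> U (inverse w) z) ** dual (htw z (-w))
      - mat 1 ** wcoeff t (\<lambda>V. dirderiv (\<lambda>v. htw v w) V z) ** dual (htw z (-w))"
proof -
  have "ht z (- inverse w) = htw z (- w)" using htw_eq[of "- w" z] w by simp
  then show ?thesis
    using wcoeff_Om_S[OF z small_S(2)[OF w], of t] w(2) by (simp add: htw_eq)
qed

lemma wcoeff_Ddiag:
  "wcoeff t (\<lambda>V. Ddiag (of_real (\<delta> z V)) ** A) = Ddiag (\<delta>c t z) ** A"
  "wcoeff t (\<lambda>V. Ddiag (- of_real (\<delta> z V)) ** A) = Ddiag (- \<delta>c t z) ** A"
  by (simp_all add: matrix_eq_3 matrix_mult_nth wcoeff_def Ddiag_def \<delta>c_def field_simps)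

lemma ht_limits:
  assumes z: "z \<in> D"
  shows "((\<lambda>l. ht z l) \<longlongrightarrow> Adiag (inverse (of_real (dt z)))) (at 0)"
    "((\<lambda>l. dual (ht z (-l))) \<longlongrightarrow> Adiag (of_real (dt z))) (at 0)"
    "((\<lambda>l. htw z l) \<longlongrightarrow> Adiag (of_real (dt z))) (at 0)"
    "((\<lambda>l. dual (htw z (-l))) \<longlongrightarrow> Adiag (inverse (of_real (dt z)))) (at 0)"
proof -
  have c: "((\<lambda>x. x :: complex) \<longlongrightarrow> 0) (at 0)" "((\<lambda>x. - x :: complex) \<longlongrightarrow> 0) (at 0)"
    by (auto intro!: tendsto_eq_intros)
  show "((\<lambda>l. ht z l) \<longlongrightarrow> Adiag (inverse (of_real (dt z)))) (at 0)"
    using ht_tendsto[OF z c(1)] by (simp add: ht_0[OF z])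
  show "((\<lambda>l. dual (ht z (-l))) \<longlongrightarrow> Adiag (of_real (dt z))) (at 0)"
    using tendsto_dual[OF ht_tendsto[OF z c(2)]] by (simp add: ht_0[OF z] dual_Adiag)
  show "((\<lambda>l. htw z l) \<longlongrightarrow> Adiag (of_real (dt z))) (at 0)"
    using htw_tendsto[OF z c(1)] by (simp add: htw_0)
  show "((\<lambda>l. dual (htw z (-l))) \<longlongrightarrow> Adiag (inverse (of_real (dt z)))) (at 0)"
    using tendsto_dual[OF htw_tendsto[OF z c(2)]] by (simp add: htw_0 dual_Adiag)
qed

text \<open>At 0, conjugation by a diagonal matrix leaves the diagonal part alone, and the
  derivative of \<open>ht\<close> adds the logarithmic derivative of \<open>dt\<close>, half the
  derivative of \<open>\<psi>t\<close> minus \<open>\<psi>\<close>. At infinity, conjugation by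
  \<open>Adiag\<close> of \<open>dt\<close> multiplies the entries with
  \<open>exp (\<psi> / 2)\<close> by \<open>dt\<close> and the one with
  \<open>exp (- \<psi>)\<close> by its inverse square. Both agree with the metric
  \<open>\<psi>t\<close>.\<close>

lemma wcoeff_1_Om:
  assumes z: "z \<in> D" and l: "l \<noteq> 0"
  shows "wcoeff 1 (Om z l) = mcA H \<psi>t U l z"
proof -
  have p: "complex_of_real (dt z) \<noteq> 0" using dt_pos[OF z] by simp
  have "wcoeff 1 (Om z l) $ i $ j - mcA H \<psi>t U l z $ i $ j = 0" for i j
  proof (rule Liouville_punctured'[OF _ _ _ l])
    show "(\<lambda>l. wcoeff 1 (Om z l) $ i $ j - mcA H \<psi>t U l z $ i $ j) holomorphic_on - {0}"
      using mat_holomorphic_diff[OF wcoeff_Om_hol[OF z] mat_holomorphic_mcA] by (simp add: mat_holomorphic_on_def)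
    define Q where "Q = (\<lambda>l. ht z l ** mcA H \<psi> U l z ** dual (ht z (-l))
      - mat 1 ** wcoeff 1 (\<lambda>V. dirderiv (\<lambda>w. ht w l) V z) ** dual (ht z (-l)) - mcA H \<psi>t U l z)"
    have "(Q \<longlongrightarrow> Adiag (inverse (of_real (dt z))) ** mcA H \<psi> U 0 z ** Adiag (of_real (dt z))
      - mat 1 ** (Ddiag (- \<delta>c 1 z) ** Adiag (inverse (of_real (dt z)))) ** Adiag (of_real (dt z)) - mcA H \<psi>t U 0 z) (at 0)"
      unfolding Q_def wcoeff_Ddiag[symmetric]
      by (intro tendsto_diff tendsto_matrix_mult tendsto_const ht_limits z mcA_tendsto tendsto_wcoeff dirderiv_ht_tendsto)
    also have "Adiag (inverse (of_real (dt z))) ** mcA H \<psi> U 0 z ** Adiag (of_real (dt z))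
      - mat 1 ** (Ddiag (- \<delta>c 1 z) ** Adiag (inverse (of_real (dt z)))) ** Adiag (of_real (dt z)) - mcA H \<psi>t U 0 z = 0"
      using p by (simp add: matrix_eq_3 matrix_mult_nth mat1_nth mcA_eq Adiag_def Ddiag_def wirt_psit[OF z] add_divide_distrib) (simp add: field_simps)
    finally have Q: "(Q \<longlongrightarrow> 0) (at 0)" .
    have "eventually (\<lambda>l. Q l $ i $ j = wcoeff 1 (Om z l) $ i $ j - mcA H \<psi>t U l z $ i $ j) (at 0)"
      using eventually_small
      by eventually_elim (simp add: Q_def wcoeff_Om_S[OF z small_S(1)] wcoeff_mc)
    from Lim_transform_eventually[OF tendsto_vec_nth[OF tendsto_vec_nth[OF Q]] this]
    show "((\<lambda>l. wcoeff 1 (Om z l) $ i $ j - mcA H \<psi>t U l z $ i $ j) \<longlongrightarrow> 0) (at 0)" by simp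
    \<comment> \<open>The coefficient of \<open>l\<close> in \<open>mcA\<close>, as a function of
      the metric.\<close>
    define C where "C = (\<lambda>\<psi>. vector [vector [0, 0, csqrt (- of_real H / 2) * of_real (exp (\<psi> z / 2))],
       vector [U z * of_real (exp (- \<psi> z)), 0, 0],
       vector [0, csqrt (- of_real H / 2) * of_real (exp (\<psi> z / 2)), 0]] :: complex^3^3)"
    \<comment> \<open>\<open>w\<close> times the difference in the chart at infinity, written with
      \<open>w * inverse w\<close> already cancelled so that the limit can be taken.\<close>
    define P where "P = (\<lambda>w. htw z w ** (cscale w (mcA H \<psi> U 0 z) + C \<psi>) ** dual (htw z (-w))
      - cscale w (mat 1 ** wcoeff 1 (\<lambda>V. dirderiv (\<lambda>v. htw v w) V z) ** dual (htw z (-w)))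
      - (cscale w (mcA H \<psi>t U 0 z) + C \<psi>t))"
    have "(P \<longlongrightarrow> Adiag (of_real (dt z)) ** (0 + C \<psi>) ** Adiag (inverse (of_real (dt z))) - 0 - (0 + C \<psi>t)) (at 0)"
      unfolding P_def
      by (intro tendsto_diff tendsto_add tendsto_matrix_mult tendsto_const ht_limits z tendsto_cscale_0[OF tendsto_const]
          tendsto_cscale_0[OF tendsto_matrix_mult[OF tendsto_matrix_mult[OF tendsto_const
            tendsto_wcoeff[OF dirderiv_ht_tendsto(2)[OF z]]] ht_limits(4)[OF z]]])
    also have "Adiag (of_real (dt z)) ** (0 + C \<psi>) ** Adiag (inverse (of_real (dt z))) - 0 - (0 + C \<psi>t) = 0"
      using p by (simp add: matrix_eq_3 matrix_mult_nth C_def Adiag_def exp_psit_half[OF z] exp_psit_neg[OF z] field_simps power2_eq_square)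
    finally have P: "(P \<longlongrightarrow> 0) (at 0)" .
    have "eventually (\<lambda>w. P w $ i $ j = w * (wcoeff 1 (Om z (inverse w)) $ i $ j - mcA H \<psi>t U (inverse w) z $ i $ j)) (at 0)"
      using eventually_small
    proof eventually_elim
      case (elim w)
      have "cscale w (wcoeff 1 (Om z (inverse w)) - mcA H \<psi>t U (inverse w) z) = P w"
        using elim mcA_scaled[of w H \<psi> U z] mcA_scaled[of w H \<psi>t U z]
        by (simp add: P_def C_def wcoeff_Om_S_inverse[OF z] wcoeff_mc cscale_diff cscale_mult)
      then show ?case by (metis cscale_nth vector_minus_component)
    qed
    from Lim_transform_eventually[OF tendsto_vec_nth[OF tendsto_vec_nth[OF P]] this]
    show "((\<lambda>w. w * (wcoeff 1 (Om z (inverse w)) $ i $ j - mcA H \<psi>t U (inverse w) z $ i $ j)) \<longlongrightarrow> 0) (at 0)" by simp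
  qed
  then show ?thesis by (simp add: vec_eq_iff)
qed

text \<open>As for the \<open>dz\<close> coefficient with the two ends exchanged: \<open>mcB\<close>
  has its pole at 0, so the diagonal parts are compared at infinity and the polar parts at
  0.\<close>

lemma wcoeff_m1_Om:
  assumes z: "z \<in> D" and l: "l \<noteq> 0"
  shows "wcoeff (-1) (Om z l) = mcB H \<psi>t U l z"
proof -
  have p: "complex_of_real (dt z) \<noteq> 0" using dt_pos[OF z] by simp
  have "wcoeff (-1) (Om z l) $ i $ j - mcB H \<psi>t U l z $ i $ j = 0" for i j
  proof (rule Liouville_punctured[OF _ _ _ l])
    show "(\<lambda>l. wcoeff (-1) (Om z l) $ i $ j - mcB H \<psi>t U l z $ i $ j) holomorphic_on - {0}"
      using mat_holomorphic_diff[OF wcoeff_Om_hol[OF z] mat_holomorphic_mcB] by (simp add: mat_holomorphic_on_def)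
    define Q where "Q = (\<lambda>w. htw z w ** mcB H \<psi> U (inverse w) z ** dual (htw z (-w))
      - mat 1 ** wcoeff (-1) (\<lambda>V. dirderiv (\<lambda>v. htw v w) V z) ** dual (htw z (-w)) - mcB H \<psi>t U (inverse w) z)"
    have "(Q \<longlongrightarrow> Adiag (of_real (dt z)) ** mcB H \<psi> U 0 z ** Adiag (inverse (of_real (dt z)))
      - mat 1 ** (Ddiag (\<delta>c (-1) z) ** Adiag (of_real (dt z))) ** Adiag (inverse (of_real (dt z))) - mcB H \<psi>t U 0 z) (at 0)"
      unfolding Q_def wcoeff_Ddiag[symmetric]
      by (intro tendsto_diff tendsto_matrix_mult tendsto_const ht_limits z mcB_inverse_tendsto tendsto_wcoeff dirderiv_ht_tendsto)
    also have "Adiag (of_real (dt z)) ** mcB H \<psi> U 0 z ** Adiag (inverse (of_real (dt z)))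
      - mat 1 ** (Ddiag (\<delta>c (-1) z) ** Adiag (of_real (dt z))) ** Adiag (inverse (of_real (dt z))) - mcB H \<psi>t U 0 z = 0"
      using p by (simp add: matrix_eq_3 matrix_mult_nth mat1_nth mcB_eq Adiag_def Ddiag_def wirt_psit[OF z] add_divide_distrib diff_divide_distrib) (simp add: field_simps)
    finally have Q: "(Q \<longlongrightarrow> 0) (at 0)" .
    have "eventually (\<lambda>w. Q w $ i $ j = wcoeff (-1) (Om z (inverse w)) $ i $ j - mcB H \<psi>t U (inverse w) z $ i $ j) (at 0)"
      using eventually_small
      by eventually_elim (simp add: Q_def wcoeff_Om_S_inverse[OF z] wcoeff_mc)
    from Lim_transform_eventually[OF tendsto_vec_nth[OF tendsto_vec_nth[OF Q]] this]
    show "((\<lambda>w. wcoeff (-1) (Om z (inverse w)) $ i $ j - mcB H \<psi>t U (inverse w) z $ i $ j) \<longlongrightarrow> 0) (at 0)" by simp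
    define C where "C = (\<lambda>\<psi>. vector [vector [0, cnj (U z) * of_real (exp (- \<psi> z)), 0],
       vector [0, 0, csqrt (- of_real H / 2) * of_real (exp (\<psi> z / 2))],
       vector [csqrt (- of_real H / 2) * of_real (exp (\<psi> z / 2)), 0, 0]] :: complex^3^3)"
    define P where "P = (\<lambda>l. ht z l ** (cscale l (mcB H \<psi> U 0 z) + C \<psi>) ** dual (ht z (-l))
      - cscale l (mat 1 ** wcoeff (-1) (\<lambda>V. dirderiv (\<lambda>v. ht v l) V z) ** dual (ht z (-l)))
      - (cscale l (mcB H \<psi>t U 0 z) + C \<psi>t))"
    have "(P \<longlongrightarrow> Adiag (inverse (of_real (dt z))) ** (0 + C \<psi>) ** Adiag (of_real (dt z)) - 0 - (0 + C \<psi>t)) (at 0)"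
      unfolding P_def
      by (intro tendsto_diff tendsto_add tendsto_matrix_mult tendsto_const ht_limits z tendsto_cscale_0[OF tendsto_const]
          tendsto_cscale_0[OF tendsto_matrix_mult[OF tendsto_matrix_mult[OF tendsto_const
            tendsto_wcoeff[OF dirderiv_ht_tendsto(1)[OF z]]] ht_limits(2)[OF z]]])
    also have "Adiag (inverse (of_real (dt z))) ** (0 + C \<psi>) ** Adiag (of_real (dt z)) - 0 - (0 + C \<psi>t) = 0"
      using p by (simp add: matrix_eq_3 matrix_mult_nth C_def Adiag_def exp_psit_half[OF z] exp_psit_neg[OF z] field_simps power2_eq_square)
    finally have P: "(P \<longlongrightarrow> 0) (at 0)" .
    have "eventually (\<lambda>l. P l $ i $ j = l * (wcoeff (-1) (Om z l) $ i $ j - mcB H \<psi>t U l z $ i $ j)) (at 0)"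
      using eventually_small
    proof eventually_elim
      case (elim l)
      have "cscale l (wcoeff (-1) (Om z l) - mcB H \<psi>t U l z) = P l"
        using elim mcB_scaled[of l H \<psi> U z] mcB_scaled[of l H \<psi>t U z]
        by (simp add: P_def C_def wcoeff_Om_S[OF z small_S(1)] wcoeff_mc cscale_diff cscale_mult)
      then show ?case by (metis cscale_nth vector_minus_component)
    qed
    from Lim_transform_eventually[OF tendsto_vec_nth[OF tendsto_vec_nth[OF P]] this]
    show "((\<lambda>l. l * (wcoeff (-1) (Om z l) $ i $ j - mcB H \<psi>t U l z $ i $ j)) \<longlongrightarrow> 0) (at 0)" by simp
  qed
  then show ?thesis by (simp add: vec_eq_iff)
qed

lemma Om_mc:
  assumes z: "z \<in> D" and l: "l \<noteq> 0"
  shows "Om z l V = mc_form H \<psi>t U l z V"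
proof -
  have dEt: "(\<lambda>w. Et w l) differentiable (at z)"
    by (rule slice_differentiable[OF Et_smooth _ z]) (use l in auto)
  have "Om z l V = Re V *\<^sub>R Om z l 1 + Im V *\<^sub>R Om z l \<i>" for V
    unfolding Om_def dirderiv_linear[OF dEt, of V]
    by (simp add: matrix_eq_3 matrix_mult_nth algebra_simps)
  from wcoeff_linear[of "Om z l", OF this] show ?thesis
    by (simp add: vec_eq_iff mc_form_nth wcoeff_1_Om[OF z l] wcoeff_m1_Om[OF z l])
qed

lemma Et_frame: "extended_frame D H \<psi>t U Et"
  unfolding extended_frame_def
proof (intro conjI ballI allI impI Et_smooth Et_loop)
  fix z l V assume z: "z \<in> D" and l: "l \<noteq> (0::complex)"
  show "matrix_inv (Et z l) ** dirderiv (\<lambda>w. Et w l) V z = mc_form H \<psi>t U l z V"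
    using Om_mc[OF z l, of V] matrix_inv_eq[OF Et_inverse(1)[OF z l]] by (simp add: Om_def)
qed

end

subsection \<open>Affine spheres from extended frames\<close>

lemma csqrt_H:
  assumes "H = 2 \<or> H = -2"
  shows "csqrt (- of_real H / 2) * csqrt (- of_real H / 2) = - of_real H / 2"
    "cnj (csqrt (- of_real H / 2)) = eta H * csqrt (- of_real H / 2)"
proof -
  show "csqrt (- of_real H / 2) * csqrt (- of_real H / 2) = - of_real H / 2"
    using power2_csqrt[of "- of_real H / 2"] by (simp only: power2_eq_square)
  have "csqrt (-1) = \<i>" using csqrt_minus[of 1] by simp
  then show "cnj (csqrt (- of_real H / 2)) = eta H * csqrt (- of_real H / 2)"
    using assms by (auto simp: eta_def)
qed

lemma inverse_eq_cnj: "cmod l = 1 \<Longrightarrow> inverse l = cnj l"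
  using complex_norm_square[of l] by (metis inverse_unique of_real_1 power_one)

text \<open>Replacing two columns u, v by u + v and i(u - v) multiplies a determinant by -2i. Here u
  and v are the conjugate columns, and the combinations are the real x- and y-derivatives; the last
  bracket is the determinant with columns \<open>a\<close>, \<open>b\<close>,
  \<open>c\<close>.\<close>

lemma of_real_det_eq:
  fixes a b c :: "complex^3" and \<xi> :: "real^3"
  assumes "\<And>i. \<gamma>' * b $ i = cnj (\<gamma> * a $ i)" "\<And>i. of_real (\<xi> $ i) = c $ i"
  shows "complex_of_real (det (vector [\<chi> i. 2 * Re (1 * (\<gamma> * a $ i)), \<chi> i. 2 * Re (\<i> * (\<gamma> * a $ i)), \<xi>] :: real^3^3))
    = - 2 * \<i> * \<gamma> * \<gamma>' * (a$1 * b$2 * c$3 + b$1 * c$2 * a$3 + c$1 * a$2 * b$3 - a$1 * c$2 * b$3 - b$1 * a$2 * c$3 - c$1 * b$2 * a$3)"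
proof -
  have 1: "complex_of_real (2 * Re (1 * (\<gamma> * a $ i))) = \<gamma> * a $ i + \<gamma>' * b $ i" for i
    using assms(1)[of i] by (simp add: complex_eq_iff)
  have 2: "complex_of_real (2 * Re (\<i> * (\<gamma> * a $ i))) = \<i> * (\<gamma> * a $ i - \<gamma>' * b $ i)" for i
    using assms(1)[of i] by (simp add: complex_eq_iff)
  show ?thesis
    unfolding det_3 vector_3 vec_lambda_beta of_real_add of_real_diff of_real_mult[of "_ * _"] of_real_mult[of _ "\<xi> $ _"]
    by (simp only: of_real_diff of_real_add of_real_mult[of "2 * Re _ * (2 * Re _)"] of_real_mult[of "2 * Re _" "2 * Re _"]
        of_real_mult[of "2 * Re _ * \<xi> $ _"] of_real_mult[of "2 * Re _" "\<xi> $ _"] of_real_mult[of "\<xi> $ _"] 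
        of_real_mult[of "\<xi> $ _ * (2 * Re _)"] 1 2 assms(2)) algebra
qed

text \<open>On the unit circle the reflection fixes \<open>l\<close>, so reality becomes a condition
  on the single matrix \<open>F z l\<close>. A constant change of basis turns its third column real,
  and that column is up to a constant both the immersion and its affine normal.\<close>

lemma affine_sphere_of_frame:
  assumes H: "H = 2 \<or> H = -2" and D: "open D" and psi: "smooth_on D \<psi>"
    and frame: "extended_frame D H \<psi> U F" and l: "cmod l = 1"
  shows "\<exists>M ft. invertible M \<and> definite_affine_sphere D H \<psi> (\<lambda>z. l^3 * U z) ft \<and>
    (\<forall>z\<in>D. (\<chi> i. complex_of_real (ft z $ i)) = M *v (F z l *v e3))"
proof -
  define s where "s = csqrt (- of_real H / 2)"
  note s = csqrt_H[OF H, folded s_def]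
  have l0: "l \<noteq> 0" "inverse l = cnj l" using l inverse_eq_cnj by auto
  \<comment> \<open>Chosen so that \<open>Q\<close> maps matrices fixed by \<open>tau\<close> to
    matrices with real third column and first two columns conjugate up to the sign
    \<open>eta H\<close>. The product of \<open>c1\<close> and \<open>c2\<close> fixes
    \<open>det Q\<close>, which later makes the volume equal to
    \<open>exp (\<psi> z)\<close>.\<close>
  define c1 :: complex where "c1 = (if H = 2 then \<i> else 1)"
  define c2 :: complex where "c2 = (if H = 2 then 1 else - \<i>)"
  have c: "cnj c1 = eta H * c1" "cnj c2 = - eta H * c2" "2 * c1 * c2 = \<i> * of_real H"
    using H by (auto simp: c1_def c2_def eta_def)
  have eta: "eta H * eta H = 1" "cnj (eta H) = eta H" using eta_sq[OF H] by auto
  have H0: "complex_of_real H \<noteq> 0" using H by auto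
  define Q :: "complex^3^3" where "Q = vector [vector [c1, c1, 0], vector [c2, - c2, 0], vector [0, 0, 1]]"
  have detQ: "det Q = - \<i> * of_real H" using c(3) by (simp add: det_3 Q_def algebra_simps)
  define N where "N = (\<lambda>z. Q ** F z l)"
  have F_smooth: "smooth_on D (\<lambda>z. F z l)"
    using frame l0 by (intro smooth_on_slice[where L = "- {0}", OF D]) (auto simp: extended_frame_def)
  have N_smooth: "smooth_on D N"
    unfolding N_def by (intro smooth_on_matrix_mult D smooth_on_const F_smooth)
  have N_deriv: "(N has_derivative (\<lambda>V. N z ** mc_form H \<psi> U l z V)) (at z)" if z: "z \<in> D" for z
  proof -
    have dF: "(\<lambda>z. F z l) differentiable (at z)" by (rule smooth_on_differentiable[OF F_smooth z])
    have "det (F z l) = 1" using frame z l0 by (auto simp: extended_frame_def loop_SL_def)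
    then have i: "F z l ** matrix_inv (F z l) = mat 1"
      by (intro matrix_inv_right_inverse) (simp add: invertible_det_nz)
    have "matrix_inv (F z l) ** dirderiv (\<lambda>w. F w l) V z = mc_form H \<psi> U l z V" for V
      using frame z l0 by (auto simp: extended_frame_def)
    then have "F z l ** (matrix_inv (F z l) ** dirderiv (\<lambda>w. F w l) V z) = F z l ** mc_form H \<psi> U l z V" for V by simp
    then have d: "dirderiv (\<lambda>w. F w l) V z = F z l ** mc_form H \<psi> U l z V" for V
      by (simp add: matrix_mul_assoc i matrix_mul_lid)
    have "(N has_derivative (\<lambda>V. Q ** dirderiv (\<lambda>w. F w l) V z + 0 ** F z l)) (at z)"
      unfolding N_def
      by (rule bounded_bilinear.FDERIV[OF bounded_bilinear_matrix_mult3 has_derivative_const differentiable_has_derivative[OF dF]])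
    moreover have "Q ** dirderiv (\<lambda>w. F w l) V z + 0 ** F z l = N z ** mc_form H \<psi> U l z V" for V
    proof -
      have "0 ** F z l = 0" by (simp add: matrix_eq_3 matrix_mult_nth)
      then show ?thesis by (simp add: d N_def matrix_mul_assoc)
    qed
    ultimately show ?thesis by simp
  qed
  have real: "N z $ i $ 2 = eta H * cnj (N z $ i $ 1)" "cnj (N z $ i $ 3) = N z $ i $ 3" if z: "z \<in> D" for z i
  proof -
    have "inverse (cnj l) = l" using l0 by (metis complex_cnj_cnj complex_cnj_inverse inverse_inverse_eq)
    then have t: "tau H (F z l) = F z l"
      using frame z l0 by (auto simp: extended_frame_def loop_SL_def) metis
    have e: "F z l $ i $ j = tau H (F z l) $ i $ j" for i j using t by simp
    have r: "F z l $ 2 $ 2 = cnj (F z l $ 1 $ 1)" "F z l $ 1 $ 2 = cnj (F z l $ 2 $ 1)" "F z l $ 3 $ 2 = eta H * cnj (F z l $ 3 $ 1)"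
      "F z l $ 2 $ 3 = eta H * cnj (F z l $ 1 $ 3)" "cnj (F z l $ 3 $ 3) = F z l $ 3 $ 3"
      using e[of 2 2] e[of 1 2] e[of 3 2] e[of 2 3] e[of 3 3] unfolding tau_nth[OF H] by simp_all
    have ex: "eta H * (eta H * x) = x" for x using eta(1) by (simp add: mult.assoc[symmetric])
    show "N z $ i $ 2 = eta H * cnj (N z $ i $ 1)"
      using exhaust_3[of i] by (auto simp: N_def Q_def matrix_mult_nth r c eta ex algebra_simps)
    show "cnj (N z $ i $ 3) = N z $ i $ 3"
      using exhaust_3[of i] by (auto simp: N_def Q_def matrix_mult_nth r c eta ex algebra_simps)
  qed
  \<comment> \<open>Read off from the third column of the Maurer-Cartan form: with this factor,
    \<open>g i\<close> is the component of the derivative of \<open>f\<close> in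
    \<open>z\<close>.\<close>
  define \<gamma> where "\<gamma> = (\<lambda>z. - inverse (of_real H) * s * l * of_real (exp (\<psi> z / 2)))"
  define g where "g = (\<lambda>i z. \<gamma> z * N z $ i $ 1)"
  have cg: "cnj (g i z) = - inverse (of_real H) * s * inverse l * of_real (exp (\<psi> z / 2)) * N z $ i $ 2" if "z \<in> D" for i z
  proof -
    have "eta H * (eta H * x) = x" for x using eta(1) by (simp add: mult.assoc[symmetric])
    then show ?thesis by (simp add: g_def \<gamma>_def real(1)[OF that] s(2) l0(2) mult_ac)
  qed
  \<comment> \<open>The affine normal \<open>\<xi>\<close> is \<open>- H\<close> times
    \<open>f\<close>, so it points along the position vector: an affine sphere centred at the
    origin.\<close>
  define f :: "complex \<Rightarrow> real^3" where "f = (\<lambda>z. \<chi> i. Re (- inverse (of_real H) * N z $ i $ 3))"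
  define \<xi> :: "complex \<Rightarrow> real^3" where "\<xi> = (\<lambda>z. \<chi> i. Re (N z $ i $ 3))"
  have f_real: "complex_of_real (f z $ i) = - inverse (of_real H) * N z $ i $ 3"
    and xi_real: "complex_of_real (\<xi> z $ i) = N z $ i $ 3" if "z \<in> D" for z i
    using real(2)[OF that, of i] by (simp_all add: f_def \<xi>_def complex_eq_iff flip: of_real_inverse)
  have xi_f: "\<xi> = (\<lambda>z. - H *\<^sub>R f z)"
    using H by (auto simp: f_def \<xi>_def vec_eq_iff simp flip: of_real_inverse)
  have "smooth_on D (\<lambda>z. f z $ i)" for i
    unfolding f_def vec_lambda_beta
    by (intro smooth_on_Re smooth_on_mult smooth_on_const smooth_on_matrix_nth[OF D N_smooth] D)
  then have f_smooth: "smooth_on D f" by (intro smooth_on_vec D)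
  have xi_smooth: "smooth_on D \<xi>"
    unfolding xi_f by (intro smooth_on_scaleR smooth_on_const D f_smooth)
  have f_deriv: "(f has_derivative (\<lambda>V. \<chi> i. 2 * Re (V * g i z))) (at z)" if z: "z \<in> D" for z
  proof -
    define L :: "complex^3^3 \<Rightarrow> real^3" where "L = (\<lambda>A. \<chi> i. Re (- inverse (of_real H) * A $ i $ 3))"
    have "bounded_linear L"
      unfolding linear_conv_bounded_linear[symmetric]
      by (rule linearI) (simp_all add: L_def vec_eq_iff algebra_simps add_divide_distrib)
    from bounded_linear.has_derivative[OF this N_deriv[OF z]]
    have "(f has_derivative (\<lambda>V. L (N z ** mc_form H \<psi> U l z V))) (at z)" by (simp add: f_def L_def)
    moreover have "L (N z ** mc_form H \<psi> U l z V) = (\<chi> i. 2 * Re (V * g i z))" for V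
    proof -
      have "- inverse (of_real H) * (N z ** mc_form H \<psi> U l z V) $ i $ 3 = V * g i z + cnj (V * g i z)" for i
        unfolding complex_cnj_mult cg[OF z]
        by (simp add: matrix_mult_nth mc_form_nth mcA_eq mcB_eq g_def \<gamma>_def s_def algebra_simps)
      then show ?thesis unfolding L_def by (simp only:) (simp add: vec_eq_iff)
    qed
    ultimately show ?thesis by simp
  qed
  have f_dir: "dirderiv f V z = (\<chi> i. 2 * Re (V * g i z))" if "z \<in> D" for V z
    by (rule dirderiv_eqI[OF f_deriv[OF that]])
  define pz where "pz = (\<lambda>z. wirt_z (\<lambda>w. of_real (\<psi> w)) z)"
  \<comment> \<open>The equations for the second derivatives of \<open>f\<close> in complex form.
    The power \<open>l^3\<close> collects one \<open>l\<close> from the form and \<open>l^2\<close>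
    from the quotient of \<open>\<gamma>\<close> by the coefficient in \<open>cg\<close>.\<close>
  have g_deriv: "(g i has_derivative (\<lambda>W. pz z * W * g i z + l^3 * U z * of_real (exp (- \<psi> z)) * W * cnj (g i z)
      + of_real (exp (\<psi> z)) / 2 * cnj W * N z $ i $ 3)) (at z)" if z: "z \<in> D" for i z
  proof -
    have p: "(\<psi> has_derivative (\<lambda>V. dirderiv \<psi> V z)) (at z)"
      by (intro differentiable_has_derivative smooth_on_differentiable[OF psi] z)
    have pc: "((\<lambda>w. complex_of_real (\<psi> w)) has_derivative (\<lambda>V. of_real (dirderiv \<psi> V z))) (at z)"
      by (intro has_derivative_of_real p)
    have pd: "of_real (dirderiv \<psi> W z) = pz z * W + wirt_zb (\<lambda>w. of_real (\<psi> w)) z * cnj W" for W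
    proof -
      have "dirderiv \<psi> W z = Re W * dirderiv \<psi> 1 z + Im W * dirderiv \<psi> \<i> z"
        using dirderiv_linear[OF smooth_on_differentiable[OF psi z], of W] by simp
      then show ?thesis
        by (simp add: pz_def wirt_z_def wirt_zb_def dirderiv_eqI[OF pc] complex_eq_iff field_simps)
    qed
    have "((\<lambda>w. exp (\<psi> w / 2)) has_derivative (\<lambda>W. exp (\<psi> z / 2) * (dirderiv \<psi> W z / 2))) (at z)"
      by (auto intro!: derivative_eq_intros p)
    then have e: "((\<lambda>w. complex_of_real (exp (\<psi> w / 2))) has_derivative (\<lambda>W. of_real (exp (\<psi> z / 2) * (dirderiv \<psi> W z / 2)))) (at z)"
      by (rule has_derivative_of_real)
    have n: "((\<lambda>w. N w $ i $ 1) has_derivative (\<lambda>W. (N z ** mc_form H \<psi> U l z W) $ i $ 1)) (at z)"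
      by (intro bounded_linear.has_derivative[OF bounded_linear_vec_nth] N_deriv z)
    have "(g i has_derivative (\<lambda>W. \<gamma> z * (N z ** mc_form H \<psi> U l z W) $ i $ 1 +
        (- inverse (of_real H) * s * l * of_real (exp (\<psi> z / 2) * (dirderiv \<psi> W z / 2))) * N z $ i $ 1)) (at z)"
      unfolding g_def \<gamma>_def by (intro has_derivative_mult n has_derivative_mult_right e)
    moreover have "\<gamma> z * (N z ** mc_form H \<psi> U l z W) $ i $ 1 +
        (- inverse (of_real H) * s * l * of_real (exp (\<psi> z / 2) * (dirderiv \<psi> W z / 2))) * N z $ i $ 1
        = pz z * W * g i z + l^3 * U z * of_real (exp (- \<psi> z)) * W * cnj (g i z)
      + of_real (exp (\<psi> z)) / 2 * cnj W * N z $ i $ 3" for W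
    proof -
      define e where "e = complex_of_real (exp (\<psi> z / 2))"
      define k where "k = inverse (complex_of_real H)"
      define il where "il = inverse l"
      have ee: "complex_of_real (exp (\<psi> z)) = e * e"
        unfolding e_def of_real_mult[symmetric] exp_add[symmetric] by simp
      \<comment> \<open>This value produces the factor 1/2 in front of the affine normal in the
        mixed second derivative.\<close>
      have sk: "s * s * k = - 1 / 2" using s(1) H0 by (simp add: k_def)
      have ll: "l * il = 1" using l0(1) by (simp add: il_def)
      have dd: "of_real (exp (\<psi> z / 2) * (dirderiv \<psi> W z / 2)) = e * (pz z * W + wirt_zb (\<lambda>w. of_real (\<psi> w)) z * cnj W) / 2"
        by (simp add: e_def pd[symmetric])
      show ?thesis
        unfolding cg[OF z]
        unfolding dd ee g_def \<gamma>_def matrix_mult_nth mc_form_nth mcA_eq mcB_eq vector_3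
          s_def[symmetric] e_def[symmetric] k_def[symmetric] il_def[symmetric] pz_def[symmetric]
        using sk ll by algebra
    qed
    ultimately show ?thesis by simp
  qed
  \<comment> \<open>Obtained from \<open>g_deriv\<close>: under the real part, the conjugate on
    \<open>g\<close> may be moved to its coefficient, so both tangential terms become multiples of
    \<open>g\<close>.\<close>
  define C where "C = (\<lambda>z X Y. pz z * X * Y + of_real (exp (- \<psi> z)) * cnj (l^3 * U z * X * Y))"
  have second: "dirderiv (dirderiv f Y) X z = dirderiv f (C z X Y) z + (exp (\<psi> z) * (X \<bullet> Y)) *\<^sub>R \<xi> z" if z: "z \<in> D" for X Y z
  proof -
    define L :: "complex^3 \<Rightarrow> real^3" where "L = (\<lambda>v. \<chi> i. 2 * Re (Y * v $ i))"
    have L: "bounded_linear L"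
      unfolding linear_conv_bounded_linear[symmetric]
      by (rule linearI) (simp_all add: L_def vec_eq_iff algebra_simps)
    define G where "G = (\<lambda>z. \<chi> i. g i z)"
    have Gs: "G z = (\<Sum>i\<in>UNIV. axis i (g i z))" for z
      by (simp add: vec_eq_iff G_def axis_def if_distrib cong: if_cong)
    have bl: "bounded_linear (axis i :: complex \<Rightarrow> complex^3)" for i
      by (auto intro!: linearI simp: vec_eq_iff axis_def linear_conv_bounded_linear[symmetric])
    define g' where "g' = (\<lambda>i W. pz z * W * g i z + l^3 * U z * of_real (exp (- \<psi> z)) * W * cnj (g i z)
      + of_real (exp (\<psi> z)) / 2 * cnj W * N z $ i $ 3)"
    have "(G has_derivative (\<lambda>W. \<Sum>i\<in>UNIV. axis i (g' i W))) (at z)"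
      unfolding Gs[abs_def] g'_def
      by (intro has_derivative_sum bounded_linear.has_derivative[OF bl] g_deriv z)
    from bounded_linear.has_derivative[OF L this]
    have LG: "((\<lambda>z. L (G z)) has_derivative (\<lambda>W. L (\<Sum>i\<in>UNIV. axis i (g' i W)))) (at z)" .
    have "dirderiv (dirderiv f Y) X z = dirderiv (\<lambda>z. L (G z)) X z"
    proof (rule dirderiv_cong[OF D z])
      show "dirderiv f Y w = L (G w)" if "w \<in> D" for w
        by (simp add: f_dir[OF that] L_def G_def)
      show "dirderiv f Y differentiable (at z)"
        by (rule smooth_on_differentiable[OF smooth_on_dirderiv[OF f_smooth] z])
    qed
    also have "\<dots> = (\<chi> i. 2 * Re (Y * g' i X))"
    proof -
      have "(\<Sum>i\<in>UNIV. axis i (g' i X)) = (\<chi> i. g' i X)"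
        by (simp add: vec_eq_iff axis_def if_distrib cong: if_cong)
      then show ?thesis unfolding dirderiv_eqI[OF LG] by (simp add: L_def)
    qed
    also have "\<dots> = dirderiv f (C z X Y) z + (exp (\<psi> z) * (X \<bullet> Y)) *\<^sub>R \<xi> z"
    proof -
      have "2 * Re (Y * g' i X) = 2 * Re (C z X Y * g i z) + exp (\<psi> z) * (X \<bullet> Y) * \<xi> z $ i" for i
      proof -
        have 1: "Re (cnj x * y) = Re (x * cnj y)" for x y by simp
        have "2 * Re (C z X Y * g i z) = 2 * Re (pz z * X * Y * g i z) + 2 * exp (- \<psi> z) * Re (cnj (l^3 * U z * X * Y) * g i z)"
          by (simp add: C_def algebra_simps)
        also have "\<dots> = 2 * Re (pz z * X * Y * g i z) + 2 * exp (- \<psi> z) * Re (l^3 * U z * X * Y * cnj (g i z))"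
          unfolding 1 ..
        finally have a: "2 * Re (C z X Y * g i z) = 2 * Re (pz z * X * Y * g i z)
          + 2 * exp (- \<psi> z) * Re (l^3 * U z * X * Y * cnj (g i z))" .
        have "2 * Re (Y * g' i X) = 2 * Re (pz z * X * Y * g i z) + 2 * exp (- \<psi> z) * Re (l^3 * U z * X * Y * cnj (g i z))
          + 2 * Re (of_real (exp (\<psi> z)) / 2 * (cnj X * Y) * of_real (\<xi> z $ i))"
        proof -
          have "Y * g' i X = pz z * X * Y * g i z + of_real (exp (- \<psi> z)) * (l^3 * U z * X * Y * cnj (g i z))
             + of_real (exp (\<psi> z)) / 2 * (cnj X * Y) * of_real (\<xi> z $ i)"
            by (simp add: g'_def xi_real[OF z] algebra_simps)
          then show ?thesis by (simp add: distrib_left)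
        qed
        also have "2 * Re (of_real (exp (\<psi> z)) / 2 * (cnj X * Y) * of_real (\<xi> z $ i)) = exp (\<psi> z) * (X \<bullet> Y) * \<xi> z $ i"
          by (simp add: inner_complex_def)
        finally show ?thesis using a by simp
      qed
      then show ?thesis by (simp add: f_dir[OF z] vec_eq_iff)
    qed
    finally show ?thesis .
  qed
  have det: "det (vector [dirderiv f 1 z, dirderiv f \<i> z, \<xi> z] :: real^3^3) = exp (\<psi> z)" if z: "z \<in> D" for z
  proof -
    define a where "a = (\<chi> i. N z $ i $ 1)"
    define b where "b = (\<chi> i. N z $ i $ 2)"
    define c where "c = (\<chi> i. N z $ i $ 3)"
    define \<gamma>' where "\<gamma>' = - inverse (of_real H) * s * inverse l * of_real (exp (\<psi> z / 2))"
    have 1: "\<gamma>' * b $ i = cnj (\<gamma> z * a $ i)" for i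
      using cg[OF z, of i] by (simp add: a_def b_def g_def \<gamma>'_def)
    have 2: "of_real (\<xi> z $ i) = c $ i" for i using xi_real[OF z] by (simp add: c_def)
    have "det (F z l) = 1" using frame z l0 by (auto simp: extended_frame_def loop_SL_def)
    then have "det (N z) = - \<i> * of_real H" by (simp add: N_def det_mul detQ)
    then have 3: "a$1 * b$2 * c$3 + b$1 * c$2 * a$3 + c$1 * a$2 * b$3 - a$1 * c$2 * b$3 - b$1 * a$2 * c$3 - c$1 * b$2 * a$3 = - \<i> * of_real H"
      by (simp add: det_3 a_def b_def c_def)
    have 4: "\<gamma> z * \<gamma>' = - of_real (exp (\<psi> z)) / (2 * of_real H)"
    proof -
      have "\<gamma> z * \<gamma>' = (s * s) * inverse (of_real H) * inverse (of_real H) * (l * inverse l) * of_real (exp (\<psi> z / 2) * exp (\<psi> z / 2))"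
        by (simp add: \<gamma>_def \<gamma>'_def mult_ac)
      also have "exp (\<psi> z / 2) * exp (\<psi> z / 2) = exp (\<psi> z)" by (simp add: exp_add[symmetric])
      finally show ?thesis using H0 l0(1) by (simp add: s(1) field_simps)
    qed
    have "complex_of_real (det (vector [dirderiv f 1 z, dirderiv f \<i> z, \<xi> z] :: real^3^3)) = - 2 * \<i> * (\<gamma> z * \<gamma>') * (- \<i> * of_real H)"
      using of_real_det_eq[of \<gamma>' b "\<gamma> z" a "\<xi> z" c, OF 1 2]
      unfolding 3 by (simp add: f_dir[OF z] g_def a_def mult.assoc)
    also have "\<dots> = of_real (exp (\<psi> z))" using H0 by (simp add: 4) (simp add: complex_eq_iff)
    finally show ?thesis using of_real_eq_iff by blast
  qed
  have sph: "definite_affine_sphere D H \<psi> (\<lambda>z. l^3 * U z) f"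
    unfolding definite_affine_sphere_def
  proof (intro conjI f_smooth psi exI[of _ \<xi>] exI[of _ C] xi_smooth ballI allI det second)
    fix z X Y Z assume z: "z \<in> D"
    have "(\<xi> has_derivative (\<lambda>V. - H *\<^sub>R (\<chi> i. 2 * Re (V * g i z)))) (at z)"
      unfolding xi_f by (intro has_derivative_scaleR_right f_deriv z)
    from dirderiv_eqI[OF this] show "dirderiv \<xi> X z = - H *\<^sub>R dirderiv f X z"
      by (simp add: f_dir[OF z])
    have 1: "exp (\<psi> z) * exp (- \<psi> z) = 1" by (simp add: exp_minus)
    have 2: "C z X Y - wirt_z (\<lambda>w. of_real (\<psi> w)) z * X * Y = of_real (exp (- \<psi> z)) * cnj (l^3 * U z * X * Y)"
      by (simp add: C_def pz_def)
    have 3: "(of_real r * cnj x) \<bullet> Z = r * Re (x * Z)" for r x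
      by (simp add: inner_complex_def algebra_simps)
    have 4: "2 * exp (\<psi> z) * (exp (- \<psi> z) * x) = 2 * x" for x
      using 1 by (metis mult.assoc mult.right_neutral mult.commute)
    have 5: "Re (q + cnj q) = 2 * Re q" for q by simp
    show "2 * exp (\<psi> z) * ((C z X Y - wirt_z (\<lambda>w. of_real (\<psi> w)) z * X * Y) \<bullet> Z)
        = Re (l^3 * U z * X * Y * Z + cnj (l^3 * U z * X * Y * Z))"
      unfolding 2 3 4 5 ..
  qed
  define M where "M = cscale (- inverse (of_real H)) Q"
  have "det M = - inverse (of_real H) * (- inverse (of_real H)) * (- inverse (of_real H)) * det Q"
    by (simp add: M_def det_3 cscale_nth algebra_simps)
  then have "invertible M" using H0 by (simp add: invertible_det_nz detQ)
  moreover have "(\<chi> i. complex_of_real (f z $ i)) = M *v (F z l *v e3)" if "z \<in> D" for z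
  proof -
    have "(M *v (F z l *v e3)) $ i = - inverse (of_real H) * N z $ i $ 3" for i
      by (simp add: matrix_vector_mult_def sum_3 e3_def M_def cscale_nth N_def matrix_mult_nth algebra_simps)
    then show ?thesis by (simp add: vec_eq_iff f_real[OF that])
  qed
  ultimately show ?thesis using sph by blast
qed

subsection \<open>The explicit formula\<close>

text \<open>\<open>W\<close> is the inverse of the two new simple factors, and its third column
  gives the coordinates of the new sphere in the columns of \<open>E\<close>. The powers of
  \<open>l\<close> and the sign on the left are those relating these columns to \<open>r\<close> and
  its derivatives.\<close>

lemma sphere_coefficients:
  fixes a \<alpha> b1 c1 b2 c2 l :: complex
  assumes "a \<noteq> 0" "2*b2*c2 \<noteq> 1" "l^3 + \<alpha>^3 \<noteq> 0" "l^3 * a^3 + 1 \<noteq> 0"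
  defines "W \<equiv> dual (gfac (inverse a) b2 c2 (-l)) ** dual (gfac \<alpha> b1 c1 (-l))"
  defines "p \<equiv> \<alpha> * l^3 * b1 / ((l^3 * a^3 + 1) * (2*b2*c2 - 1) * (l^3 + \<alpha>^3))"
  defines "q \<equiv> \<alpha>^2 * c1 / ((l^3 * a^3 + 1) * (l^3 + \<alpha>^3))"
  defines "s \<equiv> (- (l^3) + \<alpha>^3) / ((l^3 * a^3 + 1) * (l^3 + \<alpha>^3))"
  shows "W $ 1 $ 3 = l * (p * (4 * a^2 * c2^2) + q * (2 * (l^3 * a^3 + 1 - 2*b2*c2)) - s * (2 * a * c2))"
    "l * W $ 2 $ 3 = p * (- 2 * (l^3 * a^3 * (2*b2*c2 - 1) - 1)) + q * (4 * a * l^3 * b2^2) + s * (2 * a^2 * l^3 * b2)"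
    "- W $ 3 $ 3 = p * (4 * a * c2) + q * (4 * a^2 * l^3 * b2) + s * (l^3 * a^3 - 1)"
proof -
  define P where "P = inverse (l^3 + \<alpha>^3)"
  define Q where "Q = inverse (l^3 * a^3 + 1)"
  define e where "e = inverse (2*b2*c2 - 1)"
  define A where "A = inverse a"
  have P: "P * (l^3 + \<alpha>^3) = 1" using assms(3) by (simp add: P_def)
  have Q: "Q * (l^3 * a^3 + 1) = 1" using assms(4) by (simp add: Q_def)
  have e: "e * (2*b2*c2 - 1) = 1" using assms(2) by (simp add: e_def)
  have A: "A * a = 1" using assms(1) by (simp add: A_def)
  have dP: "2 / ((-l)^3 - \<alpha>^3) = - 2 * P"
  proof -
    have "(-l)^3 - \<alpha>^3 = - (l^3 + \<alpha>^3)" by simp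
    then show ?thesis by (simp only: P_def divide_inverse inverse_minus_eq mult_minus_left mult_minus_right)
  qed
  \<comment> \<open>Since \<open>A\<close> is the inverse of \<open>a\<close>, clearing denominators
    produces the factor \<open>a^3\<close> and the denominator \<open>l^3 * a^3 + 1\<close> of the
    explicit formula.\<close>
  have dQ: "2 / ((-l)^3 - A^3) = - 2 * a^3 * Q"
  proof -
    have "(-l)^3 - A^3 = - (l^3 * a^3 + 1) * A^3"
      using A by (simp add: power3_eq_cube) algebra
    then have "2 / ((-l)^3 - A^3) = 2 * (- Q * inverse A ^ 3)"
      by (simp only: Q_def divide_inverse inverse_mult_distrib inverse_minus_eq power_inverse mult_minus_left)
    then show ?thesis by (simp add: A_def)
  qed
  have de: "x / (2*b2*c2 - 1) = x * e" for x by (simp add: e_def divide_inverse)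
  have pqs: "p = \<alpha> * l^3 * b1 * (Q * e * P)" "q = \<alpha>^2 * c1 * (Q * P)" "s = (- (l^3) + \<alpha>^3) * (Q * P)"
    by (simp_all only: p_def q_def s_def P_def Q_def e_def divide_inverse inverse_mult_distrib)
  note g1 = gfac_nth(7-9)[of \<alpha> b1 c1 "- l", unfolded dP]
  note g2 = gfac_nth[of A b2 c2 "- l", unfolded dQ de]
  show "W $ 1 $ 3 = l * (p * (4 * a^2 * c2^2) + q * (2 * (l^3 * a^3 + 1 - 2*b2*c2)) - s * (2 * a * c2))"
    unfolding W_def A_def[symmetric] matrix_mult_nth dual_nth g1 g2 pqs
    using P Q e A by algebra
  show "l * W $ 2 $ 3 = p * (- 2 * (l^3 * a^3 * (2*b2*c2 - 1) - 1)) + q * (4 * a * l^3 * b2^2) + s * (2 * a^2 * l^3 * b2)"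
    unfolding W_def A_def[symmetric] matrix_mult_nth dual_nth g1 g2 pqs
    using P Q e A by algebra
  show "- W $ 3 $ 3 = p * (4 * a * c2) + q * (4 * a^2 * l^3 * b2) + s * (l^3 * a^3 - 1)"
    unfolding W_def A_def[symmetric] matrix_mult_nth dual_nth g1 g2 pqs
    using P Q e A by algebra
qed

section \<open>The new sphere in terms of the associated family\<close>

context dressing_result
begin

lemma assoc_family_wirt:
  assumes z: "z \<in> D" and l: "l \<noteq> 0"
  defines "k \<equiv> 2 * csqrt (- of_real H / 2) * of_real (exp (- \<psi> z / 2))"
  shows "k * wirt_z_vec (assoc_family H E l) z $ i = l * E z l $ i $ 1"
    "k * wirt_zb_vec (assoc_family H E l) z $ i = inverse l * E z l $ i $ 2"
    "of_real H * assoc_family H E l z $ i = - E z l $ i $ 3"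
proof -
  define s where "s = csqrt (- of_real H / 2)"
  have ss: "s * s = - of_real H / 2" using csqrt_H(1)[OF H] by (simp add: s_def)
  have H0: "complex_of_real H \<noteq> 0" using H by auto
  have e: "exp (- \<psi> z / 2) * exp (\<psi> z / 2) = 1" by (simp add: exp_add[symmetric])
  \<comment> \<open>\<open>k\<close> is the inverse of the factor in front of the frame columns in
    the derivatives of \<open>r\<close>, because the square of \<open>s\<close> is
    \<open>- H / 2\<close>.\<close>
  have k: "k * (- inverse (of_real H) * (s * of_real (exp (\<psi> z / 2)))) = 1"
  proof -
    have "k * (- inverse (of_real H) * (s * of_real (exp (\<psi> z / 2)))) =
      - 2 * (s * s) * inverse (of_real H) * of_real (exp (- \<psi> z / 2) * exp (\<psi> z / 2))"
      by (simp add: k_def s_def mult_ac)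
    then show ?thesis unfolding e ss using H0 by simp
  qed
  have r: "assoc_family H E l w $ i = - inverse (of_real H) * E w l $ i $ 3" for w i
    by (simp add: assoc_family_def matrix_vector_mult_def sum_3 e3_def)
  have dE: "(\<lambda>w. E w l) differentiable (at z)"
    by (rule slice_differentiable[OF E_smooth _ z]) (use l in auto)
  have "E z l ** (matrix_inv (E z l) ** dirderiv (\<lambda>w. E w l) V z) = dirderiv (\<lambda>w. E w l) V z" for V
    using matrix_inv_eq[OF E_inverse(1)[OF z l]] E_inverse(1)[OF z l]
    by (simp add: matrix_mul_assoc matrix_mul_lid)
  then have d: "dirderiv (\<lambda>w. E w l) V z = E z l ** mc_form H \<psi> U l z V" for V
    using E_mc[OF z l] by simp
  have "((\<lambda>w. assoc_family H E l w $ i) has_derivative (\<lambda>V. - inverse (of_real H) * (E z l ** mc_form H \<psi> U l z V) $ i $ 3)) (at z)"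
    unfolding r d[symmetric]
    by (intro has_derivative_mult_right bounded_linear.has_derivative[OF bounded_linear_vec_nth] differentiable_has_derivative dE)
  note dr = dirderiv_eqI[OF this]
  define x where "x = s * of_real (exp (\<psi> z / 2)) * (l * E z l $ i $ 1)"
  define y where "y = s * of_real (exp (\<psi> z / 2)) * (inverse l * E z l $ i $ 2)"
  have xy: "(E z l ** mc_form H \<psi> U l z V) $ i $ 3 = V * x + cnj V * y" for V
    by (simp add: matrix_mult_nth mc_form_nth mcA_eq mcB_eq s_def x_def y_def algebra_simps)
  have "(- \<kappa> * (1 * x + cnj 1 * y) - \<i> * (- \<kappa> * (\<i> * x + cnj \<i> * y))) / 2 = - \<kappa> * x"
    "(- \<kappa> * (1 * x + cnj 1 * y) + \<i> * (- \<kappa> * (\<i> * x + cnj \<i> * y))) / 2 = - \<kappa> * y" for \<kappa>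
    by (simp_all add: algebra_simps)
  then have wz: "wirt_z (\<lambda>w. assoc_family H E l w $ i) z = - inverse (of_real H) * (s * of_real (exp (\<psi> z / 2))) * (l * E z l $ i $ 1)"
    and wzb: "wirt_zb (\<lambda>w. assoc_family H E l w $ i) z = - inverse (of_real H) * (s * of_real (exp (\<psi> z / 2))) * (inverse l * E z l $ i $ 2)"
    unfolding wirt_z_def wirt_zb_def dr xy by (simp_all only: x_def y_def mult.assoc)
  show "k * wirt_z_vec (assoc_family H E l) z $ i = l * E z l $ i $ 1"
    unfolding wirt_z_vec_def vec_lambda_beta wz mult.assoc[of k, symmetric] using k by (simp add: mult.assoc[symmetric])
  show "k * wirt_zb_vec (assoc_family H E l) z $ i = inverse l * E z l $ i $ 2"
    unfolding wirt_zb_vec_def vec_lambda_beta wzb mult.assoc[of k, symmetric] using k by (simp add: mult.assoc[symmetric])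
  show "of_real H * assoc_family H E l z $ i = - E z l $ i $ 3"
    unfolding r using H0 by simp
qed

text \<open>In \<open>h\<close>^-1 \<open>Et\<close> the loop \<open>h\<close> cancels and
  \<open>E ht\<close>^-1 remains. The diagonal factor of \<open>ht\<close> fixes \<open>e3\<close>,
  so \<open>dt\<close> disappears from the formula.\<close>

lemma new_sphere_formula:
  assumes z: "z \<in> D" and l: "l \<in> S"
  shows "matrix_inv (h l) *v (Et z l *v e3) = new_sphere (of_real H) (2 * csqrt (- of_real H / 2) * of_real (exp (- \<psi> z / 2)))
            \<alpha> (bt1 z) (ct1 z) (bt2 z) (ct2 z) l (assoc_family H E l z)
            (wirt_z_vec (assoc_family H E l) z) (wirt_zb_vec (assoc_family H E l) z)"
proof -
  have l0: "l \<noteq> 0" "l \<in> - K" using l by (auto simp: S_def)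
  define a where "a = cnj \<alpha>"
  have a: "a \<noteq> 0" "\<beta> = inverse a" using alpha by (auto simp: a_def \<beta>_def)
  have nz: "l^3 + \<alpha>^3 \<noteq> 0" "l^3 * a^3 + 1 \<noteq> 0"
  proof -
    show "l^3 + \<alpha>^3 \<noteq> 0" using l by (auto simp: S_iff eq_neg_iff_add_eq_0)
    have "l^3 \<noteq> - (inverse a ^ 3)" using l a by (simp add: S_iff)
    then show "l^3 * a^3 + 1 \<noteq> 0" using a(1) by (auto simp: field_simps eq_neg_iff_add_eq_0)
  qed
  define W where "W = dual (gfac (inverse a) (bt2 z) (ct2 z) (-l)) ** dual (gfac \<alpha> (bt1 z) (ct1 z) (-l))"
  note co = sphere_coefficients[OF a(1) bct2[OF z] nz, of "bt1 z" "ct1 z", folded W_def]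
  have "matrix_inv (h l) ** Et z l = dual (h (-l)) ** (h l ** E z l ** dual (ht z (-l)))"
    using matrix_inv_eq[OF h_inverse(1)[OF l0(2)]] by (simp add: Et_X[OF z l] X_def)
  also have "\<dots> = E z l ** dual (ht z (-l))"
    by (simp add: matrix_mul_assoc h_inverse(2)[OF l0(2)] matrix_mul_lid)
  also have "dual (ht z (-l)) = W ** Adiag (inverse (of_real (dt z)))"
    by (simp add: ht_eq W_def dual_mult dual_Adiag a(2) matrix_mul_assoc)
  finally have 1: "matrix_inv (h l) ** Et z l = E z l ** (W ** Adiag (inverse (of_real (dt z))))" .
  have "(matrix_inv (h l) *v (Et z l *v e3)) $ i = E z l $ i $ 1 * W $ 1 $ 3 + E z l $ i $ 2 * W $ 2 $ 3 + E z l $ i $ 3 * W $ 3 $ 3" for i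
  proof -
    have "(M *v e3) $ i = M $ i $ 3" for M :: "complex^3^3"
      by (simp add: matrix_vector_mult_def sum_3 e3_def)
    then have "(matrix_inv (h l) *v (Et z l *v e3)) $ i = (E z l ** (W ** Adiag (inverse (of_real (dt z))))) $ i $ 3"
      by (simp add: matrix_vector_mul_assoc 1)
    then show ?thesis by (simp add: matrix_mult_nth Adiag_def)
  qed
  moreover define R1 R2 R3 where "R1 = (\<lambda>i. E z l $ i $ 1)" and "R2 = (\<lambda>i. E z l $ i $ 2)" and "R3 = (\<lambda>i. E z l $ i $ 3)"
  ultimately have 2: "(matrix_inv (h l) *v (Et z l *v e3)) $ i = R1 i * W $ 1 $ 3 + R2 i * W $ 2 $ 3 + R3 i * W $ 3 $ 3" for i
    by simp
  define k where "k = 2 * csqrt (- of_real H / 2) * complex_of_real (exp (- \<psi> z / 2))"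
  define r where "r = assoc_family H E l z"
  define rz where "rz = wirt_z_vec (assoc_family H E l) z"
  define rzb where "rzb = wirt_zb_vec (assoc_family H E l) z"
  have K: "k * rz $ i = l * R1 i" "k * rzb $ i = inverse l * R2 i" "of_real H * r $ i = - R3 i" for i
    using assoc_family_wirt[OF z l0(1), of i, folded k_def r_def rz_def rzb_def] by (simp_all add: R1_def R2_def R3_def)
  \<comment> \<open>The second and third coefficients are rewritten to the form in which
    \<open>sphere_coefficients\<close> provides them.\<close>
  have W2: "W $ 2 $ 3 = inverse l * (l * W $ 2 $ 3)" using l0(1) by simp
  have W3: "W $ 3 $ 3 = - (- W $ 3 $ 3)" by simp
  have "(matrix_inv (h l) *v (Et z l *v e3)) $ i = new_sphere (of_real H) k \<alpha> (bt1 z) (ct1 z) (bt2 z) (ct2 z) l r rz rzb $ i" for i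
  proof -
    define p where "p = \<alpha> * l^3 * bt1 z / ((l^3 * a^3 + 1) * (2*bt2 z*ct2 z - 1) * (l^3 + \<alpha>^3))"
    define q where "q = \<alpha>^2 * ct1 z / ((l^3 * a^3 + 1) * (l^3 + \<alpha>^3))"
    define s where "s = (- (l^3) + \<alpha>^3) / ((l^3 * a^3 + 1) * (l^3 + \<alpha>^3))"
    have "new_sphere (of_real H) k \<alpha> (bt1 z) (ct1 z) (bt2 z) (ct2 z) l r rz rzb $ i =
      p * ((- 2 * (l^3 * a^3 * (2*bt2 z*ct2 z - 1) - 1)) * (k * rzb $ i) + (4 * a^2 * (ct2 z)^2) * (k * rz $ i)
         + (4 * a * ct2 z) * (of_real H * r $ i))
      + q * ((4 * a * l^3 * (bt2 z)^2) * (k * rzb $ i) + (2 * (l^3 * a^3 + 1 - 2*bt2 z*ct2 z)) * (k * rz $ i)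
         + (4 * a^2 * l^3 * bt2 z) * (of_real H * r $ i))
      + s * ((2 * a^2 * l^3 * bt2 z) * (k * rzb $ i) - (2 * a * ct2 z) * (k * rz $ i) + (l^3 * a^3 - 1) * (of_real H * r $ i))"
      unfolding new_sphere_def Let_def a_def[symmetric] p_def[symmetric] q_def[symmetric] s_def[symmetric]
      by (simp add: algebra_simps)
    then show ?thesis
      unfolding 2 K
      by (subst W2, subst W3) (simp only: co[folded p_def q_def s_def], simp add: algebra_simps)
  qed
  then show ?thesis by (simp add: vec_eq_iff k_def r_def rz_def rzb_def)
qed

end

theorem theorem5p5:
  fixes H r0 :: real
    and D :: "complex set"
    and \<psi> \<psi>t dt :: "complex \<Rightarrow> real"
    and U :: "complex \<Rightarrow> complex"
    and f :: "complex \<Rightarrow> real^3"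
    and E :: "complex \<Rightarrow> complex \<Rightarrow> complex^3^3"
    and \<alpha> d b1 c1 b2 c2 :: complex
    and h :: "complex \<Rightarrow> complex^3^3"
    and bt1 ct1 bt2 ct2 :: "complex \<Rightarrow> complex"
    and ht :: "complex \<Rightarrow> complex \<Rightarrow> complex^3^3"
  assumes H: "H \<in> {2, -2}"
    and D: "open D" "simply_connected D" "0 \<in> D"
    and sphere: "definite_affine_sphere D H \<psi> U f"
    and frame: "extended_frame D H \<psi> U E"
    and normalized: "\<And>l. l \<noteq> 0 \<Longrightarrow> E 0 l = mat 1"
    and alpha: "\<alpha> \<noteq> 0" "cmod \<alpha> \<noteq> 1"
    and r0: "0 < r0" "r0 < 1" "r0 < cmod \<alpha>" "cmod \<alpha> < 1 / r0"
    and lines: "\<not> cline b1 c1 \<subseteq> Delta" "\<not> cline b2 c2 \<subseteq> Delta"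
    and d: "d \<noteq> 0"
    and h_def: "h = dressing \<alpha> d b1 c1 b2 c2"
    and h_loop: "loop_GL H r0 h"
    and line2: "\<And>z. z \<in> D \<Longrightarrow>
          line_mult (cline b2 c2) (E z (inverse (cnj \<alpha>))) = cline (bt2 z) (ct2 z)"
    and line1: "\<And>z. z \<in> D \<Longrightarrow>
          line_mult (cline b1 c1)
            (gfac (inverse (cnj \<alpha>)) b2 c2 \<alpha> ** E z \<alpha>
               ** matrix_inv (gfac (inverse (cnj \<alpha>)) (bt2 z) (ct2 z) \<alpha>))
          = cline (bt1 z) (ct1 z)"
    and linet_Delta: "\<And>z. z \<in> D \<Longrightarrow> \<not> cline (bt1 z) (ct1 z) \<subseteq> Delta"
          "\<And>z. z \<in> D \<Longrightarrow> \<not> cline (bt2 z) (ct2 z) \<subseteq> Delta"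
    and pos: "\<And>z. z \<in> D \<Longrightarrow> (2 * bt1 z * ct1 z - 1) * (2 * bt2 z * ct2 z - 1) \<in> \<real> \<and>
          0 < Re ((2 * bt1 z * ct1 z - 1) * (2 * bt2 z * ct2 z - 1))"
    and dt_def: "dt = (\<lambda>z. sqrt (Re ((2 * bt1 z * ct1 z - 1) * (2 * bt2 z * ct2 z - 1))))"
    and ht_def: "ht = (\<lambda>z. dressing \<alpha> (of_real (dt z)) (bt1 z) (ct1 z) (bt2 z) (ct2 z))"
    and psit_def: "\<psi>t = (\<lambda>z. \<psi> z + ln ((dt z)\<^sup>2))"
  shows "\<exists>Et :: complex \<Rightarrow> complex \<Rightarrow> complex^3^3. \<exists>rt :: complex \<Rightarrow> complex \<Rightarrow> complex^3.
     \<comment> \<open>(i) the factorization\<close>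
     (\<forall>z\<in>D. loop_SL H (Et z) \<and> loop_GL H r0 (ht z) \<and>
        (\<forall>l. l \<noteq> 0 \<longrightarrow> l^3 \<noteq> \<alpha>^3 \<longrightarrow> l^3 \<noteq> inverse (cnj \<alpha>)^3 \<longrightarrow>
           h l ** E z l = Et z l ** ht z l)) \<and>
     \<comment> \<open>(ii), (iii) \<open>Et\<close> is the extended frame with the new data \<open>\<psi>t, U, H\<close>\<close>
     extended_frame D H \<psi>t U Et \<and>
     (\<forall>z\<in>D. exp (\<psi>t z) = (dt z)\<^sup>2 * exp (\<psi> z)) \<and>
     \<comment> \<open>(ii) the new sphere and its explicit formula\<close>
     rt = (\<lambda>l z. Nmat H *v (matrix_inv (h l) *v (Et z l *v e3))) \<and>
     (\<forall>l. cmod l = 1 \<longrightarrow>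
        (\<exists>M ft. invertible M \<and> definite_affine_sphere D H \<psi>t (\<lambda>z. l^3 * U z) ft \<and>
           (\<forall>z\<in>D. (\<chi> i. complex_of_real (ft z $ i)) = M *v rt l z))) \<and>
     (\<forall>z\<in>D. \<forall>l. l \<noteq> 0 \<longrightarrow> l^3 \<notin> {\<alpha>^3, - (\<alpha>^3), inverse (cnj \<alpha>)^3, - (inverse (cnj \<alpha>)^3)} \<longrightarrow>
        rt l z = Nmat H *v
          new_sphere (of_real H)
            (2 * csqrt (- of_real H / 2) * of_real (exp (- \<psi> z / 2)))
            \<alpha> (bt1 z) (ct1 z) (bt2 z) (ct2 z) l
            (assoc_family H E l z)
            (wirt_z_vec (assoc_family H E l) z)
            (wirt_zb_vec (assoc_family H E l) z))"
proof -
  have H': "H = 2 \<or> H = -2" using H by auto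
  interpret X: dressing_data H r0 D \<psi> U E \<alpha> d b1 c1 b2 c2 bt1 ct1 bt2 ct2
  proof unfold_locales
    show "smooth_on D \<psi>" using sphere by (simp add: definite_affine_sphere_def)
    show "loop_GL H r0 (dressing \<alpha> d b1 c1 b2 c2)" using h_loop by (simp add: h_def)
    show "2 * b1 * c1 \<noteq> 1" "2 * b2 * c2 \<noteq> 1" using lines cline_not_Delta by auto
    show "2 * bt1 z * ct1 z \<noteq> 1" "2 * bt2 z * ct2 z \<noteq> 1" if "z \<in> D" for z
      using linet_Delta[OF that] cline_not_Delta by auto
    show "line_rel (E z (inverse (cnj \<alpha>))) b2 c2 (bt2 z) (ct2 z)" if "z \<in> D" for z
      by (rule line_relI[OF line2[OF that]])
    show "line_rel (gfac (inverse (cnj \<alpha>)) b2 c2 \<alpha> ** E z \<alpha> ** matrix_inv (gfac (inverse (cnj \<alpha>)) (bt2 z) (ct2 z) \<alpha>))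
        b1 c1 (bt1 z) (ct1 z)" if "z \<in> D" for z
      by (rule line_relI[OF line1[OF that]])
  qed (use H' D frame alpha r0 d pos in auto)
  obtain Et where Et: "smooth_on (D \<times> (- {0})) (\<lambda>(z, l). Et z l)"
    "\<And>z. z \<in> D \<Longrightarrow> mat_holomorphic_on (Et z) (- {0})" "\<And>z l. z \<in> D \<Longrightarrow> l \<in> X.S \<Longrightarrow> Et z l = X.X z l"
    using X.extension_exists by blast
  interpret Y: dressing_result H r0 D \<psi> U E \<alpha> d b1 c1 b2 c2 bt1 ct1 bt2 ct2 Et
    using Et by unfold_locales
  have hh: "h = X.h" by (simp add: h_def X.h_def)
  have dd: "dt = X.dt" by (rule ext) (simp add: dt_def X.dt_def)
  have tt: "ht = X.ht" by (rule ext) (simp add: ht_def X.ht_def dd)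
  have pp: "\<psi>t = Y.\<psi>t" by (rule ext) (simp add: psit_def Y.\<psi>t_def dd)
  have bb: "inverse (cnj \<alpha>) = X.\<beta>" by (simp add: X.\<beta>_def)
  define rt where "rt = (\<lambda>l z. Nmat H *v (matrix_inv (h l) *v (Et z l *v e3)))"
  have N: "invertible (Nmat H)"
  proof -
    have "complex_of_real (sqrt 2) \<noteq> 0" "csqrt (of_real H / 2) \<noteq> 0" using H' by auto
    then show ?thesis by (simp add: invertible_det_nz det_3 Nmat_def)
  qed
  have "\<exists>M ft. invertible M \<and> definite_affine_sphere D H \<psi>t (\<lambda>z. l^3 * U z) ft \<and>
      (\<forall>z\<in>D. (\<chi> i. complex_of_real (ft z $ i)) = M *v rt l z)" if l: "cmod l = 1" for l
  proof -
    obtain M ft where M: "invertible M" "definite_affine_sphere D H \<psi>t (\<lambda>z. l^3 * U z) ft"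
      "\<And>z. z \<in> D \<Longrightarrow> (\<chi> i. complex_of_real (ft z $ i)) = M *v (Et z l *v e3)"
      using affine_sphere_of_frame[OF H' D(1) Y.psit_smooth Y.Et_frame l] by (auto simp: pp)
    \<comment> \<open>The poles are off the unit circle, so \<open>h l\<close> is invertible and can
      be absorbed into the constant linear transformation.\<close>
    have "l \<in> - X.K" by (rule X.unit_K[OF l])
    then have hi: "invertible (h l)" using X.h_inverse by (auto simp: hh invertible_def)
    \<comment> \<open>Undoes \<open>N h\<close>^-1 in the definition of \<open>rt\<close>; it does
      not depend on \<open>z\<close>, so it is a constant transformation of the sphere.\<close>
    define M' where "M' = M ** h l ** matrix_inv (Nmat H)"
    have "invertible M'"
      unfolding M'_def using M(1) hi matrix_inv_right_inverse[OF N]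
      by (intro invertible_mult) (auto simp: invertible_def)
    moreover have "M' *v rt l z = M *v (Et z l *v e3)" for z
    proof -
      have "M' ** (Nmat H ** matrix_inv (h l)) = M ** (h l ** (matrix_inv (Nmat H) ** Nmat H) ** matrix_inv (h l))"
        by (simp add: M'_def matrix_mul_assoc)
      then have "M' ** (Nmat H ** matrix_inv (h l)) = M"
        by (simp add: matrix_inv_right_inverse[OF N] matrix_inv_right_inverse[OF hi] matrix_mul_rid)
      then show ?thesis unfolding rt_def by (simp add: matrix_vector_mul_assoc matrix_mul_assoc)
    qed
    ultimately show ?thesis using M(2,3) by metis
  qed
  moreover have "rt l z = Nmat H *v
          new_sphere (of_real H) (2 * csqrt (- of_real H / 2) * of_real (exp (- \<psi> z / 2)))
            \<alpha> (bt1 z) (ct1 z) (bt2 z) (ct2 z) l (assoc_family H E l z)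
            (wirt_z_vec (assoc_family H E l) z) (wirt_zb_vec (assoc_family H E l) z)"
    if "z \<in> D" "l \<noteq> 0" "l^3 \<notin> {\<alpha>^3, - (\<alpha>^3), inverse (cnj \<alpha>)^3, - (inverse (cnj \<alpha>)^3)}" for z l
  proof -
    have "l \<in> X.S" using that unfolding bb X.S_iff by blast
    from Y.new_sphere_formula[OF that(1) this] show ?thesis by (simp add: rt_def hh)
  qed
  moreover have "h l ** E z l = Et z l ** ht z l" if "z \<in> D" "l \<noteq> 0" "l^3 \<noteq> \<alpha>^3" "l^3 \<noteq> inverse (cnj \<alpha>)^3" for z l
    using Y.factorization[OF that(1,2,3)] that(4) unfolding bb hh tt by blast
  ultimately show ?thesis
    using Y.Et_loop Y.ht_loop Y.Et_frame Y.exp_psit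
    by (intro exI[of _ Et] exI[of _ rt] conjI ballI allI impI rt_def) (auto simp: tt pp dd)
qed

end
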